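(* Let $\boldsymbol{\Phi}=\{\Phi_k\}_{k\ge1}$ be a non-autonomous conformal iterated function system (NCIFS) in $\mathbb{R}^d$ satisfying the open set condition and $\lim_{k\to\infty}\frac{\log \underline c_k}{\log M_k}=0$, and let $\mu$ be a positive finite Borel measure on $\Sigma^\infty$. If the image measure $\mu^\omega$ of $\mu$ satisfies the bounded overlap condition, then for $q>1$, $$\underline{D}_q(\mu^\omega)=\underline{d}_q=\underline{d}_q^*,$$ and for $0<q<1$, $$\overline{D}_q(\mu^\omega)=\overline{d}_q=\overline{d}_q^*.$$
   Context: Words. $\{I_k\}_{k\ge1}$ is a sequence of finite index sets with $\#I_k\ge 2$. For $1\le l\le k$, $\Sigma_l^k=\{u_l u_{l+1}\ldots u_k: u_j\in I_j\}$, $\Sigma^k=\Sigma_1^k$, $\Sigma^0=\{\emptyset\}$ (empty word), $\Sigma^*=\bigcup_{k\ge0}\Sigma^k$, $\Sigma^\infty=\{u_1u_2\ldots: u_k\in I_k\}$. $|\mathbf u|$ is the length of $\mathbf u$; for $\mathbf u=u_1\ldots u_k$ with $k\ge1$, $\mathbf u^*=u_1\ldots u_{k-1}$; $\mathbf u|_n$ is the prefix of length $n$. $[\mathbf u]=\{\mathbf v\in\Sigma^\infty:\mathbf u\text{ is a prefix of }\mathbf v\}$. $\Sigma^\infty$ has the metric $d(\mathbf u,\mathbf v)=2^{-|\mathbf u\wedge\mathbf v|}$, with $\mathbf u\wedge\mathbf v$ the longest common prefix. NCIFS. $J\subset\mathbb{R}^d$ is compact with non-empty interior and $\overline{\mathrm{int}(J)}=J$;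 for each $k\ge1$, $\Phi_k=\{\varphi_{k,i}\}_{i\in I_k}$ is a family of maps $\varphi_{k,i}:J\to J$. For $\mathbf u=u_l\ldots u_k\in\Sigma_l^k$, $\varphi_{\mathbf u}=\varphi_{l,u_l}\circ\cdots\circ\varphi_{k,u_k}$ ($\varphi_\emptyset$ is the identity). $\boldsymbol\Phi$, together with closed sets $J_{\mathbf u}\subset J$ ($\mathbf u\in\Sigma^*$, $J_\emptyset=J$), is an NCIFS if: (i) there is $0<c<1$ with $|\varphi_{k,i}(x)-\varphi_{k,i}(y)|\le c|x-y|$ for all $k$, $i\in I_k$, $x,y\in J$; (ii) for all $k\ge1$, $\mathbf u\in\Sigma^{k-1}$, $i\in I_k$: $J_{\mathbf ui}\subset J_{\mathbf u}$; (iii) for each $\mathbf u\in\Sigma^*$ there is $\omega_{\mathbf u}\in\mathbb{R}^d$ with $J_{\mathbf u}=\Psi_{\mathbf u}(J)=\varphi_{\mathbf u}(J)+\omega_{\mathbf u}$, where $\Psi_{\mathbf u}=\varphi_{\mathbf u}+\omega_{\mathbf u}$; (iv) there is an open connected set $V\supset J$, independent of $k$, such that each $\varphi_{k,j}$ extends to a $C^1$ conformal diffeomorphism of $V$ into $V$; (v) there is $C\ge1$ with $\|D\varphi_{\mathbf u}(x)\|\le C\|D\varphi_{\mathbf u}(y)\|$ for all $l\le k$, $\mathbf u\in\Sigma_l^k$, $x,y\in V$. Put $\|D\varphi_{\mathbf u}\|=\sup_{x\in J}\|D\varphi_{\mathbf u}(x)\|$, $M_k=\max_{\mathbf u\in\Sigma^k}\|D\varphi_{\mathbf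 u}\|$, $\underline c_k=\min_{j\in I_k}\|D\varphi_{k,j}\|$. The attractor is $E=\bigcap_{k\ge1}\bigcup_{\mathbf u\in\Sigma^k}J_{\mathbf u}$. Open set condition: for all $k\ge0$, $\mathbf u\in\Sigma^k$ and $i\ne j\in I_{k+1}$, $\mathrm{int}(J_{\mathbf ui})\cap\mathrm{int}(J_{\mathbf uj})=\emptyset$. Image measure. $\pi(\mathbf u)=\bigcap_{n\ge1}J_{\mathbf u|_n}$ (a single point) defines $\pi:\Sigma^\infty\to J$ with $\pi(\Sigma^\infty)=E$, and $\mu^\omega(A)=\mu\{\mathbf u:\pi(\mathbf u)\in A\}$. The bounded overlap condition: there is $C\ge1$ with $C^{-1}\mu^\omega(J_{\mathbf u})\le\mu([\mathbf u])\le C\mu^\omega(J_{\mathbf u})$ for all $\mathbf u\in\Sigma^*$. Generalized $q$-dimensions ($q\neq 1$). For a positive finite Borel measure $\nu$ on $\mathbb{R}^d$, let $\mathcal M_\delta$ be the family of $\delta$-mesh cubes $\prod_{j=1}^d[m_j\delta,(m_j+1)\delta)$, $m_j\in\mathbb{Z}$. $\underline D_q(\nu)$ and $\overline D_q(\nu)$ are the $\liminf$ and $\limsup$ as $\delta\to0$ of $\frac{\log\sum_{Q\in\mathcal M_\delta}\nu(Q)^q}{(q-1)\log\delta}$. Pressures ($q>0$, $q\ne1$, $t\in\mathbb{R}$). $\mathcal C(\delta)=\{\mathbf u\in\Sigma^*:\|D\varphi_{\mathbf u}\|\le\delta<\|D\varphi_{\mathbf u^*}\|\}$, $k_\delta=\min\{|\mathbf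 u|:\mathbf u\in\mathcal C(\delta)\}$. $\overline P_\mu(t,q)$ and $\underline P_\mu(t,q)$ are the $\limsup$ and $\liminf$ as $\delta\to0$ of $\frac{\mathrm{sgn}(1-q)}{k_\delta}\log\sum_{\mathbf u\in\mathcal C(\delta)}\|D\varphi_{\mathbf u}\|^{t(1-q)}\mu([\mathbf u])^q$. $\overline P^\mu(t,q)$ and $\underline P^\mu(t,q)$ are the $\limsup$ and $\liminf$ as $k\to\infty$ of $\frac{\mathrm{sgn}(1-q)}{k}\log\sum_{\mathbf u\in\Sigma^k}\|D\varphi_{\mathbf u}\|^{t(1-q)}\mu([\mathbf u])^q$. Jump points (possibly $\pm\infty$): $\overline d_q^*=\inf\{t:\overline P_\mu(t,q)<0\}=\sup\{t:\overline P_\mu(t,q)>0\}$, $\underline d_q^*=\inf\{t:\underline P_\mu(t,q)<0\}=\sup\{t:\underline P_\mu(t,q)>0\}$, $\overline d_q=\inf\{t:\overline P^\mu(t,q)<0\}=\sup\{t:\overline P^\mu(t,q)>0\}$, $\underline d_q=\inf\{t:\underline P^\mu(t,q)<0\}=\sup\{t:\underline P^\mu(t,q)>0\}$. *)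

theory Defs
  imports "HOL-Analysis.Analysis"
begin

section \<open>Words\<close>

text \<open>
  The word \<open>u\<^sub>l u\<^bsub>l+1\<^esub> \<dots> u\<^sub>k\<close> is the list \<open>[u\<^sub>l, \<dots>, u\<^sub>k]\<close>; the starting level \<open>l\<close> is not
  recorded in the list and is passed separately wherever it matters. Levels start at 1, so
  \<open>words I 1 0 = {[]}\<close>, and the value \<open>I 0\<close> is never used. Infinite words are extensional functions
  on \<open>{1..}\<close>, so that equality of words is equality of functions.
\<close>

definition words :: "(nat \<Rightarrow> 'i set) \<Rightarrow> nat \<Rightarrow> nat \<Rightarrow> 'i list set" where
  "words I l k = {u. length u = Suc k - l \<and> (\<forall>n < length u. u ! n \<in> I (l + n))}"

definition fin_words :: "(nat \<Rightarrow> 'i set) \<Rightarrow> 'i list set" where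
  "fin_words I = (\<Union>k. words I 1 k)"

definition inf_words :: "(nat \<Rightarrow> 'i set) \<Rightarrow> (nat \<Rightarrow> 'i) set" where
  "inf_words I = (\<Pi>\<^sub>E k\<in>{1..}. I k)"

definition word_prefix :: "(nat \<Rightarrow> 'i) \<Rightarrow> nat \<Rightarrow> 'i list" where
  "word_prefix u n = map u [1..<Suc n]"

definition cylinder :: "(nat \<Rightarrow> 'i set) \<Rightarrow> 'i list \<Rightarrow> (nat \<Rightarrow> 'i) set" where
  "cylinder I u = {v \<in> inf_words I. word_prefix v (length u) = u}"

definition word_dist :: "(nat \<Rightarrow> 'i) \<Rightarrow> (nat \<Rightarrow> 'i) \<Rightarrow> real" where
  "word_dist u v =
    (if u = v then 0 else (1/2) ^ (GREATEST n. word_prefix u n = word_prefix v n))"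

definition word_borel :: "(nat \<Rightarrow> 'i set) \<Rightarrow> (nat \<Rightarrow> 'i) measure" where
  "word_borel I =
    sigma (inf_words I) {U. openin (Metric_space.mtopology (inf_words I) word_dist) U}"

lemma word_prefix_eq_iff:
  "word_prefix u n = word_prefix v n \<longleftrightarrow> (\<forall>k\<in>{1..n}. u k = v k)"
  unfolding word_prefix_def by (auto simp: atLeastLessThanSuc_atLeastAtMost)

lemma inf_words_neqE:
  assumes "u \<in> inf_words I" "v \<in> inf_words I" "u \<noteq> v"
  obtains b where "\<And>n. word_prefix u n = word_prefix v n \<Longrightarrow> n \<le> b"
proof -
  obtain k where k: "k \<in> {1..}" "u k \<noteq> v k"
    using assms PiE_ext[of u "{1..}" I v] by (auto simp: inf_words_def)
  have "n \<le> k" if "word_prefix u n = word_prefix v n" for n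
  proof (rule ccontr)
    assume "\<not> n \<le> k"
    then have "k \<in> {1..n}" using k(1) by auto
    then show False using that k(2) unfolding word_prefix_eq_iff by blast
  qed
  then show thesis using that by blast
qed

lemma word_prefix_Greatest:
  assumes "u \<in> inf_words I" "v \<in> inf_words I" "u \<noteq> v"
  defines "N \<equiv> GREATEST n. word_prefix u n = word_prefix v n"
  shows "word_prefix u N = word_prefix v N"
    and "\<And>n. word_prefix u n = word_prefix v n \<Longrightarrow> n \<le> N"
proof -
  obtain b where b: "\<And>n. word_prefix u n = word_prefix v n \<Longrightarrow> n \<le> b"
    using inf_words_neqE[OF assms(1-3)] by blast
  have 0: "word_prefix u 0 = word_prefix v 0"
    by (simp add: word_prefix_def)
  show "word_prefix u N = word_prefix v N"
    unfolding N_def by (rule GreatestI_nat[where P = "\<lambda>n. word_prefix u n = word_prefix v n" and k = 0 and b = b])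
      (simp_all add: 0 b)
  show "n \<le> N" if n: "word_prefix u n = word_prefix v n" for n
    unfolding N_def by (rule Greatest_le_nat[where P = "\<lambda>n. word_prefix u n = word_prefix v n" and b = b])
      (simp_all add: n b)
qed

lemma Metric_space_word_dist: "Metric_space (inf_words I) word_dist"
proof
  fix x y :: "nat \<Rightarrow> 'a"
  show "0 \<le> word_dist x y" by (simp add: word_dist_def)
  show "word_dist x y = word_dist y x" by (simp add: word_dist_def eq_commute)
  show "(word_dist x y = 0) = (x = y)" by (simp add: word_dist_def)
next
  fix x y z assume mem: "x \<in> inf_words I" "y \<in> inf_words I" "z \<in> inf_words I"
  show "word_dist x z \<le> word_dist x y + word_dist y z"
  proof (cases "x = y \<or> y = z \<or> x = z")
    case True
    then show ?thesis by (auto simp: word_dist_def)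
  next
    case False
    define L where "L u v = (GREATEST n. word_prefix u n = word_prefix v n)" for u v :: "nat \<Rightarrow> 'a"
    have xy: "word_prefix x (L x y) = word_prefix y (L x y)"
      and yz: "word_prefix y (L y z) = word_prefix z (L y z)"
      using word_prefix_Greatest(1)[of x I y] word_prefix_Greatest(1)[of y I z] mem False
      unfolding L_def by blast+
    have "x k = z k" if "k \<in> {1..min (L x y) (L y z)}" for k
    proof -
      have "k \<in> {1..L x y}" "k \<in> {1..L y z}" using that by auto
      then show ?thesis using xy yz unfolding word_prefix_eq_iff by metis
    qed
    then have "word_prefix x (min (L x y) (L y z)) = word_prefix z (min (L x y) (L y z))"
      unfolding word_prefix_eq_iff by blast
    then have "min (L x y) (L y z) \<le> L x z"
      using word_prefix_Greatest(2)[of x I z] mem False unfolding L_def by blast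
    then have "(1/2::real) ^ L x z \<le> (1/2) ^ min (L x y) (L y z)"
      by (intro power_decreasing) auto
    also have "\<dots> \<le> (1/2) ^ L x y + (1/2) ^ L y z"
      by (simp add: min_def)
    finally show ?thesis using False by (simp add: word_dist_def L_def)
  qed
qed


section \<open>Non-autonomous conformal iterated function systems\<close>

definition C1_on :: "('a::real_normed_vector \<Rightarrow> 'b::real_normed_vector) \<Rightarrow> 'a set \<Rightarrow> bool" where
  "C1_on f S \<longleftrightarrow> (\<exists>f' :: 'a \<Rightarrow> 'a \<Rightarrow>\<^sub>L 'b.
     (\<forall>x\<in>S. (f has_derivative blinfun_apply (f' x)) (at x)) \<and> continuous_on S f')"

definition conformal_at :: "('a::real_inner \<Rightarrow> 'a) \<Rightarrow> 'a \<Rightarrow> bool" where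
  "conformal_at f x \<longleftrightarrow>
    (\<exists>r>0. \<exists>T. orthogonal_transformation T \<and> (f has_derivative (\<lambda>h. r *\<^sub>R T h)) (at x))"

definition C1_conformal_diffeo_into :: "'a::real_inner set \<Rightarrow> ('a \<Rightarrow> 'a) \<Rightarrow> bool" where
  "C1_conformal_diffeo_into V f \<longleftrightarrow>
     f ` V \<subseteq> V \<and> open (f ` V) \<and> C1_on f V \<and>
     (\<exists>g. C1_on g (f ` V) \<and> (\<forall>x\<in>V. g (f x) = x)) \<and>
     (\<forall>x\<in>V. conformal_at f x)"

fun word_map :: "(nat \<Rightarrow> 'i \<Rightarrow> 'a \<Rightarrow> 'a) \<Rightarrow> nat \<Rightarrow> 'i list \<Rightarrow> 'a \<Rightarrow> 'a" where
  "word_map \<phi> l [] = id"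
| "word_map \<phi> l (i # u) = \<phi> l i \<circ> word_map \<phi> (Suc l) u"

definition deriv_norm :: "('a::real_normed_vector \<Rightarrow> 'a) \<Rightarrow> 'a \<Rightarrow> real" where
  "deriv_norm f x = onorm (frechet_derivative f (at x))"

definition sup_deriv_norm :: "'a::real_normed_vector set \<Rightarrow> ('a \<Rightarrow> 'a) \<Rightarrow> real" where
  "sup_deriv_norm J f = (SUP x\<in>J. deriv_norm f x)"

text \<open>
  Each \<open>\<phi> k i\<close> is a total function that stands both for the map \<open>J \<rightarrow> J\<close> and for its extension to the
  open set \<open>V\<close>; its values outside \<open>V\<close> are irrelevant. As \<open>J\<close> is the closure of its interior, the
  derivative on \<open>J\<close> does not depend on the choice of the \<open>C\<^sup>1\<close> extension.
\<close>

definition ncifs ::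
  "(nat \<Rightarrow> 'i set) \<Rightarrow> (nat \<Rightarrow> 'i \<Rightarrow> real^'n \<Rightarrow> real^'n) \<Rightarrow> (real^'n) set \<Rightarrow>
   ('i list \<Rightarrow> (real^'n) set) \<Rightarrow> bool" where
  "ncifs I \<phi> J Jw \<longleftrightarrow>
     (\<forall>k\<ge>1. finite (I k) \<and> 2 \<le> card (I k)) \<and>
     compact J \<and> interior J \<noteq> {} \<and> closure (interior J) = J \<and>
     (\<forall>k\<ge>1. \<forall>i\<in>I k. \<phi> k i ` J \<subseteq> J) \<and>
     (\<forall>u\<in>fin_words I. closed (Jw u) \<and> Jw u \<subseteq> J) \<and> Jw [] = J \<and>
     (\<exists>c. 0 < c \<and> c < 1 \<and>
        (\<forall>k\<ge>1. \<forall>i\<in>I k. \<forall>x\<in>J. \<forall>y\<in>J. dist (\<phi> k i x) (\<phi> k i y) \<le> c * dist x y)) \<and>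
     (\<forall>k\<ge>1. \<forall>u\<in>words I 1 (k - 1). \<forall>i\<in>I k. Jw (u @ [i]) \<subseteq> Jw u) \<and>
     (\<forall>u\<in>fin_words I. \<exists>\<omega>. Jw u = (\<lambda>x. word_map \<phi> 1 u x + \<omega>) ` J) \<and>
     (\<exists>V. open V \<and> connected V \<and> J \<subseteq> V \<and>
        (\<forall>k\<ge>1. \<forall>i\<in>I k. C1_conformal_diffeo_into V (\<phi> k i)) \<and>
        (\<exists>C\<ge>1. \<forall>l k. 1 \<le> l \<and> l \<le> k \<longrightarrow>
           (\<forall>u\<in>words I l k. \<forall>x\<in>V. \<forall>y\<in>V.
              deriv_norm (word_map \<phi> l u) x \<le> C * deriv_norm (word_map \<phi> l u) y)))"

definition word_deriv_norm ::
  "(nat \<Rightarrow> 'i \<Rightarrow> 'a \<Rightarrow> 'a) \<Rightarrow> 'a::real_normed_vector set \<Rightarrow> 'i list \<Rightarrow> real" where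
  "word_deriv_norm \<phi> J u = sup_deriv_norm J (word_map \<phi> 1 u)"

definition max_deriv_norm ::
  "(nat \<Rightarrow> 'i set) \<Rightarrow> (nat \<Rightarrow> 'i \<Rightarrow> 'a \<Rightarrow> 'a) \<Rightarrow> 'a::real_normed_vector set \<Rightarrow> nat \<Rightarrow> real" where
  "max_deriv_norm I \<phi> J k = Max (word_deriv_norm \<phi> J ` words I 1 k)"

definition min_level_deriv_norm ::
  "(nat \<Rightarrow> 'i set) \<Rightarrow> (nat \<Rightarrow> 'i \<Rightarrow> 'a \<Rightarrow> 'a) \<Rightarrow> 'a::real_normed_vector set \<Rightarrow> nat \<Rightarrow> real" where
  "min_level_deriv_norm I \<phi> J k = Min ((\<lambda>j. sup_deriv_norm J (\<phi> k j)) ` I k)"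

definition open_set_condition ::
  "(nat \<Rightarrow> 'i set) \<Rightarrow> ('i list \<Rightarrow> 'a::topological_space set) \<Rightarrow> bool" where
  "open_set_condition I Jw \<longleftrightarrow>
     (\<forall>k. \<forall>u\<in>words I 1 k. \<forall>i\<in>I (Suc k). \<forall>j\<in>I (Suc k).
        i \<noteq> j \<longrightarrow> interior (Jw (u @ [i])) \<inter> interior (Jw (u @ [j])) = {})"


section \<open>Image measure\<close>

definition coding_map :: "('i list \<Rightarrow> 'a set) \<Rightarrow> (nat \<Rightarrow> 'i) \<Rightarrow> 'a" where
  "coding_map Jw u = the_elem (\<Inter>n\<in>{1..}. Jw (word_prefix u n))"

definition image_measure ::
  "('i list \<Rightarrow> 'a::topological_space set) \<Rightarrow> (nat \<Rightarrow> 'i) measure \<Rightarrow> 'a measure" where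
  "image_measure Jw \<mu> = distr \<mu> borel (coding_map Jw)"

definition bounded_overlap ::
  "(nat \<Rightarrow> 'i set) \<Rightarrow> ('i list \<Rightarrow> 'a::topological_space set) \<Rightarrow> (nat \<Rightarrow> 'i) measure \<Rightarrow> bool" where
  "bounded_overlap I Jw \<mu> \<longleftrightarrow>
     (\<exists>C\<ge>1. \<forall>u\<in>fin_words I.
        inverse C * measure (image_measure Jw \<mu>) (Jw u) \<le> measure \<mu> (cylinder I u) \<and>
        measure \<mu> (cylinder I u) \<le> C * measure (image_measure Jw \<mu>) (Jw u))"


section \<open>Generalized dimensions\<close>

text \<open>
  For an arbitrary finite measure and \<open>q < 1\<close> the sum over all mesh cubes may be infinite, hence the
  sum in \<^typ>\<open>ennreal\<close> and the extended logarithm.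
\<close>

definition extended_ln :: "ennreal \<Rightarrow> ereal" where
  "extended_ln x = (if x = 0 then - \<infinity> else if x = \<infinity> then \<infinity> else ereal (ln (enn2real x)))"

definition mesh_cubes :: "real \<Rightarrow> (real^'n) set set" where
  "mesh_cubes \<delta> =
    range (\<lambda>m :: 'n \<Rightarrow> int. {x. \<forall>j. of_int (m j) * \<delta> \<le> x $ j \<and> x $ j < (of_int (m j) + 1) * \<delta>})"

definition dim_quotient :: "real \<Rightarrow> (real^'n) measure \<Rightarrow> real \<Rightarrow> ereal" where
  "dim_quotient q \<nu> \<delta> =
    extended_ln (\<Sum>\<^sub>\<infinity>Q\<in>mesh_cubes \<delta>. ennreal (measure \<nu> Q powr q)) / ereal ((q - 1) * ln \<delta>)"

definition lower_gen_dim :: "real \<Rightarrow> (real^'n) measure \<Rightarrow> ereal" where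
  "lower_gen_dim q \<nu> = Liminf (at_right 0) (dim_quotient q \<nu>)"

definition upper_gen_dim :: "real \<Rightarrow> (real^'n) measure \<Rightarrow> ereal" where
  "upper_gen_dim q \<nu> = Limsup (at_right 0) (dim_quotient q \<nu>)"


section \<open>Pressures and their jump points\<close>

definition cut_set ::
  "(nat \<Rightarrow> 'i set) \<Rightarrow> (nat \<Rightarrow> 'i \<Rightarrow> 'a \<Rightarrow> 'a) \<Rightarrow> 'a::real_normed_vector set \<Rightarrow> real \<Rightarrow> 'i list set" where
  "cut_set I \<phi> J \<delta> = {u \<in> fin_words I. u \<noteq> [] \<and>
     word_deriv_norm \<phi> J u \<le> \<delta> \<and> \<delta> < word_deriv_norm \<phi> J (butlast u)}"

definition cut_level ::
  "(nat \<Rightarrow> 'i set) \<Rightarrow> (nat \<Rightarrow> 'i \<Rightarrow> 'a \<Rightarrow> 'a) \<Rightarrow> 'a::real_normed_vector set \<Rightarrow> real \<Rightarrow> nat" where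
  "cut_level I \<phi> J \<delta> = (LEAST k. \<exists>u\<in>cut_set I \<phi> J \<delta>. length u = k)"

definition pressure_sum ::
  "(nat \<Rightarrow> 'i set) \<Rightarrow> (nat \<Rightarrow> 'i \<Rightarrow> 'a \<Rightarrow> 'a) \<Rightarrow> 'a::real_normed_vector set \<Rightarrow> (nat \<Rightarrow> 'i) measure \<Rightarrow>
   real \<Rightarrow> real \<Rightarrow> 'i list set \<Rightarrow> real" where
  "pressure_sum I \<phi> J \<mu> t q W =
    (\<Sum>u\<in>W. word_deriv_norm \<phi> J u powr (t * (1 - q)) * measure \<mu> (cylinder I u) powr q)"

text \<open>
  For a non-zero finite measure on the infinite words of an NCIFS, the sums below (for \<open>\<delta> < 1\<close>) are
  finite sums with a positive value, so the real logarithm suffices.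
\<close>

definition cut_pressure_term ::
  "(nat \<Rightarrow> 'i set) \<Rightarrow> (nat \<Rightarrow> 'i \<Rightarrow> 'a \<Rightarrow> 'a) \<Rightarrow> 'a::real_normed_vector set \<Rightarrow> (nat \<Rightarrow> 'i) measure \<Rightarrow>
   real \<Rightarrow> real \<Rightarrow> real \<Rightarrow> real" where
  "cut_pressure_term I \<phi> J \<mu> t q \<delta> =
    sgn (1 - q) / real (cut_level I \<phi> J \<delta>) * ln (pressure_sum I \<phi> J \<mu> t q (cut_set I \<phi> J \<delta>))"

definition level_pressure_term ::
  "(nat \<Rightarrow> 'i set) \<Rightarrow> (nat \<Rightarrow> 'i \<Rightarrow> 'a \<Rightarrow> 'a) \<Rightarrow> 'a::real_normed_vector set \<Rightarrow> (nat \<Rightarrow> 'i) measure \<Rightarrow>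
   real \<Rightarrow> real \<Rightarrow> nat \<Rightarrow> real" where
  "level_pressure_term I \<phi> J \<mu> t q k =
    sgn (1 - q) / real k * ln (pressure_sum I \<phi> J \<mu> t q (words I 1 k))"

definition upper_cut_pressure ::
  "(nat \<Rightarrow> 'i set) \<Rightarrow> (nat \<Rightarrow> 'i \<Rightarrow> 'a \<Rightarrow> 'a) \<Rightarrow> 'a::real_normed_vector set \<Rightarrow> (nat \<Rightarrow> 'i) measure \<Rightarrow>
   real \<Rightarrow> real \<Rightarrow> ereal" where
  "upper_cut_pressure I \<phi> J \<mu> t q =
    Limsup (at_right 0) (\<lambda>\<delta>. ereal (cut_pressure_term I \<phi> J \<mu> t q \<delta>))"

definition lower_cut_pressure ::
  "(nat \<Rightarrow> 'i set) \<Rightarrow> (nat \<Rightarrow> 'i \<Rightarrow> 'a \<Rightarrow> 'a) \<Rightarrow> 'a::real_normed_vector set \<Rightarrow> (nat \<Rightarrow> 'i) measure \<Rightarrow>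
   real \<Rightarrow> real \<Rightarrow> ereal" where
  "lower_cut_pressure I \<phi> J \<mu> t q =
    Liminf (at_right 0) (\<lambda>\<delta>. ereal (cut_pressure_term I \<phi> J \<mu> t q \<delta>))"

definition upper_level_pressure ::
  "(nat \<Rightarrow> 'i set) \<Rightarrow> (nat \<Rightarrow> 'i \<Rightarrow> 'a \<Rightarrow> 'a) \<Rightarrow> 'a::real_normed_vector set \<Rightarrow> (nat \<Rightarrow> 'i) measure \<Rightarrow>
   real \<Rightarrow> real \<Rightarrow> ereal" where
  "upper_level_pressure I \<phi> J \<mu> t q =
    limsup (\<lambda>k. ereal (level_pressure_term I \<phi> J \<mu> t q k))"

definition lower_level_pressure ::
  "(nat \<Rightarrow> 'i set) \<Rightarrow> (nat \<Rightarrow> 'i \<Rightarrow> 'a \<Rightarrow> 'a) \<Rightarrow> 'a::real_normed_vector set \<Rightarrow> (nat \<Rightarrow> 'i) measure \<Rightarrow>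
   real \<Rightarrow> real \<Rightarrow> ereal" where
  "lower_level_pressure I \<phi> J \<mu> t q =
    liminf (\<lambda>k. ereal (level_pressure_term I \<phi> J \<mu> t q k))"

text \<open>
  For a pressure \<open>P\<close> of an NCIFS, the jump point also equals \<open>sup {t. P t > 0}\<close>; the infimum over the
  empty set is \<open>\<infinity>\<close>.
\<close>

definition jump_point :: "(real \<Rightarrow> ereal) \<Rightarrow> ereal" where
  "jump_point P = Inf (ereal ` {t. P t < 0})"

definition upper_cut_jump ::
  "(nat \<Rightarrow> 'i set) \<Rightarrow> (nat \<Rightarrow> 'i \<Rightarrow> 'a \<Rightarrow> 'a) \<Rightarrow> 'a::real_normed_vector set \<Rightarrow> (nat \<Rightarrow> 'i) measure \<Rightarrow>
   real \<Rightarrow> ereal" where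
  "upper_cut_jump I \<phi> J \<mu> q = jump_point (\<lambda>t. upper_cut_pressure I \<phi> J \<mu> t q)"

definition lower_cut_jump ::
  "(nat \<Rightarrow> 'i set) \<Rightarrow> (nat \<Rightarrow> 'i \<Rightarrow> 'a \<Rightarrow> 'a) \<Rightarrow> 'a::real_normed_vector set \<Rightarrow> (nat \<Rightarrow> 'i) measure \<Rightarrow>
   real \<Rightarrow> ereal" where
  "lower_cut_jump I \<phi> J \<mu> q = jump_point (\<lambda>t. lower_cut_pressure I \<phi> J \<mu> t q)"

definition upper_level_jump ::
  "(nat \<Rightarrow> 'i set) \<Rightarrow> (nat \<Rightarrow> 'i \<Rightarrow> 'a \<Rightarrow> 'a) \<Rightarrow> 'a::real_normed_vector set \<Rightarrow> (nat \<Rightarrow> 'i) measure \<Rightarrow>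
   real \<Rightarrow> ereal" where
  "upper_level_jump I \<phi> J \<mu> q = jump_point (\<lambda>t. upper_level_pressure I \<phi> J \<mu> t q)"

definition lower_level_jump ::
  "(nat \<Rightarrow> 'i set) \<Rightarrow> (nat \<Rightarrow> 'i \<Rightarrow> 'a \<Rightarrow> 'a) \<Rightarrow> 'a::real_normed_vector set \<Rightarrow> (nat \<Rightarrow> 'i) measure \<Rightarrow>
   real \<Rightarrow> ereal" where
  "lower_level_jump I \<phi> J \<mu> q = jump_point (\<lambda>t. lower_level_pressure I \<phi> J \<mu> t q)"

end

theory Submission
  imports Defs "HOL-Library.Sublist"
begin

text \<open>
  Write \<open>r u\<close> for the derivative norm of the word \<open>u\<close>, \<open>K \<delta>\<close> for the cut set at scale \<open>\<delta>\<close>, and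
  \<open>Z q s W = \<Sum>u\<in>W. r u powr s * \<mu>[u] powr q\<close>; the pressures at \<open>t\<close> are logarithms of \<open>Z\<close> at
  \<open>s = t * (1 - q)\<close>. All three quantities of the theorem are determined by a threshold in \<open>s\<close>: the
  level jump by where \<open>Z q s (\<Sigma>\<^sup>k) \<le> 1\<close> eventually, the cut jump by where \<open>Z q s (K \<delta>) \<le> 1\<close>
  eventually, and the dimension by where the mesh sum times \<open>\<delta> powr s\<close> is eventually at most 1. For
  \<open>q < 1\<close> the upper quantities are the infimum of the \<open>t\<close> with the threshold property, for \<open>q > 1\<close>
  the lower ones are the infimum of the \<open>t\<close> without it. It thus suffices that each property at
  \<open>s\<close> implies the others at every \<open>s' > s\<close>.

  Between levels and cuts, \<open>r (u @ [i]) \<le> c * r u\<close> gives \<open>\<Sigma>\<^sup>k \<subseteq> (\<Union>n\<ge>k. K (c ^ n))\<close>, while \<open>K \<delta>\<close> lies in a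
  union of levels whose least index tends to infinity; both unions cost a geometric series, paid for
  by \<open>s' - s\<close>. Between cuts and meshes, the limit hypothesis gives \<open>\<delta> powr (1 + \<kappa>) \<le> r u \<le> \<delta>\<close> on
  \<open>K \<delta>\<close>, so by a volume count with the open set condition a mesh cube meets at most
  \<open>A * \<delta> powr (- \<kappa>)\<close> of the sets \<open>J\<^sub>u\<close>, and each \<open>J\<^sub>u\<close> meets boundedly many cubes; double counting
  compares the two sums up to a factor \<open>\<delta> powr (- \<kappa>)\<close> with \<open>\<kappa>\<close> arbitrarily small.
\<close>

section \<open>Conformal maps\<close>

lemma onorm_scaleR_orthogonal:
  fixes T :: "real^'n \<Rightarrow> real^'n"
  assumes T: "orthogonal_transformation T" and r: "0 < r"
  shows "onorm (\<lambda>h. r *\<^sub>R T h) = r"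
proof (rule antisym)
  show "onorm (\<lambda>h. r *\<^sub>R T h) \<le> r"
    by (rule onorm_le) (use T r in \<open>auto simp: orthogonal_transformation_norm\<close>)
  have "bounded_linear (\<lambda>h. r *\<^sub>R T h)"
    using orthogonal_transformation_linear[OF T]
    by (intro bounded_linear_intros) (simp add: linear_conv_bounded_linear)
  from le_onorm[OF this, of "axis undefined 1"] show "r \<le> onorm (\<lambda>h. r *\<^sub>R T h)"
    using T r by (simp add: orthogonal_transformation_norm)
qed

lemma deriv_norm_conformal:
  fixes f :: "real^'n \<Rightarrow> real^'n"
  assumes T: "orthogonal_transformation T" and r: "0 < r"
    and D: "(f has_derivative (\<lambda>h. r *\<^sub>R T h)) (at x)"
  shows "deriv_norm f x = r"
proof -
  have "frechet_derivative f (at x) = (\<lambda>h. r *\<^sub>R T h)"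
    using frechet_derivative_at[OF D] by simp
  then show ?thesis using onorm_scaleR_orthogonal[OF T r] by (simp add: deriv_norm_def)
qed

lemma conformal_atE:
  fixes f :: "real^'n \<Rightarrow> real^'n"
  assumes "conformal_at f x"
  obtains T where "orthogonal_transformation T" "0 < deriv_norm f x"
    "(f has_derivative (\<lambda>h. deriv_norm f x *\<^sub>R T h)) (at x)"
proof -
  obtain r T where r: "0 < r" and T: "orthogonal_transformation T"
    and D: "(f has_derivative (\<lambda>h. r *\<^sub>R T h)) (at x)"
    using assms unfolding conformal_at_def by blast
  show thesis using that[of T] deriv_norm_conformal[OF T r D] r T D by simp
qed

lemma deriv_norm_compose:
  fixes f g :: "real^'n \<Rightarrow> real^'n"
  assumes "conformal_at g x" "conformal_at f (g x)"
  shows "conformal_at (f \<circ> g) x"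
    and "deriv_norm (f \<circ> g) x = deriv_norm f (g x) * deriv_norm g x"
proof -
  obtain S where S: "orthogonal_transformation S" "0 < deriv_norm g x"
    "(g has_derivative (\<lambda>h. deriv_norm g x *\<^sub>R S h)) (at x)"
    using assms(1) by (rule conformal_atE)
  obtain T where T: "orthogonal_transformation T" "0 < deriv_norm f (g x)"
    "(f has_derivative (\<lambda>h. deriv_norm f (g x) *\<^sub>R T h)) (at (g x))"
    using assms(2) by (rule conformal_atE)
  let ?r = "deriv_norm f (g x) * deriv_norm g x"
  have "(f \<circ> g has_derivative ((\<lambda>h. deriv_norm f (g x) *\<^sub>R T h) \<circ> (\<lambda>h. deriv_norm g x *\<^sub>R S h))) (at x)"
    using S(3) T(3) by (rule diff_chain_at)
  moreover have "((\<lambda>h. deriv_norm f (g x) *\<^sub>R T h) \<circ> (\<lambda>h. deriv_norm g x *\<^sub>R S h))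
      = (\<lambda>h. ?r *\<^sub>R (T \<circ> S) h)"
    using orthogonal_transformation_linear[OF T(1)] by (auto simp: linear_scale)
  ultimately have D: "(f \<circ> g has_derivative (\<lambda>h. ?r *\<^sub>R (T \<circ> S) h)) (at x)" by simp
  have o: "orthogonal_transformation (T \<circ> S)"
    using S(1) T(1) by (simp add: orthogonal_transformation_compose)
  have r: "0 < ?r" using S(2) T(2) by simp
  show "conformal_at (f \<circ> g) x" unfolding conformal_at_def using D o r by blast
  show "deriv_norm (f \<circ> g) x = ?r" using deriv_norm_conformal[OF o r D] .
qed

lemma conformal_at_differentiable: "conformal_at f x \<Longrightarrow> f differentiable (at x)"
  unfolding conformal_at_def differentiable_def by blast

lemma deriv_norm_id: "deriv_norm id (x :: real^'n) = 1" "conformal_at id (x :: real^'n)"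
proof -
  have D: "(id has_derivative (\<lambda>h :: real^'n. 1 *\<^sub>R id h)) (at x)"
    by (simp add: id_def)
  have o: "orthogonal_transformation (id :: real^'n \<Rightarrow> real^'n)"
    by (simp add: id_def orthogonal_transformation_id)
  show "conformal_at id x" unfolding conformal_at_def using D o zero_less_one by blast
  show "deriv_norm id x = 1" using deriv_norm_conformal[OF o zero_less_one D] .
qed

text \<open>Conformality turns the contraction estimate along \<^emph>\<open>any\<close> sequence in \<open>S\<close> converging to \<open>x\<close>
  into a bound of the derivative, so that boundary points need no separate treatment.\<close>

lemma deriv_norm_le_of_contraction:
  fixes f :: "real^'n \<Rightarrow> real^'n"
  assumes conf: "conformal_at f x" and x: "x \<in> S" "x islimpt S"
    and lip: "\<And>y. y \<in> S \<Longrightarrow> dist (f y) (f x) \<le> c * dist y x"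
  shows "deriv_norm f x \<le> c"
proof (rule field_le_epsilon)
  fix e :: real assume e: "0 < e"
  obtain T where T: "orthogonal_transformation T"
    "(f has_derivative (\<lambda>h. deriv_norm f x *\<^sub>R T h)) (at x)" "0 < deriv_norm f x"
    using conf by (rule conformal_atE)
  obtain d where d: "0 < d" and
    D: "\<And>y. norm (y - x) < d \<Longrightarrow> norm (f y - f x - deriv_norm f x *\<^sub>R T (y - x)) \<le> e * norm (y - x)"
    using T(2) e unfolding has_derivative_at_alt by blast
  obtain y where y: "y \<in> S" "y \<noteq> x" "dist y x < d"
    using x(2) d unfolding islimpt_approachable by blast
  have "deriv_norm f x * norm (y - x) = norm (deriv_norm f x *\<^sub>R T (y - x))"
    using T by (simp add: orthogonal_transformation_norm)
  also have "\<dots> \<le> norm (f y - f x) + norm (f y - f x - deriv_norm f x *\<^sub>R T (y - x))"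
    using norm_triangle_ineq4[of "f y - f x" "f y - f x - deriv_norm f x *\<^sub>R T (y - x)"] by simp
  also have "\<dots> \<le> c * norm (y - x) + e * norm (y - x)"
    using lip[OF y(1)] D[of y] y(3) by (simp add: dist_norm)
  finally have "deriv_norm f x * norm (y - x) \<le> (c + e) * norm (y - x)"
    by (simp add: algebra_simps)
  then show "deriv_norm f x \<le> c + e" using y(2) by simp
qed


section \<open>Lipschitz bounds from derivative bounds, and balls inside conformal images\<close>

definition bounded_deriv :: "'a::real_normed_vector set \<Rightarrow> real \<Rightarrow> ('a \<Rightarrow> 'b::real_normed_vector) \<Rightarrow> bool" where
  "bounded_deriv V B f \<longleftrightarrow> (\<forall>z\<in>V. \<exists>f'. (f has_derivative f') (at z) \<and> onorm f' \<le> B)"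

text \<open>The mean value inequality needs a convex domain. On \<open>V\<close> itself, which is
  only connected, \<open>B\<close> need not be a Lipschitz constant.\<close>

lemma bounded_deriv_ball:
  assumes f: "bounded_deriv V B f" and b: "ball z e \<subseteq> V" and x: "x \<in> ball z e" and y: "y \<in> ball z e"
  shows "dist (f x) (f y) \<le> B * dist x y"
proof -
  obtain f' where f': "\<And>w. w \<in> V \<Longrightarrow> (f has_derivative f' w) (at w)"
      "\<And>w. w \<in> V \<Longrightarrow> onorm (f' w) \<le> B"
    using f unfolding bounded_deriv_def by metis
  have "norm (f x - f y) \<le> B * norm (x - y)"
    by (rule differentiable_bound[OF convex_ball[of z e], where f' = f'])
      (use b x y in \<open>auto intro!: has_derivative_at_withinI f'\<close>)
  then show ?thesis by (simp add: dist_norm)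
qed

lemma bounded_deriv_nonneg:
  assumes "bounded_deriv V B f" "z \<in> V"
  shows "0 \<le> B"
proof -
  obtain f' where f': "(f has_derivative f') (at z)" "onorm f' \<le> B"
    using assms unfolding bounded_deriv_def by blast
  show ?thesis using onorm_pos_le[OF has_derivative_bounded_linear[OF f'(1)]] f'(2) by linarith
qed

text \<open>A chain of balls replaces the rectifiable path that would join two points of \<open>K\<close> inside \<open>V\<close>.\<close>

lemma connected_uniform_lipschitz:
  fixes V K :: "'a::real_normed_vector set"
  assumes V: "open V" "connected V" and K: "compact K" "K \<subseteq> V"
  obtains L where "0 < L"
    "\<And>(f :: 'a \<Rightarrow> 'b::real_normed_vector) B x y.
       bounded_deriv V B f \<Longrightarrow> x \<in> K \<Longrightarrow> y \<in> K \<Longrightarrow> dist (f x) (f y) \<le> L * B"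
proof (cases "K = {}")
  case True
  then show ?thesis using that[of 1] by auto
next
  case False
  then obtain a where a: "a \<in> V" using K(2) by blast
  \<comment> \<open>\<open>P y L\<close> bounds the distance from the base point \<open>a\<close>
    for all maps and all \<open>B\<close> at once; this uniformity is what makes \<open>L\<close>
    depend on \<open>V\<close> and \<open>K\<close> alone.\<close>
  define P where "P y L \<longleftrightarrow> (\<forall>(f :: 'a \<Rightarrow> 'b) B. bounded_deriv V B f \<longrightarrow> dist (f a) (f y) \<le> L * B)" for y L
  define S where "S = {y \<in> V. \<exists>L. P y L}"
  have step: "P y' (L + e)" if "P y L" "ball z e \<subseteq> V" "y \<in> ball z (e/2)" "y' \<in> ball z (e/2)" for y y' z e L
    unfolding P_def
  proof (intro allI impI)
    fix f :: "'a \<Rightarrow> 'b" and B assume f: "bounded_deriv V B f"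
    have e: "0 < e" using that(3) by (metis ball_eq_empty empty_iff half_gt_zero_iff not_le)
    have B: "0 \<le> B" using bounded_deriv_nonneg[OF f a] .
    have "dist (f a) (f y') \<le> dist (f a) (f y) + dist (f y) (f y')" by (rule dist_triangle)
    also have "dist (f a) (f y) \<le> L * B" using that(1) f unfolding P_def by blast
    also have "dist (f y) (f y') \<le> B * dist y y'"
      by (rule bounded_deriv_ball[OF f that(2)]) (use that e in auto)
    also have "\<dots> \<le> B * e"
    proof (rule mult_left_mono[OF _ B])
      show "dist y y' \<le> e" using that(3,4) dist_triangle3[of y y' z] by simp
    qed
    finally show "dist (f a) (f y') \<le> (L + e) * B" by (simp add: algebra_simps)
  qed
  have nb: "\<exists>e>0. ball y e \<subseteq> V" if "y \<in> V" for y
    using V(1) that openE by blast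
  \<comment> \<open>\<open>S\<close> is open and closed in \<open>V\<close>. Both halves use
    \<open>step\<close>: forwards from a reached point to its neighbours, and backwards from a
    reached neighbour to the point itself.\<close>
  have "open S"
  proof (rule openI)
    fix y assume "y \<in> S"
    then obtain L e where L: "P y L" and e: "0 < e" "ball y e \<subseteq> V" using nb unfolding S_def by blast
    have "ball y (e/2) \<subseteq> S"
    proof
      fix y' assume "y' \<in> ball y (e/2)"
      then show "y' \<in> S" using step[OF L e(2), of y'] e unfolding S_def by auto
    qed
    then show "\<exists>e>0. ball y e \<subseteq> S" using e(1) half_gt_zero by blast
  qed
  moreover have "open (V - S)"
  proof (rule openI)
    fix y assume y: "y \<in> V - S"
    then obtain e where e: "0 < e" "ball y e \<subseteq> V" using nb by blast
    have "ball y (e/2) \<subseteq> V - S"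
    proof
      fix y' assume y': "y' \<in> ball y (e/2)"
      have "y' \<notin> S"
      proof
        assume "y' \<in> S"
        then obtain L where "P y' L" unfolding S_def by blast
        then have "P y (L + e)" using step[of y' L y e y] y' e by simp
        then show False using y unfolding S_def by blast
      qed
      then show "y' \<in> V - S" using y' e by auto
    qed
    then show "\<exists>e>0. ball y e \<subseteq> V - S" using e(1) half_gt_zero by blast
  qed
  moreover have "a \<in> S"
  proof -
    have "P a 0" unfolding P_def by simp
    then show ?thesis using a unfolding S_def by blast
  qed
  ultimately have "V - S = {}"
    using V(2) a unfolding connected_def S_def by blast
  then have "\<forall>y\<in>K. \<exists>L e. P y L \<and> 0 < e \<and> ball y e \<subseteq> V"
    using K(2) nb unfolding S_def by blast
  then obtain L e where Le: "\<And>y. y \<in> K \<Longrightarrow> P y (L y) \<and> 0 < e y \<and> ball y (e y) \<subseteq> V" by metis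
  obtain D where D: "D \<subseteq> K" "finite D" "K \<subseteq> (\<Union>y\<in>D. ball y (e y / 2))"
  proof (rule compactE_image[OF K(1)])
    show "open (ball y (e y / 2))" if "y \<in> K" for y by simp
    show "K \<subseteq> (\<Union>y\<in>K. ball y (e y / 2))" using Le by force
  qed
  \<comment> \<open>The absolute values make every single constant of the finite cover at most the
    sum.\<close>
  define M where "M = (\<Sum>y\<in>D. \<bar>L y + e y\<bar>)"
  have M: "P x M" if "x \<in> K" for x
  proof -
    obtain y where y: "y \<in> D" "x \<in> ball y (e y / 2)" using D(3) \<open>x \<in> K\<close> by blast
    have Py: "P x (L y + e y)" using step[of y "L y" y "e y" x] Le[of y] y D(1) by auto
    have "L y + e y \<le> \<bar>L y + e y\<bar>" by simp
    also have "\<dots> \<le> M" unfolding M_def by (rule member_le_sum) (use y D in auto)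
    finally have le: "L y + e y \<le> M" .
    show ?thesis unfolding P_def
    proof (intro allI impI)
      fix f :: "'a \<Rightarrow> 'b" and B assume f: "bounded_deriv V B f"
      have "dist (f a) (f x) \<le> (L y + e y) * B" using Py f unfolding P_def by blast
      also have "\<dots> \<le> M * B" using le bounded_deriv_nonneg[OF f a] by (rule mult_right_mono)
      finally show "dist (f a) (f x) \<le> M * B" .
    qed
  qed
  have M0: "0 \<le> M" unfolding M_def by (simp add: sum_nonneg)
  show ?thesis
  \<comment> \<open>Two points of \<open>K\<close> are compared through \<open>a\<close>, which
    gives \<open>2 * M\<close>; the added 1 keeps the constant positive.\<close>
  proof (rule that[of "2 * M + 1"])
    show "0 < 2 * M + 1" using M0 by simp
    fix f :: "'a \<Rightarrow> 'b" and B x y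
    assume f: "bounded_deriv V B f" and xy: "x \<in> K" "y \<in> K"
    have "dist (f x) (f y) \<le> dist (f a) (f x) + dist (f a) (f y)" by (rule dist_triangle3)
    also have "\<dots> \<le> M * B + M * B" using M[OF xy(1)] M[OF xy(2)] f unfolding P_def by (meson add_mono)
    also have "\<dots> \<le> (2 * M + 1) * B" using bounded_deriv_nonneg[OF f a] by (simp add: algebra_simps)
    finally show "dist (f x) (f y) \<le> (2 * M + 1) * B" .
  qed
qed

lemma bounded_deriv_conformal:
  fixes f :: "real^'n \<Rightarrow> real^'n"
  assumes "\<And>x. x \<in> V \<Longrightarrow> conformal_at f x" "\<And>x. x \<in> V \<Longrightarrow> deriv_norm f x \<le> B"
  shows "bounded_deriv V B f"
  unfolding bounded_deriv_def
proof
  fix x assume x: "x \<in> V"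
  have "(f has_derivative frechet_derivative f (at x)) (at x)"
    using conformal_at_differentiable[OF assms(1)[OF x]] by (simp add: frechet_derivative_works)
  then show "\<exists>f'. (f has_derivative f') (at x) \<and> onorm f' \<le> B"
    using assms(2)[OF x] unfolding deriv_norm_def by blast
qed

text \<open>A point of the target ball outside the image and nearest to the centre would be a limit of
  points whose preimages stay in a smaller compact ball, as the inverse is \<open>1/m\<close>-Lipschitz.\<close>

lemma ball_subset_conformal_image:
  fixes f :: "real^'n \<Rightarrow> real^'n"
  assumes inj: "inj_on f (ball a \<rho>)"
    and conf: "\<And>x. x \<in> ball a \<rho> \<Longrightarrow> conformal_at f x"
    and m: "0 < m" "\<And>x. x \<in> ball a \<rho> \<Longrightarrow> m \<le> deriv_norm f x"
    and \<rho>: "0 < \<rho>"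
  shows "ball (f a) (m * \<rho> / 2) \<subseteq> f ` ball a \<rho>"
proof (rule ccontr)
  let ?U = "ball a \<rho>" and ?s = "m * \<rho> / 2"
  let ?W = "f ` ?U"
  assume "\<not> ball (f a) ?s \<subseteq> ?W"
  then have ne: "cball (f a) ?s - ?W \<noteq> {}" using ball_subset_cball by blast
  have cont: "continuous_on ?U f"
    using conf conformal_at_differentiable differentiable_imp_continuous_within
    by (metis continuous_at_imp_continuous_on)
  \<comment> \<open>Openness of the image makes the set of missed points closed, so one of them is
    nearest to \<open>f a\<close>.\<close>
  have W: "open ?W" using invariance_of_domain[OF cont _ inj] by simp
  obtain y where y: "y \<in> cball (f a) ?s - ?W"
    and ymin: "\<And>w. w \<in> cball (f a) ?s - ?W \<Longrightarrow> dist (f a) y \<le> dist (f a) w"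
    using distance_attains_inf[of "cball (f a) ?s - ?W" "f a"] ne W by (metis closed_Diff closed_cball)
  define \<sigma> where "\<sigma> = dist (f a) y"
  have "f a \<in> ?W" using \<rho> by simp
  then have \<sigma>: "0 < \<sigma>" "\<sigma> \<le> ?s" using y unfolding \<sigma>_def by auto
  \<comment> \<open>Nothing closer than \<open>y\<close> is missed, so the inverse is defined on a
    whole ball, which is convex.\<close>
  have sub: "ball (f a) \<sigma> \<subseteq> ?W"
  proof
    fix w assume w: "w \<in> ball (f a) \<sigma>"
    show "w \<in> ?W"
    proof (rule ccontr)
      assume "w \<notin> ?W"
      then have "\<sigma> \<le> dist (f a) w" using ymin[of w] w \<sigma> unfolding \<sigma>_def by auto
      then show False using w by simp
    qed
  qed
  define g where "g = inv_into ?U f"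
  have gf: "\<And>x. x \<in> ?U \<Longrightarrow> g (f x) = x" unfolding g_def using inj by simp
  have gW: "g w \<in> ?U" "f (g w) = w" if "w \<in> ?W" for w
    unfolding g_def using that inv_into_into[of w f ?U] f_inv_into_f[of w f ?U] by auto
  \<comment> \<open>The inverse of a similarity of ratio at least \<open>m\<close> has ratio at most
    \<open>1/m\<close>.\<close>
  have bd: "bounded_deriv ?W (1/m) g"
    unfolding bounded_deriv_def
  proof
    fix w assume "w \<in> ?W"
    then obtain x where x: "x \<in> ?U" "w = f x" by blast
    obtain T where T: "orthogonal_transformation T" "0 < deriv_norm f x"
      "(f has_derivative (\<lambda>h. deriv_norm f x *\<^sub>R T h)) (at x)"
      using conf[OF x(1)] by (rule conformal_atE)
    let ?r = "deriv_norm f x"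
    have Ti: "orthogonal_transformation (inv T)"
      using T(1) by (rule orthogonal_transformation_inv)
    have TT: "T (inv T h) = h" for h
      using orthogonal_transformation_surj[OF T(1)] by (rule surj_f_inv_f)
    have "(g has_derivative (\<lambda>h. (1 / ?r) *\<^sub>R inv T h)) (at (f x))"
    proof (rule has_derivative_inverse_strong[of ?U x f g])
      show "(\<lambda>h. ?r *\<^sub>R T h) \<circ> (\<lambda>h. (1 / ?r) *\<^sub>R inv T h) = id"
        using T(1,2) TT by (auto simp: linear_scale orthogonal_transformation_linear)
    qed (use x gf cont T in auto)
    moreover have "onorm (\<lambda>h. (1 / ?r) *\<^sub>R inv T h) = 1 / ?r"
      using onorm_scaleR_orthogonal[OF Ti, of "1 / ?r"] T(2) by simp
    moreover have "1 / ?r \<le> 1 / m" using m x T(2) by (simp add: frac_le)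
    ultimately show "\<exists>g'. (g has_derivative g') (at w) \<and> onorm g' \<le> 1 / m"
      unfolding x(2) by metis
  qed
  \<comment> \<open>The factor 1/2 in \<open>?s\<close> keeps the preimages in the closed ball of
    half the radius, whose image is compact and therefore also contains the limit point
    \<open>y\<close>.\<close>
  have "ball (f a) \<sigma> \<subseteq> f ` cball a (\<rho>/2)"
  proof
    fix w assume w: "w \<in> ball (f a) \<sigma>"
    have "dist (g (f a)) (g w) \<le> 1/m * dist (f a) w"
      by (rule bounded_deriv_ball[OF bd sub]) (use w \<sigma> in auto)
    also have "\<dots> \<le> 1/m * ?s" using w \<sigma> m(1) by (intro mult_left_mono) auto
    finally have "dist a (g w) \<le> \<rho> / 2" using gf \<rho> m(1) by simp
    then show "w \<in> f ` cball a (\<rho>/2)"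
      using gW(2)[of w] w sub by (metis image_eqI mem_cball subsetD)
  qed
  moreover have "compact (f ` cball a (\<rho>/2))"
    by (rule compact_continuous_image[OF continuous_on_subset[OF cont]])
      (use \<rho> in \<open>auto simp: subset_eq\<close>)
  ultimately have "closure (ball (f a) \<sigma>) \<subseteq> f ` cball a (\<rho>/2)"
    by (simp add: closure_minimal compact_imp_closed)
  moreover have "y \<in> closure (ball (f a) \<sigma>)" using \<sigma> unfolding \<sigma>_def by simp
  ultimately have "y \<in> f ` cball a (\<rho>/2)" by blast
  also have "\<dots> \<subseteq> ?W" using \<rho> by (intro image_mono) (auto simp: subset_eq)
  finally show False using y by blast
qed

text \<open>Comparison of volumes: the disjoint balls all have the same volume and lie in one ball
  of radius \<open>R\<close>.\<close>

lemma card_disjoint_balls: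
  fixes z :: "'b \<Rightarrow> 'a::euclidean_space"
  assumes fin: "finite A" and disj: "disjoint_family_on (\<lambda>u. ball (z u) \<rho>) A"
    and sub: "\<And>u. u \<in> A \<Longrightarrow> ball (z u) \<rho> \<subseteq> ball p R" and pos: "0 < \<rho>" "0 < R"
  shows "real (card A) \<le> (R / \<rho>) ^ DIM('a)"
proof -
  let ?v = "unit_ball_vol (DIM('a))"
  have "real (card A) * (?v * \<rho> ^ DIM('a)) = (\<Sum>u\<in>A. measure lebesgue (ball (z u) \<rho>))"
    using pos by (simp add: content_ball)
  also have "\<dots> = measure lebesgue (\<Union>u\<in>A. ball (z u) \<rho>)"
    by (rule measure_finite_Union[symmetric]) (use fin disj in \<open>auto simp: emeasure_ball pos less_imp_le\<close>)
  also have "\<dots> \<le> measure lebesgue (ball p R)"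
    by (rule measure_mono_fmeasurable) (use sub fin in \<open>auto intro!: sets.finite_UN\<close>)
  also have "\<dots> = ?v * R ^ DIM('a)" using pos by (simp add: content_ball)
  finally have "?v * (real (card A) * \<rho> ^ DIM('a)) \<le> ?v * R ^ DIM('a)" by (simp add: mult_ac)
  then have "real (card A) * \<rho> ^ DIM('a) \<le> R ^ DIM('a)" by simp
  then show ?thesis using pos by (simp add: power_divide pos_le_divide_eq)
qed

section \<open>Sums and double counting\<close>

text \<open>The sum is at most \<open>n\<close> times its largest term, and the power of that term
  is one of the summands on the right. This treats \<open>q < 1\<close> and \<open>q > 1\<close>
  alike.\<close>

lemma sum_powr_le:
  fixes a :: "'u \<Rightarrow> real"
  assumes A: "finite A" and a: "\<And>u. u \<in> A \<Longrightarrow> 0 \<le> a u" and n: "real (card A) \<le> n" and q: "0 < q"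
  shows "(\<Sum>u\<in>A. a u) powr q \<le> n powr q * (\<Sum>u\<in>A. a u powr q)"
proof (cases "A = {}")
  case False
  define M where "M = Max (a ` A)"
  have "M \<in> a ` A" unfolding M_def using A False by simp
  then obtain v where v: "v \<in> A" "a v = M" by force
  have M: "0 \<le> M" using a v by metis
  have "(\<Sum>u\<in>A. a u) \<le> real (card A) * M"
    by (rule sum_bounded_above) (use A in \<open>simp add: M_def\<close>)
  also have "\<dots> \<le> n * M" using n M by (rule mult_right_mono)
  finally have "(\<Sum>u\<in>A. a u) powr q \<le> (n * M) powr q"
    using q a by (intro powr_mono2) (auto intro: sum_nonneg)
  also have "\<dots> = n powr q * a v powr q"
    using n M v(2) by (simp add: powr_mult)
  also have "\<dots> \<le> n powr q * (\<Sum>u\<in>A. a u powr q)"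
    by (intro mult_left_mono member_le_sum[of v A "\<lambda>u. a u powr q"]) (use A v in auto)
  finally show ?thesis .
qed (use q in simp)

text \<open>Used in both directions between cubes and cut words. Here \<open>n\<close> counts the
  terms in the bound for one \<open>p\<close>, and \<open>m\<close> counts the bounds in which one
  \<open>u\<close> occurs; only the former is raised to the power \<open>q\<close>.\<close>

lemma double_counting_powr:
  fixes a :: "'u \<Rightarrow> real" and b :: "'p \<Rightarrow> real"
  assumes fin: "finite U" "finite P"
    and a: "\<And>u. u \<in> U \<Longrightarrow> 0 \<le> a u" and b: "\<And>p. p \<in> P \<Longrightarrow> 0 \<le> b p" and q: "0 < q"
    and le: "\<And>p. p \<in> P \<Longrightarrow> b p \<le> (\<Sum>u | u \<in> U \<and> R u p. a u)"
    and n: "\<And>p. p \<in> P \<Longrightarrow> real (card {u \<in> U. R u p}) \<le> n"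
    and m: "\<And>u. u \<in> U \<Longrightarrow> real (card {p \<in> P. R u p}) \<le> m"
  shows "(\<Sum>p\<in>P. b p powr q) \<le> n powr q * m * (\<Sum>u\<in>U. a u powr q)"
proof -
  have "(\<Sum>p\<in>P. b p powr q) \<le> (\<Sum>p\<in>P. n powr q * (\<Sum>u | u \<in> U \<and> R u p. a u powr q))"
  proof (rule sum_mono)
    fix p assume p: "p \<in> P"
    have "b p powr q \<le> (\<Sum>u | u \<in> U \<and> R u p. a u) powr q"
      using le[OF p] b[OF p] q by (intro powr_mono2) auto
    also have "\<dots> \<le> n powr q * (\<Sum>u | u \<in> U \<and> R u p. a u powr q)"
      by (rule sum_powr_le) (use fin a n[OF p] q in auto)
    finally show "b p powr q \<le> n powr q * (\<Sum>u | u \<in> U \<and> R u p. a u powr q)" .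
  qed
  also have "\<dots> = n powr q * (\<Sum>u\<in>U. \<Sum>p | p \<in> P \<and> R u p. a u powr q)"
    unfolding sum_distrib_left[symmetric]
    by (subst sum.swap_restrict[OF fin(2,1), of "\<lambda>p u. a u powr q" "\<lambda>p u. R u p"]) simp
  also have "\<dots> \<le> n powr q * (\<Sum>u\<in>U. m * a u powr q)"
    by (intro mult_left_mono sum_mono) (use m in \<open>auto intro!: mult_right_mono\<close>)
  also have "\<dots> = n powr q * m * (\<Sum>u\<in>U. a u powr q)"
    by (simp add: sum_distrib_left mult.assoc)
  finally show ?thesis .
qed

lemma sum_cover_le:
  fixes g :: "'u \<Rightarrow> real"
  assumes A: "finite A" and B: "\<And>m. m \<in> A \<Longrightarrow> finite (B m)" and W: "W \<subseteq> (\<Union>m\<in>A. B m)"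
    and g: "\<And>u m. m \<in> A \<Longrightarrow> u \<in> B m \<Longrightarrow> 0 \<le> g u"
  shows "sum g W \<le> (\<Sum>m\<in>A. sum g (B m))"
proof -
  have "sum g W \<le> sum g (\<Union>m\<in>A. B m)"
    by (rule sum_mono2) (use A B W g in auto)
  also have "\<dots> \<le> (\<Sum>m\<in>A. sum g (B m))"
    using A B g
  proof (induction A)
    case (insert a A)
    have "sum g (B a \<union> (\<Union>m\<in>A. B m)) = sum g (B a) + sum g (\<Union>m\<in>A. B m) - sum g (B a \<inter> (\<Union>m\<in>A. B m))"
      by (rule sum_Un) (use insert in auto)
    moreover have "0 \<le> sum g (B a \<inter> (\<Union>m\<in>A. B m))"
      by (rule sum_nonneg) (use insert.prems in auto)
    moreover have "sum g (\<Union>m\<in>A. B m) \<le> (\<Sum>m\<in>A. sum g (B m))" using insert by auto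
    ultimately show ?case using insert.hyps by simp
  qed simp
  finally show ?thesis .
qed

lemma sum_power_tail_le:
  fixes x :: real
  assumes "0 \<le> x" "x < 1"
  shows "(\<Sum>m = k..M. x ^ m) \<le> x ^ k / (1 - x)"
proof (cases "k \<le> M")
  case True
  have "(\<Sum>m = k..M. x ^ m) = (x ^ k - x ^ Suc M) / (1 - x)"
    using sum_gp[of x k M] True assms by simp
  also have "\<dots> \<le> x ^ k / (1 - x)" using assms by (intro divide_right_mono) auto
  finally show ?thesis .
qed (use assms in simp)

text \<open>An arbitrarily small gain in the exponent of the scale absorbs any constant
  factor.\<close>

lemma eventually_const_powr_le_1:
  fixes A e :: real
  assumes e: "0 < e"
  shows "\<forall>\<^sub>F \<delta> in at_right 0. A * \<delta> powr e \<le> 1"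
proof -
  \<comment> \<open>Chosen so that \<open>b powr e = 1 / (\<bar>A\<bar> + 1)\<close>; the added 1
    covers \<open>A = 0\<close>.\<close>
  define b where "b = (1 / (\<bar>A\<bar> + 1)) powr (1 / e)"
  have b: "0 < b" unfolding b_def by simp
  have "\<forall>\<^sub>F \<delta> in at_right 0. \<delta> \<in> {0<..<b}" by (rule eventually_at_right_real[OF b])
  then show ?thesis
  proof eventually_elim
    case (elim \<delta>)
    have "\<delta> powr e \<le> b powr e" using elim e by (intro powr_mono2) auto
    also have "\<dots> = 1 / (\<bar>A\<bar> + 1)" unfolding b_def using e by (simp add: powr_powr)
    finally have "\<bar>A\<bar> * \<delta> powr e \<le> \<bar>A\<bar> * (1 / (\<bar>A\<bar> + 1))" by (intro mult_left_mono) auto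
    also have "\<dots> \<le> 1" by simp
    finally have "\<bar>A\<bar> * \<delta> powr e \<le> 1" .
    moreover have "A * \<delta> powr e \<le> \<bar>A\<bar> * \<delta> powr e" by (intro mult_right_mono) auto
    ultimately show ?case by linarith
  qed
qed

section \<open>Thresholds and jump points\<close>

text \<open>Rewrites an upper limit as a threshold in \<open>t\<close>, the form in which dimensions
  and jump points can be compared.\<close>

lemma Limsup_eq_Inf_eventually_le:
  fixes D :: "'b \<Rightarrow> real"
  shows "Limsup F (\<lambda>x. ereal (D x)) = Inf (ereal ` {t. \<forall>\<^sub>F x in F. D x \<le> t})"
proof (rule antisym)
  show "Limsup F (\<lambda>x. ereal (D x)) \<le> Inf (ereal ` {t. \<forall>\<^sub>F x in F. D x \<le> t})"
    by (rule Inf_greatest) (auto intro!: Limsup_bounded)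
  show "Inf (ereal ` {t. \<forall>\<^sub>F x in F. D x \<le> t}) \<le> Limsup F (\<lambda>x. ereal (D x))"
  proof (rule ccontr)
    assume "\<not> ?thesis"
    then obtain t where t: "Limsup F (\<lambda>x. ereal (D x)) < ereal t"
      "ereal t < Inf (ereal ` {t. \<forall>\<^sub>F x in F. D x \<le> t})"
      using ereal_dense2 unfolding not_le by metis
    have "\<forall>\<^sub>F x in F. D x \<le> t"
      using Limsup_lessD[OF t(1)] by (rule eventually_mono) simp
    then have "Inf (ereal ` {t. \<forall>\<^sub>F x in F. D x \<le> t}) \<le> ereal t" by (intro Inf_lower) auto
    then show False using t(2) by simp
  qed
qed

lemma Liminf_eq_Inf_not_eventually_ge:
  fixes D :: "'b \<Rightarrow> real"
  shows "Liminf F (\<lambda>x. ereal (D x)) = Inf (ereal ` {t. \<not> (\<forall>\<^sub>F x in F. t \<le> D x)})"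
proof (rule antisym)
  show "Liminf F (\<lambda>x. ereal (D x)) \<le> Inf (ereal ` {t. \<not> (\<forall>\<^sub>F x in F. t \<le> D x)})"
  proof (rule Inf_greatest, clarify, rule ccontr)
    fix t assume t: "\<not> (\<forall>\<^sub>F x in F. t \<le> D x)" "\<not> Liminf F (\<lambda>x. ereal (D x)) \<le> ereal t"
    have "\<forall>\<^sub>F x in F. ereal t < ereal (D x)" using t(2) by (intro less_LiminfD) auto
    then have "\<forall>\<^sub>F x in F. t \<le> D x" by (rule eventually_mono) simp
    then show False using t(1) by simp
  qed
  show "Inf (ereal ` {t. \<not> (\<forall>\<^sub>F x in F. t \<le> D x)}) \<le> Liminf F (\<lambda>x. ereal (D x))"
  proof (rule ccontr)
    assume "\<not> ?thesis"
    then obtain t where t: "Liminf F (\<lambda>x. ereal (D x)) < ereal t"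
      "ereal t < Inf (ereal ` {t. \<not> (\<forall>\<^sub>F x in F. t \<le> D x)})"
      using ereal_dense2 unfolding not_le by metis
    have "\<forall>\<^sub>F x in F. t \<le> D x"
      using t(2) Inf_lower[of "ereal t" "ereal ` {t. \<not> (\<forall>\<^sub>F x in F. t \<le> D x)}"] by force
    then have "ereal t \<le> Liminf F (\<lambda>x. ereal (D x))" by (intro Liminf_bounded) simp
    then show False using t(1) by simp
  qed
qed

text \<open>Passing from \<open>s\<close> to a larger \<open>s'\<close> is invisible to the infimum:
  for \<open>a > 0\<close> it amounts to raising \<open>t\<close> by an arbitrarily small
  amount.\<close>

lemma Inf_threshold_mono_pos:
  assumes AB: "\<And>s s' :: real. s < s' \<Longrightarrow> A s \<Longrightarrow> B s'" and a: "0 < a"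
  shows "Inf (ereal ` {t. B (t * a)}) \<le> Inf (ereal ` {t. A (t * a)})"
proof (rule Inf_greatest, clarify)
  fix t assume t: "A (t * a)"
  show "Inf (ereal ` {t. B (t * a)}) \<le> ereal t"
  proof (rule ereal_le_epsilon2)
    fix e :: real assume "0 < e"
    then have "B ((t + e) * a)" using AB[OF _ t] a by simp
    then show "Inf (ereal ` {t. B (t * a)}) \<le> ereal t + ereal e" by (intro Inf_lower) auto
  qed
qed

text \<open>For \<open>a < 0\<close> a larger \<open>t\<close> means a smaller \<open>s\<close>.
  Reflecting \<open>s\<close> to \<open>- s\<close> and passing to the contrapositive of the
  implication reduces this to the positive case.\<close>

lemma Inf_threshold_mono_neg:
  assumes AB: "\<And>s s' :: real. s < s' \<Longrightarrow> A s \<Longrightarrow> B s'" and a: "a < 0"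
  shows "Inf (ereal ` {t. \<not> A (t * a)}) \<le> Inf (ereal ` {t. \<not> B (t * a)})"
  by (rule order_trans[OF _ Inf_threshold_mono_pos[of "\<lambda>s. \<not> B (- s)" "\<lambda>s. \<not> A (- s)" "- a", simplified]])
     (use AB[of "- s'" "- s" for s s'] a in auto)

section \<open>Logarithmic quotients and pressures as thresholds\<close>

lemma ln_mult_powr_le_0_iff:
  fixes S \<delta> :: real
  assumes "0 < S" "0 < \<delta>"
  shows "S * \<delta> powr s \<le> 1 \<longleftrightarrow> ln S + s * ln \<delta> \<le> 0"
proof -
  have "S * \<delta> powr s \<le> 1 \<longleftrightarrow> ln (S * \<delta> powr s) \<le> 0" using assms by simp
  then show ?thesis using assms by (simp add: ln_mult ln_powr)
qed

lemma extended_ln_quotient_eventually: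
  assumes pos: "\<forall>\<^sub>F \<delta> in at_right (0::real). 0 < S \<delta>" and q: "q \<noteq> 1"
  shows "\<forall>\<^sub>F \<delta> in at_right 0.
    extended_ln (ennreal (S \<delta>)) / ereal ((q - 1) * ln \<delta>) = ereal (ln (S \<delta>) / ((q - 1) * ln \<delta>))"
  using pos eventually_at_right_real[of 0 1, OF zero_less_one]
proof eventually_elim
  case (elim \<delta>)
  have "extended_ln (ennreal (S \<delta>)) = ereal (ln (S \<delta>))"
    using elim by (simp add: extended_ln_def ennreal_eq_0_iff)
  moreover have "(q - 1) * ln \<delta> \<noteq> 0" using elim q by simp
  ultimately show ?case by simp
qed

lemma Limsup_extended_ln_quotient:
  assumes pos: "\<forall>\<^sub>F \<delta> in at_right (0::real). 0 < S \<delta>" and q: "q < 1"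
  shows "Limsup (at_right 0) (\<lambda>\<delta>. extended_ln (ennreal (S \<delta>)) / ereal ((q - 1) * ln \<delta>)) =
    Inf (ereal ` {t. \<forall>\<^sub>F \<delta> in at_right 0. S \<delta> * \<delta> powr (t * (1 - q)) \<le> 1})"
proof -
  have "\<forall>\<^sub>F \<delta> in at_right 0. \<forall>t. ln (S \<delta>) / ((q - 1) * ln \<delta>) \<le> t \<longleftrightarrow> S \<delta> * \<delta> powr (t * (1 - q)) \<le> 1"
    using pos eventually_at_right_real[of 0 1, OF zero_less_one]
  proof eventually_elim
    case (elim \<delta>)
    then have "0 < (q - 1) * ln \<delta>" using q by (intro mult_neg_neg) auto
    then show ?case
      using elim by (simp add: ln_mult_powr_le_0_iff pos_divide_le_eq algebra_simps)
  qed
  then have "(\<forall>\<^sub>F \<delta> in at_right 0. ln (S \<delta>) / ((q - 1) * ln \<delta>) \<le> t) \<longleftrightarrow>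
      (\<forall>\<^sub>F \<delta> in at_right 0. S \<delta> * \<delta> powr (t * (1 - q)) \<le> 1)" for t
    by (intro eventually_cong) (auto elim: eventually_mono)
  then show ?thesis
    using Limsup_eq[OF extended_ln_quotient_eventually[OF pos, of q]] q
    by (simp add: Limsup_eq_Inf_eventually_le)
qed

text \<open>For \<open>q > 1\<close> the denominator is negative at small scales, so an upper bound
  on the sum becomes a lower bound on the quotient. The threshold set is therefore the one where the
  bound fails.\<close>

lemma Liminf_extended_ln_quotient:
  assumes pos: "\<forall>\<^sub>F \<delta> in at_right (0::real). 0 < S \<delta>" and q: "1 < q"
  shows "Liminf (at_right 0) (\<lambda>\<delta>. extended_ln (ennreal (S \<delta>)) / ereal ((q - 1) * ln \<delta>)) =
    Inf (ereal ` {t. \<not> (\<forall>\<^sub>F \<delta> in at_right 0. S \<delta> * \<delta> powr (t * (1 - q)) \<le> 1)})"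
proof -
  have "\<forall>\<^sub>F \<delta> in at_right 0. \<forall>t. t \<le> ln (S \<delta>) / ((q - 1) * ln \<delta>) \<longleftrightarrow> S \<delta> * \<delta> powr (t * (1 - q)) \<le> 1"
    using pos eventually_at_right_real[of 0 1, OF zero_less_one]
  proof eventually_elim
    case (elim \<delta>)
    then have "(q - 1) * ln \<delta> < 0" using q by (intro mult_pos_neg) auto
    then show ?case
      using elim by (simp add: ln_mult_powr_le_0_iff neg_le_divide_eq algebra_simps)
  qed
  then have "(\<forall>\<^sub>F \<delta> in at_right 0. t \<le> ln (S \<delta>) / ((q - 1) * ln \<delta>)) \<longleftrightarrow>
      (\<forall>\<^sub>F \<delta> in at_right 0. S \<delta> * \<delta> powr (t * (1 - q)) \<le> 1)" for t
    by (intro eventually_cong) (auto elim: eventually_mono)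
  then show ?thesis
    using Liminf_eq[OF extended_ln_quotient_eventually[OF pos, of q]] q
    by (simp add: Liminf_eq_Inf_not_eventually_ge)
qed

text \<open>Negative pressure at \<open>s\<close> gives \<open>z x s \<le> 1\<close> eventually.
  Conversely that bound at \<open>s\<close> only gives nonpositive pressure, but the decay makes the
  pressure at most \<open>- ((s' - s) * l)\<close> at every larger \<open>s'\<close>. The two infima
  therefore agree.\<close>

lemma jump_point_Limsup:
  fixes z :: "'b \<Rightarrow> real \<Rightarrow> real" and n :: "'b \<Rightarrow> real"
  assumes n: "\<forall>\<^sub>F x in F. 0 < n x" and pos: "\<forall>\<^sub>F x in F. \<forall>s. 0 < z x s"
    and l: "0 < l"
    and decay: "\<forall>\<^sub>F x in F. \<forall>s s'. s \<le> s' \<longrightarrow> z x s' \<le> exp (- ((s' - s) * l * n x)) * z x s"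
    and q: "q < 1"
  shows "jump_point (\<lambda>t. Limsup F (\<lambda>x. ereal (sgn (1 - q) / n x * ln (z x (t * (1 - q)))))) =
    Inf (ereal ` {t. \<forall>\<^sub>F x in F. z x (t * (1 - q)) \<le> 1})"
proof -
  define A where "A s \<longleftrightarrow> Limsup F (\<lambda>x. ereal (1 / n x * ln (z x s))) < 0" for s
  define B where "B s \<longleftrightarrow> (\<forall>\<^sub>F x in F. z x s \<le> 1)" for s
  have AB: "B s" if "A s" for s
    unfolding B_def using Limsup_lessD[OF that[unfolded A_def]] n pos
  proof eventually_elim
    case (elim x)
    have "ln (z x s) < 0" using elim(1,2) by (simp add: divide_less_0_iff)
    then show ?case using elim(3) by (smt (verit) ln_less_zero_iff)
  qed
  have BB: "B s'" if "s \<le> s'" "B s" for s s'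
    unfolding B_def using that(2)[unfolded B_def] n pos decay
  proof eventually_elim
    case (elim x)
    have "z x s' \<le> exp (- ((s' - s) * l * n x)) * z x s" using elim(4) that(1) by blast
    also have "\<dots> \<le> 1 * 1" using elim l that(1) by (intro mult_mono) (auto intro: less_imp_le)
    finally show ?case by simp
  qed
  have BA: "A s'" if "s < s'" "B s" for s s'
  proof -
    have "\<forall>\<^sub>F x in F. ereal (1 / n x * ln (z x s')) \<le> ereal (- ((s' - s) * l))"
      using that(2)[unfolded B_def] n pos decay
    proof eventually_elim
      case (elim x)
      have "z x s' \<le> exp (- ((s' - s) * l * n x)) * z x s" using elim(4) that(1) by simp
      also have "\<dots> \<le> exp (- ((s' - s) * l * n x)) * 1" using elim by (intro mult_left_mono) auto
      finally have "ln (z x s') \<le> ln (exp (- ((s' - s) * l * n x)))" using elim(3) by (intro ln_mono) auto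
      then have "ln (z x s') / n x \<le> - ((s' - s) * l * n x) / n x"
        using elim(2) by (intro divide_right_mono) auto
      then show ?case using elim(2) by simp
    qed
    then have "Limsup F (\<lambda>x. ereal (1 / n x * ln (z x s'))) \<le> ereal (- ((s' - s) * l))"
      by (rule Limsup_bounded)
    also have "\<dots> < 0" using that(1) l by simp
    finally show ?thesis unfolding A_def .
  qed
  have q': "0 < 1 - q" "sgn (1 - q) = 1" using q by auto
  show ?thesis unfolding jump_point_def q'(2) A_def[symmetric] B_def[symmetric]
  proof (rule antisym)
    show "Inf (ereal ` {t. A (t * (1 - q))}) \<le> Inf (ereal ` {t. B (t * (1 - q))})"
      by (rule Inf_threshold_mono_pos[OF _ q'(1)]) (rule BA)
    show "Inf (ereal ` {t. B (t * (1 - q))}) \<le> Inf (ereal ` {t. A (t * (1 - q))})"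
      by (rule Inf_threshold_mono_pos[OF _ q'(1)]) (metis AB BB less_imp_le)
  qed
qed

text \<open>For \<open>q > 1\<close> the sign factor is \<open>- 1\<close>, so
  \<open>z x s \<le> 1\<close> corresponds to nonnegative pressure. Both infima are then taken over
  the complements of the thresholds.\<close>

lemma jump_point_Liminf:
  fixes z :: "'b \<Rightarrow> real \<Rightarrow> real" and n :: "'b \<Rightarrow> real"
  assumes n: "\<forall>\<^sub>F x in F. 0 < n x" and pos: "\<forall>\<^sub>F x in F. \<forall>s. 0 < z x s"
    and l: "0 < l"
    and decay: "\<forall>\<^sub>F x in F. \<forall>s s'. s \<le> s' \<longrightarrow> z x s' \<le> exp (- ((s' - s) * l * n x)) * z x s"
    and q: "1 < q"
  shows "jump_point (\<lambda>t. Liminf F (\<lambda>x. ereal (sgn (1 - q) / n x * ln (z x (t * (1 - q)))))) =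
    Inf (ereal ` {t. \<not> (\<forall>\<^sub>F x in F. z x (t * (1 - q)) \<le> 1)})"
proof -
  define A where "A s \<longleftrightarrow> 0 \<le> Liminf F (\<lambda>x. ereal (- 1 / n x * ln (z x s)))" for s
  define B where "B s \<longleftrightarrow> (\<forall>\<^sub>F x in F. z x s \<le> 1)" for s
  have BA: "A s" if "B s" for s
    unfolding A_def
  proof (rule Liminf_bounded)
    show "\<forall>\<^sub>F x in F. 0 \<le> ereal (- 1 / n x * ln (z x s))"
      using that[unfolded B_def] n pos
    proof eventually_elim
      case (elim x)
      have "ln (z x s) \<le> 0" using elim(1,3) by simp
      then show ?case using elim(2) by (simp add: divide_nonpos_pos)
    qed
  qed
  have BB: "B s'" if "s \<le> s'" "B s" for s s'
    unfolding B_def using that(2)[unfolded B_def] n pos decay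
  proof eventually_elim
    case (elim x)
    have "z x s' \<le> exp (- ((s' - s) * l * n x)) * z x s" using elim(4) that(1) by blast
    also have "\<dots> \<le> 1 * 1" using elim l that(1) by (intro mult_mono) (auto intro: less_imp_le)
    finally show ?case by simp
  qed
  \<comment> \<open>A nonnegative lower limit bounds \<open>ln (z x s) / n x\<close> only by small
    positive numbers. The number \<open>(s' - s) * l\<close> is taken because the decay from
    \<open>s\<close> to \<open>s'\<close> cancels exactly this much.\<close>
  have AB: "B s'" if "s < s'" "A s" for s s'
  proof -
    have "ereal (- ((s' - s) * l)) < 0" using that(1) l by simp
    also have "\<dots> \<le> Liminf F (\<lambda>x. ereal (- 1 / n x * ln (z x s)))" using that(2) unfolding A_def .
    finally have "\<forall>\<^sub>F x in F. ereal (- ((s' - s) * l)) < ereal (- 1 / n x * ln (z x s))"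
      by (rule less_LiminfD)
    then show ?thesis
      unfolding B_def using n pos decay
    proof eventually_elim
      case (elim x)
      have "ln (z x s) / n x < (s' - s) * l" using elim(1) by simp
      then have ln: "ln (z x s) < (s' - s) * l * n x" using elim(2) by (simp add: pos_divide_less_eq)
      have "z x s' \<le> exp (- ((s' - s) * l * n x)) * z x s" using elim(4) that(1) by simp
      also have "\<dots> = exp (- ((s' - s) * l * n x)) * exp (ln (z x s))" using elim(3) by simp
      also have "\<dots> = exp (ln (z x s) - (s' - s) * l * n x)" by (simp add: mult_exp_exp)
      also have "\<dots> \<le> 1" using ln by simp
      finally show ?case .
    qed
  qed
  have q': "1 - q < 0" "sgn (1 - q) = - 1" using q by auto
  have *: "(Liminf F (\<lambda>x. ereal (- 1 / n x * ln (z x s))) < 0) = (\<not> A s)" for s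
    unfolding A_def by (simp add: not_le)
  show ?thesis unfolding jump_point_def q'(2) * B_def[symmetric]
  proof (rule antisym)
    show "Inf (ereal ` {t. \<not> A (t * (1 - q))}) \<le> Inf (ereal ` {t. \<not> B (t * (1 - q))})"
      by (rule Inf_threshold_mono_neg[OF _ q'(1)]) (rule AB)
    show "Inf (ereal ` {t. \<not> B (t * (1 - q))}) \<le> Inf (ereal ` {t. \<not> A (t * (1 - q))})"
      by (rule Inf_threshold_mono_neg[OF _ q'(1)]) (metis BA BB less_imp_le)
  qed
qed

section \<open>Mesh cubes\<close>

lemma mesh_cubes_cover:
  fixes x :: "real^'n"
  assumes "0 < \<delta>"
  obtains Q where "Q \<in> mesh_cubes \<delta>" "x \<in> Q"
proof
  let ?m = "\<lambda>j. \<lfloor>x $ j / \<delta>\<rfloor>"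
  show "{x. \<forall>j. of_int (?m j) * \<delta> \<le> x $ j \<and> x $ j < (of_int (?m j) + 1) * \<delta>} \<in> mesh_cubes \<delta>"
    unfolding mesh_cubes_def by (rule rangeI)
  have "of_int (?m j) * \<delta> \<le> x $ j \<and> x $ j < (of_int (?m j) + 1) * \<delta>" for j
    using floor_divide_lower[OF assms] floor_divide_upper[OF assms] by blast
  then show "x \<in> {x. \<forall>j. of_int (?m j) * \<delta> \<le> x $ j \<and> x $ j < (of_int (?m j) + 1) * \<delta>}" by blast
qed

lemma mesh_cubes_borel:
  fixes Q :: "(real^'n) set"
  assumes "Q \<in> mesh_cubes \<delta>"
  shows "Q \<in> sets borel"
proof -
  obtain m :: "'n \<Rightarrow> int" where
    "Q = {x. \<forall>j. of_int (m j) * \<delta> \<le> x $ j \<and> x $ j < (of_int (m j) + 1) * \<delta>}"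
    using assms unfolding mesh_cubes_def by (elim rangeE)
  also have "\<dots> = (\<Inter>j. {x. of_int (m j) * \<delta> \<le> x $ j} \<inter> {x. x $ j < (of_int (m j) + 1) * \<delta>})"
    by blast
  also have "\<dots> \<in> sets borel"
    by (intro sets.finite_INT sets.Int borel_closed borel_open closed_Collect_le open_Collect_less
        continuous_intros) auto
  finally show ?thesis .
qed

text \<open>In each coordinate the index of a cube meeting \<open>S\<close> differs by at most
  \<open>N + 1\<close> from that of the cube containing \<open>x\<close>, which leaves
  \<open>2 * N + 3\<close> values.\<close>

lemma mesh_cubes_hit:
  fixes x :: "real^'n" and N :: nat
  assumes \<delta>: "0 < \<delta>" and S: "S \<subseteq> cball x (real N * \<delta>)"
  shows "finite {Q \<in> mesh_cubes \<delta>. Q \<inter> S \<noteq> {}}"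
    and "card {Q \<in> mesh_cubes \<delta>. Q \<inter> S \<noteq> {}} \<le> (2 * N + 3) ^ CARD('n)"
proof -
  define cube where "cube m = {x :: real^'n. \<forall>j. of_int (m j) * \<delta> \<le> x $ j \<and> x $ j < (of_int (m j) + 1) * \<delta>}"
    for m :: "'n \<Rightarrow> int"
  define p where "p j = \<lfloor>x $ j / \<delta>\<rfloor>" for j
  define M where "M = (\<Pi>\<^sub>E j\<in>UNIV. {p j - int N - 1 .. p j + int N + 1})"
  have sub: "{Q \<in> mesh_cubes \<delta>. Q \<inter> S \<noteq> {}} \<subseteq> cube ` M"
  proof
    fix Q assume "Q \<in> {Q \<in> mesh_cubes \<delta>. Q \<inter> S \<noteq> {}}"
    then obtain y where Q: "Q \<in> mesh_cubes \<delta>" and y: "y \<in> Q" "y \<in> S" by blast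
    obtain m where m: "Q = cube m" using Q unfolding mesh_cubes_def cube_def by (elim rangeE)
    have "m j \<in> {p j - int N - 1 .. p j + int N + 1}" for j
    proof -
      have m1: "of_int (m j) \<le> y $ j / \<delta>" and m2: "y $ j / \<delta> < of_int (m j) + 1"
        using y(1) \<delta> unfolding m cube_def by (auto simp: pos_le_divide_eq pos_divide_less_eq)
      have "\<bar>x $ j - y $ j\<bar> \<le> norm (x - y)"
        using component_le_norm_cart[of "x - y" j] by simp
      also have "\<dots> \<le> real N * \<delta>" using y(2) S by (auto simp: dist_norm)
      finally have "\<bar>(x $ j - y $ j) / \<delta>\<bar> \<le> real N" using \<delta> by (simp add: pos_divide_le_eq)
      then have d: "\<bar>x $ j / \<delta> - y $ j / \<delta>\<bar> \<le> real N" by (simp add: diff_divide_distrib)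
      have p1: "of_int (p j) \<le> x $ j / \<delta>" and p2: "x $ j / \<delta> < of_int (p j) + 1"
        unfolding p_def by linarith+
      have "real_of_int (m j) < of_int (p j + int N + 1)" "of_int (p j) < real_of_int (m j + int N + 1)"
        using m1 m2 d p1 p2 unfolding of_int_add of_int_1 of_int_of_nat_eq by linarith+
      then show ?thesis unfolding of_int_less_iff by simp
    qed
    then show "Q \<in> cube ` M" unfolding m M_def by auto
  qed
  have fin: "finite M" unfolding M_def by (intro finite_PiE) auto
  show "finite {Q \<in> mesh_cubes \<delta>. Q \<inter> S \<noteq> {}}" using sub fin finite_surj by blast
  have "card {Q \<in> mesh_cubes \<delta>. Q \<inter> S \<noteq> {}} \<le> card M"
    using card_mono[OF finite_imageI[OF fin] sub] card_image_le[OF fin, of cube] by linarith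
  also have "card M = (\<Prod>j\<in>(UNIV :: 'n set). card {p j - int N - 1 .. p j + int N + 1})"
    unfolding M_def by (rule card_PiE) simp
  also have "\<dots> = (2 * N + 3) ^ CARD('n)" by (simp add: nat_add_distrib nat_mult_distrib algebra_simps)
  finally show "card {Q \<in> mesh_cubes \<delta>. Q \<inter> S \<noteq> {}} \<le> (2 * N + 3) ^ CARD('n)" .
qed

section \<open>Words\<close>

text \<open>List positions start at 0 and levels at 1, hence the shift \<open>Suc n\<close>.\<close>

lemma fin_words_iff: "u \<in> fin_words I \<longleftrightarrow> (\<forall>n < length u. u ! n \<in> I (Suc n))"
  unfolding fin_words_def words_def by auto

lemma words_1_iff: "u \<in> words I 1 k \<longleftrightarrow> u \<in> fin_words I \<and> length u = k"
  unfolding fin_words_iff unfolding words_def by auto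

lemma snoc_fin_words: "u @ [i] \<in> fin_words I \<longleftrightarrow> u \<in> fin_words I \<and> i \<in> I (Suc (length u))"
  unfolding fin_words_iff by (auto simp: nth_append less_Suc_eq)

lemma take_fin_words: "u \<in> fin_words I \<Longrightarrow> take n u \<in> fin_words I"
  unfolding fin_words_iff by auto

lemma butlast_fin_words: "u \<in> fin_words I \<Longrightarrow> butlast u \<in> fin_words I"
  by (simp add: butlast_conv_take take_fin_words)

lemma finite_words:
  assumes "\<And>k. 1 \<le> k \<Longrightarrow> finite (I k)"
  shows "finite (words I 1 k)"
proof (induction k)
  case 0
  have "words I 1 0 \<subseteq> {[]}" by (auto simp: words_def)
  then show ?case by (rule finite_subset) simp
next
  case (Suc k)
  have "words I 1 (Suc k) \<subseteq> (\<lambda>(u, i). u @ [i]) ` (words I 1 k \<times> I (Suc k))"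
  proof
    fix u assume "u \<in> words I 1 (Suc k)"
    then have u: "length (butlast u) = k" "u \<in> fin_words I" "u \<noteq> []"
      unfolding words_1_iff by auto
    then have eq: "butlast u @ [last u] = u" by simp
    then have "butlast u \<in> words I 1 k" "last u \<in> I (Suc k)"
      using snoc_fin_words[of "butlast u" "last u" I] u unfolding words_1_iff by auto
    then show "u \<in> (\<lambda>(u, i). u @ [i]) ` (words I 1 k \<times> I (Suc k))"
      using eq by (intro image_eqI[where x = "(butlast u, last u)"]) auto
  qed
  then show ?case using Suc assms[of "Suc k"] by (auto intro: finite_subset)
qed

lemma length_word_prefix [simp]: "length (word_prefix v n) = n"
  by (simp add: word_prefix_def)

lemma word_prefix_0 [simp]: "word_prefix v 0 = []"
  by (simp add: word_prefix_def)

lemma word_prefix_Suc: "word_prefix v (Suc n) = word_prefix v n @ [v (Suc n)]"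
  by (simp add: word_prefix_def)

lemma nth_word_prefix: "k < n \<Longrightarrow> word_prefix v n ! k = v (Suc k)"
  by (simp add: word_prefix_def del: upt_Suc)

lemma word_prefix_fin_words: "v \<in> inf_words I \<Longrightarrow> word_prefix v n \<in> fin_words I"
  unfolding fin_words_iff inf_words_def by (auto simp: nth_word_prefix)

lemma take_word_prefix: "m \<le> n \<Longrightarrow> take m (word_prefix v n) = word_prefix v m"
  by (rule nth_equalityI) (auto simp: nth_word_prefix)

lemma word_dist_less_imp_prefix_eq:
  assumes "v \<in> inf_words I" "w \<in> inf_words I" "word_dist v w < (1/2) ^ n"
  shows "word_prefix v n = word_prefix w n"
proof (cases "v = w")
  case False
  define N where "N = (GREATEST n. word_prefix v n = word_prefix w n)"
  have eq: "word_prefix v N = word_prefix w N"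
    unfolding N_def by (rule word_prefix_Greatest(1)[OF assms(1,2) False])
  have "(1/2 :: real) ^ N < (1/2) ^ n" using assms(3) False unfolding word_dist_def N_def by simp
  then have "n \<le> N" by (simp add: power_strict_decreasing_iff less_imp_le)
  then show ?thesis using eq take_word_prefix by metis
qed simp

text \<open>The ball of radius \<open>(1/2) ^ n\<close> consists of words sharing the first
  \<open>n\<close> letters, so a set in which membership is decided locally by finite prefixes is
  open.\<close>

lemma word_borel_openI:
  assumes "U \<subseteq> inf_words I"
    and "\<And>v. v \<in> U \<Longrightarrow> \<exists>n. \<forall>w\<in>inf_words I. word_prefix v n = word_prefix w n \<longrightarrow> w \<in> U"
  shows "U \<in> sets (word_borel I)"
proof -
  interpret W: Metric_space "inf_words I" word_dist by (rule Metric_space_word_dist)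
  have "openin W.mtopology U"
    unfolding W.openin_mtopology
  proof (intro conjI assms(1) allI impI)
    fix v assume v: "v \<in> U"
    obtain n where n: "\<forall>w\<in>inf_words I. word_prefix v n = word_prefix w n \<longrightarrow> w \<in> U"
      using assms(2)[OF v] by blast
    have "W.mball v ((1/2) ^ n) \<subseteq> U"
    proof
      fix w assume "w \<in> W.mball v ((1/2) ^ n)"
      then have "v \<in> inf_words I" "w \<in> inf_words I" "word_dist v w < (1/2) ^ n" by auto
      then show "w \<in> U" using n word_dist_less_imp_prefix_eq by blast
    qed
    then show "\<exists>r>0. W.mball v r \<subseteq> U" by (intro exI[of _ "(1/2) ^ n"]) simp
  qed
  then show ?thesis unfolding word_borel_def
    by (subst sets_measure_of) (use openin_subset[of W.mtopology] in auto)
qed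

lemma space_word_borel: "space (word_borel I) = inf_words I"
proof -
  interpret W: Metric_space "inf_words I" word_dist by (rule Metric_space_word_dist)
  show ?thesis unfolding word_borel_def
    by (rule space_measure_of) (use openin_subset[of W.mtopology] in auto)
qed

lemma cylinder_sets: "cylinder I u \<in> sets (word_borel I)"
  by (rule word_borel_openI) (auto simp: cylinder_def intro: exI[of _ "length u"])

section \<open>Geometry of a conformal system\<close>

text \<open>Names the domain \<open>V\<close>, the contraction ratio \<open>c\<close> and the
  distortion constant \<open>C\<close>, which \<open>ncifs\<close> only asserts to exist, so that
  all estimates share them.\<close>

locale conformal_system =
  fixes I :: "nat \<Rightarrow> 'i set" and \<phi> :: "nat \<Rightarrow> 'i \<Rightarrow> real^'n \<Rightarrow> real^'n" and J :: "(real^'n) set"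
    and Jw :: "'i list \<Rightarrow> (real^'n) set" and V :: "(real^'n) set" and c C :: real
  assumes I_finite: "1 \<le> k \<Longrightarrow> finite (I k)" and I_nonempty: "1 \<le> k \<Longrightarrow> I k \<noteq> {}"
    and J_compact: "compact J" and J_interior: "interior J \<noteq> {}" and J_closure: "closure (interior J) = J"
    and map_J: "1 \<le> k \<Longrightarrow> i \<in> I k \<Longrightarrow> \<phi> k i ` J \<subseteq> J"
    and Jw_Nil: "Jw [] = J"
    and c_pos: "0 < c" and c_less: "c < 1"
    and contraction: "1 \<le> k \<Longrightarrow> i \<in> I k \<Longrightarrow> x \<in> J \<Longrightarrow> y \<in> J \<Longrightarrow> dist (\<phi> k i x) (\<phi> k i y) \<le> c * dist x y"
    and Jw_snoc: "u @ [i] \<in> fin_words I \<Longrightarrow> Jw (u @ [i]) \<subseteq> Jw u"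
    and Jw_image: "u \<in> fin_words I \<Longrightarrow> \<exists>\<omega>. Jw u = (\<lambda>x. word_map \<phi> 1 u x + \<omega>) ` J"
    and V_open: "open V" and V_connected: "connected V" and J_V: "J \<subseteq> V"
    and map_V: "1 \<le> k \<Longrightarrow> i \<in> I k \<Longrightarrow> \<phi> k i ` V \<subseteq> V"
    and map_inj: "1 \<le> k \<Longrightarrow> i \<in> I k \<Longrightarrow> inj_on (\<phi> k i) V"
    and map_conformal: "1 \<le> k \<Longrightarrow> i \<in> I k \<Longrightarrow> x \<in> V \<Longrightarrow> conformal_at (\<phi> k i) x"
    and C_ge: "1 \<le> C"
    and distortion: "u \<in> fin_words I \<Longrightarrow> u \<noteq> [] \<Longrightarrow> x \<in> V \<Longrightarrow> y \<in> V \<Longrightarrow>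
      deriv_norm (word_map \<phi> 1 u) x \<le> C * deriv_norm (word_map \<phi> 1 u) y"
begin

section \<open>Derivative norms of words\<close>

abbreviation r :: "'i list \<Rightarrow> real" where "r \<equiv> word_deriv_norm \<phi> J"

lemma J_nonempty: "J \<noteq> {}"
  using J_interior interior_subset by blast

lemma word_map_snoc: "word_map \<phi> l (u @ [i]) = word_map \<phi> l u \<circ> \<phi> (l + length u) i"
  by (induction u arbitrary: l) (auto simp: comp_assoc)

lemma word_map_1_snoc: "word_map \<phi> 1 (u @ [i]) = word_map \<phi> 1 u \<circ> \<phi> (Suc (length u)) i"
  using word_map_snoc[of 1 u i] by simp

text \<open>The last letter of a word acts first. It maps \<open>V\<close> into itself, so the
  induction hypothesis applies at the image point.\<close>

lemma word_map_V:
  assumes "u \<in> fin_words I"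
  shows "inj_on (word_map \<phi> 1 u) V \<and> (\<forall>x\<in>V. conformal_at (word_map \<phi> 1 u) x)"
  using assms
proof (induction u rule: rev_induct)
  case Nil
  show ?case unfolding word_map.simps using deriv_norm_id(2) by (intro conjI ballI inj_on_id)
next
  case (snoc i u)
  then have u: "u \<in> fin_words I" and i: "i \<in> I (Suc (length u))" by (auto simp: snoc_fin_words)
  have k: "1 \<le> Suc (length u)" by simp
  have V: "\<phi> (Suc (length u)) i x \<in> V" if "x \<in> V" for x using map_V[OF k i] that by blast
  show ?case unfolding word_map_1_snoc
  proof (intro conjI ballI)
    show "inj_on (word_map \<phi> 1 u \<circ> \<phi> (Suc (length u)) i) V"
      using map_inj[OF k i] snoc.IH[OF u] map_V[OF k i]
      by (intro comp_inj_on) (auto intro: inj_on_subset)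
    show "conformal_at (word_map \<phi> 1 u \<circ> \<phi> (Suc (length u)) i) x" if "x \<in> V" for x
      by (rule deriv_norm_compose(1)) (use map_conformal[OF k i] snoc.IH[OF u] V that in auto)
  qed
qed

lemma word_map_conformal: "u \<in> fin_words I \<Longrightarrow> x \<in> V \<Longrightarrow> conformal_at (word_map \<phi> 1 u) x"
  using word_map_V by blast

lemma deriv_norm_pos: "u \<in> fin_words I \<Longrightarrow> x \<in> V \<Longrightarrow> 0 < deriv_norm (word_map \<phi> 1 u) x"
  using word_map_conformal conformal_atE by metis

lemma deriv_norm_snoc:
  assumes u: "u @ [i] \<in> fin_words I" and x: "x \<in> V"
  shows "deriv_norm (word_map \<phi> 1 (u @ [i])) x =
    deriv_norm (word_map \<phi> 1 u) (\<phi> (Suc (length u)) i x) * deriv_norm (\<phi> (Suc (length u)) i) x"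
proof -
  have u': "u \<in> fin_words I" and i: "i \<in> I (Suc (length u))" using u by (auto simp: snoc_fin_words)
  have V: "\<phi> (Suc (length u)) i x \<in> V" using map_V[of "Suc (length u)" i] i x by auto
  show ?thesis unfolding word_map_1_snoc
    by (rule deriv_norm_compose(2)) (use map_conformal i x u' V word_map_conformal in auto)
qed

lemma distortion_fin_words:
  assumes "u \<in> fin_words I" "x \<in> V" "y \<in> V"
  shows "deriv_norm (word_map \<phi> 1 u) x \<le> C * deriv_norm (word_map \<phi> 1 u) y"
  using distortion[OF assms(1) _ assms(2,3)] C_ge by (cases "u = []") (auto simp: deriv_norm_id)

text \<open>A real supremum is an upper bound only over a set bounded above; distortion relative to
  one fixed point of \<open>J\<close> provides the bound.\<close>

lemma deriv_norm_le_r: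
  assumes "u \<in> fin_words I" "x \<in> J"
  shows "deriv_norm (word_map \<phi> 1 u) x \<le> r u"
  unfolding word_deriv_norm_def sup_deriv_norm_def
proof (rule cSUP_upper[OF assms(2)])
  obtain y where "y \<in> J" using J_nonempty by blast
  then show "bdd_above (deriv_norm (word_map \<phi> 1 u) ` J)"
    using distortion_fin_words[OF assms(1)] J_V by (intro bdd_aboveI2) blast
qed

lemma r_leI: "(\<And>x. x \<in> J \<Longrightarrow> deriv_norm (word_map \<phi> 1 u) x \<le> B) \<Longrightarrow> r u \<le> B"
  unfolding word_deriv_norm_def sup_deriv_norm_def by (rule cSUP_least[OF J_nonempty])

lemma r_pos: "u \<in> fin_words I \<Longrightarrow> 0 < r u"
  using J_nonempty J_V deriv_norm_pos deriv_norm_le_r by (metis ex_in_conv less_le_trans subsetD)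

lemma r_le_deriv_norm: "u \<in> fin_words I \<Longrightarrow> y \<in> V \<Longrightarrow> r u \<le> C * deriv_norm (word_map \<phi> 1 u) y"
  using distortion_fin_words J_V by (intro r_leI) blast

lemma deriv_norm_V_le_r:
  assumes "u \<in> fin_words I" "x \<in> V"
  shows "deriv_norm (word_map \<phi> 1 u) x \<le> C * r u"
proof -
  obtain y where y: "y \<in> J" using J_nonempty by blast
  have "deriv_norm (word_map \<phi> 1 u) x \<le> C * deriv_norm (word_map \<phi> 1 u) y"
    using distortion_fin_words assms y J_V by blast
  also have "\<dots> \<le> C * r u" using deriv_norm_le_r[OF assms(1) y] C_ge by (intro mult_left_mono) auto
  finally show ?thesis .
qed

lemma r_Nil: "r [] = 1"
  using J_nonempty by (simp add: word_deriv_norm_def sup_deriv_norm_def deriv_norm_id)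

lemma deriv_norm_generator_le:
  assumes k: "1 \<le> k" "i \<in> I k" and x: "x \<in> J"
  shows "deriv_norm (\<phi> k i) x \<le> c"
proof (rule deriv_norm_le_of_contraction[OF _ x])
  show "conformal_at (\<phi> k i) x" using map_conformal[OF k] x J_V by blast
  \<comment> \<open>As \<open>J\<close> is the closure of its interior, it has no isolated points,
    and the contraction estimate reaches the boundary too.\<close>
  have "x islimpt interior J"
  proof (cases "x \<in> interior J")
    case True
    then show ?thesis by (simp add: interior_limit_point interior_interior)
  next
    case False
    then show ?thesis using x J_closure unfolding closure_def by blast
  qed
  then show "x islimpt J" using interior_subset islimpt_subset by blast
  show "dist (\<phi> k i y) (\<phi> k i x) \<le> c * dist y x" if "y \<in> J" for y
    using contraction[OF k that x] .
qed

text \<open>Chain rule: the appended map contracts by \<open>c\<close> and lands in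
  \<open>J\<close>, where \<open>r u\<close> bounds the norm of the prefix map.\<close>

lemma r_snoc_le:
  assumes u: "u @ [i] \<in> fin_words I"
  shows "r (u @ [i]) \<le> c * r u"
proof (rule r_leI)
  fix x assume x: "x \<in> J"
  have u': "u \<in> fin_words I" and i: "i \<in> I (Suc (length u))" using u by (auto simp: snoc_fin_words)
  have J: "\<phi> (Suc (length u)) i x \<in> J" using map_J[of "Suc (length u)" i] i x by auto
  have "deriv_norm (word_map \<phi> 1 u) (\<phi> (Suc (length u)) i x) * deriv_norm (\<phi> (Suc (length u)) i) x \<le> r u * c"
  proof (rule mult_mono)
    show "deriv_norm (word_map \<phi> 1 u) (\<phi> (Suc (length u)) i x) \<le> r u" by (rule deriv_norm_le_r[OF u' J])
    show "deriv_norm (\<phi> (Suc (length u)) i) x \<le> c" by (rule deriv_norm_generator_le[OF _ i x]) simp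
    show "0 \<le> r u" using r_pos[OF u'] by simp
    show "0 \<le> deriv_norm (\<phi> (Suc (length u)) i) x"
      using map_conformal[OF _ i] x J_V conformal_atE by (metis le_add1 less_imp_le plus_1_eq_Suc subsetD)
  qed
  then show "deriv_norm (word_map \<phi> 1 (u @ [i])) x \<le> c * r u"
    using deriv_norm_snoc[OF u] x J_V by (simp add: mult.commute subset_eq)
qed

text \<open>The converse of the chain rule estimate up to \<open>C\<close>: by distortion, the
  derivative of the prefix map is comparable to \<open>r u\<close> at whichever point the last map
  lands.\<close>

lemma r_snoc_ge:
  assumes u: "u @ [i] \<in> fin_words I"
  shows "r u * sup_deriv_norm J (\<phi> (Suc (length u)) i) \<le> C * r (u @ [i])"
proof -
  have u': "u \<in> fin_words I" and i: "i \<in> I (Suc (length u))" using u by (auto simp: snoc_fin_words)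
  have "sup_deriv_norm J (\<phi> (Suc (length u)) i) \<le> C * r (u @ [i]) / r u"
    unfolding sup_deriv_norm_def
  proof (rule cSUP_least[OF J_nonempty])
    fix x assume x: "x \<in> J"
    have V: "\<phi> (Suc (length u)) i x \<in> V" using map_V[of "Suc (length u)" i] i x J_V by auto
    have g: "0 \<le> deriv_norm (\<phi> (Suc (length u)) i) x"
      using map_conformal[OF _ i] x J_V conformal_atE by (metis le_add1 less_imp_le plus_1_eq_Suc subsetD)
    have "r u * deriv_norm (\<phi> (Suc (length u)) i) x
        \<le> C * deriv_norm (word_map \<phi> 1 u) (\<phi> (Suc (length u)) i x) * deriv_norm (\<phi> (Suc (length u)) i) x"
      using r_le_deriv_norm[OF u' V] g by (rule mult_right_mono)
    also have "\<dots> = C * deriv_norm (word_map \<phi> 1 (u @ [i])) x"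
      using deriv_norm_snoc[OF u] x J_V by (simp add: subset_eq)
    also have "\<dots> \<le> C * r (u @ [i])"
      using deriv_norm_le_r[OF u x] C_ge by (intro mult_left_mono) auto
    finally show "deriv_norm (\<phi> (Suc (length u)) i) x \<le> C * r (u @ [i]) / r u"
      using r_pos[OF u'] by (simp add: pos_le_divide_eq mult.commute)
  qed
  then show ?thesis using r_pos[OF u'] by (simp add: pos_le_divide_eq mult.commute)
qed

lemma r_antimono: 
  assumes "u @ v \<in> fin_words I"
  shows "r (u @ v) \<le> c ^ length v * r u"
  using assms
proof (induction v rule: rev_induct)
  case (snoc i v)
  then have uv: "(u @ v) @ [i] \<in> fin_words I" by simp
  then have "u @ v \<in> fin_words I" unfolding snoc_fin_words by (rule conjunct1)
  have "r ((u @ v) @ [i]) \<le> c * r (u @ v)" by (rule r_snoc_le[OF uv])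
  also have "\<dots> \<le> c * (c ^ length v * r u)"
    using snoc.IH \<open>u @ v \<in> fin_words I\<close> c_pos by (intro mult_left_mono) auto
  finally show ?case by simp
qed simp

lemma r_le_power: "u \<in> fin_words I \<Longrightarrow> r u \<le> c ^ length u"
  using r_antimono[of "[]" u] by (simp add: r_Nil)

section \<open>The sets \<open>Jw u\<close>: nesting, diameter and inner balls\<close>

lemma Jw_append: "u @ v \<in> fin_words I \<Longrightarrow> Jw (u @ v) \<subseteq> Jw u"
proof (induction v rule: rev_induct)
  case (snoc i v)
  then have uv: "(u @ v) @ [i] \<in> fin_words I" by simp
  then have "u @ v \<in> fin_words I" unfolding snoc_fin_words by (rule conjunct1)
  then show ?case using snoc.IH Jw_snoc[OF uv] by auto
qed simp

text \<open>Distortion bounds the derivative by \<open>C * r u\<close> on all of \<open>V\<close>,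
  so one Lipschitz constant for \<open>J\<close> inside \<open>V\<close> serves all words. The
  translation cancels in differences.\<close>

lemma Jw_diameter:
  obtains L where "0 < L" "\<And>u x y. u \<in> fin_words I \<Longrightarrow> x \<in> Jw u \<Longrightarrow> y \<in> Jw u \<Longrightarrow> dist x y \<le> L * r u"
proof -
  obtain L where L: "0 < L"
    "\<And>(f :: real^'n \<Rightarrow> real^'n) B x y. bounded_deriv V B f \<Longrightarrow> x \<in> J \<Longrightarrow> y \<in> J \<Longrightarrow> dist (f x) (f y) \<le> L * B"
    using connected_uniform_lipschitz[OF V_open V_connected J_compact J_V] by metis
  show thesis
  proof (rule that[of "L * C"])
    show "0 < L * C" using L(1) C_ge by simp
    fix u x y assume u: "u \<in> fin_words I" and x: "x \<in> Jw u" and y: "y \<in> Jw u"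
    obtain \<omega> where \<omega>: "Jw u = (\<lambda>x. word_map \<phi> 1 u x + \<omega>) ` J" using Jw_image[OF u] by blast
    obtain x' y' where xy: "x' \<in> J" "x = word_map \<phi> 1 u x' + \<omega>" "y' \<in> J" "y = word_map \<phi> 1 u y' + \<omega>"
      using x y unfolding \<omega> by blast
    have "bounded_deriv V (C * r u) (word_map \<phi> 1 u)"
      using word_map_conformal[OF u] deriv_norm_V_le_r[OF u] by (intro bounded_deriv_conformal) auto
    from L(2)[OF this xy(1,3)] show "dist x y \<le> L * C * r u"
      unfolding xy(2,4) by (simp add: mult.assoc)
  qed
qed

text \<open>A fixed ball in \<open>J\<close> is mapped with derivative norm at least
  \<open>r u / C\<close>, so its image contains a ball of radius comparable to
  \<open>r u\<close>.\<close>

lemma Jw_inner_ball: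
  obtains b where "0 < b" "\<And>u. u \<in> fin_words I \<Longrightarrow> \<exists>z. ball z (b * r u) \<subseteq> interior (Jw u)"
proof -
  obtain a \<rho> where \<rho>: "0 < \<rho>" "ball a \<rho> \<subseteq> J"
    using J_interior mem_interior by blast
  show thesis
  proof (rule that[of "\<rho> / (2 * C)"])
    show "0 < \<rho> / (2 * C)" using \<rho>(1) C_ge by simp
    fix u assume u: "u \<in> fin_words I"
    let ?f = "word_map \<phi> 1 u"
    obtain \<omega> where \<omega>: "Jw u = (\<lambda>x. ?f x + \<omega>) ` J" using Jw_image[OF u] by blast
    have V: "ball a \<rho> \<subseteq> V" using \<rho>(2) J_V by blast
    have "ball (?f a) (r u / C * \<rho> / 2) \<subseteq> ?f ` ball a \<rho>"
    proof (rule ball_subset_conformal_image)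
      show "inj_on ?f (ball a \<rho>)" using word_map_V[OF u] V inj_on_subset by blast
      show "conformal_at ?f x" if "x \<in> ball a \<rho>" for x using word_map_conformal[OF u] V that by blast
      show "0 < r u / C" using r_pos[OF u] C_ge by simp
      show "r u / C \<le> deriv_norm ?f x" if "x \<in> ball a \<rho>" for x
        using r_le_deriv_norm[OF u, of x] V that C_ge by (auto simp: pos_divide_le_eq mult.commute)
    qed (rule \<rho>(1))
    also have "\<dots> \<subseteq> ?f ` J" using \<rho>(2) by blast
    finally have sub: "ball (?f a) (r u / C * \<rho> / 2) \<subseteq> ?f ` J" .
    have "ball (?f a + \<omega>) (\<rho> / (2 * C) * r u) \<subseteq> Jw u"
    proof
      fix y assume "y \<in> ball (?f a + \<omega>) (\<rho> / (2 * C) * r u)"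
      then have "dist (?f a) (y - \<omega>) < r u / C * \<rho> / 2"
        by (simp add: dist_norm algebra_simps)
      then obtain x where "x \<in> J" "y - \<omega> = ?f x" using sub by auto
      then show "y \<in> Jw u" unfolding \<omega> by (auto intro!: image_eqI[of _ _ x] simp: algebra_simps)
    qed
    then show "\<exists>z. ball z (\<rho> / (2 * C) * r u) \<subseteq> interior (Jw u)"
      using interior_maximal open_ball by blast
  qed
qed

section \<open>The coding map\<close>

lemma Jw_compact: "u \<in> fin_words I \<Longrightarrow> compact (Jw u)"
proof -
  assume u: "u \<in> fin_words I"
  then obtain \<omega> where \<omega>: "Jw u = (\<lambda>x. word_map \<phi> 1 u x + \<omega>) ` J" using Jw_image by blast
  have "continuous_on J (word_map \<phi> 1 u)"
    using word_map_conformal[OF u] J_V conformal_at_differentiable differentiable_imp_continuous_within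
    by (intro continuous_at_imp_continuous_on) blast
  then show ?thesis unfolding \<omega> by (intro compact_continuous_image continuous_intros J_compact)
qed

text \<open>The sets along \<open>v\<close> are nested nonempty compacta with diameters tending to
  0. Their intersection is thus a single point, which is what gives \<open>the_elem\<close> in
  \<open>coding_map\<close> its meaning.\<close>

lemma coding_map_mem:
  assumes v: "v \<in> inf_words I"
  shows "coding_map Jw v \<in> Jw (word_prefix v n)"
proof -
  let ?F = "\<lambda>n. Jw (word_prefix v n)"
  have fw: "word_prefix v n \<in> fin_words I" for n using word_prefix_fin_words[OF v] .
  have mono: "?F n \<subseteq> ?F m" if "m \<le> n" for m n
    using Jw_append[of "word_prefix v m" "drop m (word_prefix v n)"] fw[of n] take_word_prefix[OF that, of v]
    by (metis append_take_drop_id)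
  have "\<Inter> (range ?F) \<noteq> {}"
  proof (rule compact_nest)
    show "compact (?F n)" for n using Jw_compact[OF fw] .
    show "?F n \<noteq> {}" for n using Jw_image[OF fw] J_nonempty by blast
  qed (rule mono)
  then obtain x where x: "\<And>n. x \<in> ?F n" by blast
  obtain L where L: "0 < L" "\<And>u x y. u \<in> fin_words I \<Longrightarrow> x \<in> Jw u \<Longrightarrow> y \<in> Jw u \<Longrightarrow> dist x y \<le> L * r u"
    using Jw_diameter by metis
  have uniq: "y = x" if y: "\<And>n. 1 \<le> n \<Longrightarrow> y \<in> ?F n" for y
  proof -
    \<comment> \<open>A competing point is only known to lie in the sets of index at least 1, hence
      \<open>Suc n\<close>.\<close>
    have "dist y x \<le> L * c ^ Suc n" for n
    proof -
      have "dist y x \<le> L * r (word_prefix v (Suc n))" by (rule L(2)[OF fw]) (use x y in auto)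
      also have "\<dots> \<le> L * c ^ Suc n" using r_le_power[OF fw, of "Suc n"] L(1) by (intro mult_left_mono) auto
      finally show ?thesis .
    qed
    moreover have "(\<lambda>n. L * c ^ Suc n) \<longlonglongrightarrow> L * 0"
      by (intro tendsto_intros filterlim_compose[OF LIMSEQ_realpow_zero filterlim_Suc]) (use c_pos c_less in auto)
    ultimately have "dist y x \<le> L * 0" by (intro LIMSEQ_le_const) auto
    then show "y = x" by simp
  qed
  have "(\<Inter>n\<in>{1..}. ?F n) = {x}" using x uniq by auto
  then have "coding_map Jw v = x" unfolding coding_map_def by simp
  then show ?thesis using x by simp
qed

text \<open>The coding map is continuous: words with a common prefix of length \<open>n\<close> have
  images within \<open>L * c ^ n\<close>.\<close>

lemma coding_map_measurable: "coding_map Jw \<in> measurable (word_borel I) borel"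
proof (rule borel_measurableI)
  fix U :: "(real^'n) set" assume U: "open U"
  obtain L where L: "0 < L" "\<And>u x y. u \<in> fin_words I \<Longrightarrow> x \<in> Jw u \<Longrightarrow> y \<in> Jw u \<Longrightarrow> dist x y \<le> L * r u"
    using Jw_diameter by metis
  show "coding_map Jw -` U \<inter> space (word_borel I) \<in> sets (word_borel I)"
    unfolding space_word_borel
  proof (rule word_borel_openI)
    fix v assume v: "v \<in> coding_map Jw -` U \<inter> inf_words I"
    then obtain e where e: "0 < e" "ball (coding_map Jw v) e \<subseteq> U" using U openE by (metis IntD1 vimageD)
    obtain n where n: "c ^ n < e / L"
      using real_arch_pow_inv[of "e / L" c] e(1) L(1) c_less by auto
    show "\<exists>n. \<forall>w\<in>inf_words I. word_prefix v n = word_prefix w n \<longrightarrow> w \<in> coding_map Jw -` U \<inter> inf_words I"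
    proof (intro exI[of _ n] ballI impI)
      fix w assume w: "w \<in> inf_words I" "word_prefix v n = word_prefix w n"
      have fw: "word_prefix v n \<in> fin_words I" using v word_prefix_fin_words by blast
      have "dist (coding_map Jw v) (coding_map Jw w) \<le> L * r (word_prefix v n)"
        by (rule L(2)[OF fw]) (use v w coding_map_mem[of v n] coding_map_mem[of w n] in auto)
      also have "\<dots> \<le> L * c ^ n" using r_le_power[OF fw] L(1) by (intro mult_left_mono) auto
      also have "\<dots> < e" using n L(1) by (simp add: pos_less_divide_eq mult.commute)
      finally show "w \<in> coding_map Jw -` U \<inter> inf_words I" using e(2) w(1) by auto
    qed
  qed blast
qed

section \<open>Cut sets\<close>

abbreviation K :: "real \<Rightarrow> 'i list set" where "K \<equiv> cut_set I \<phi> J"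

lemma cut_setD:
  assumes "u \<in> K \<delta>"
  shows "u \<in> fin_words I" "u \<noteq> []" "r u \<le> \<delta>" "\<delta> < r (butlast u)"
  using assms unfolding cut_set_def by auto

lemma snoc_in_cut_set:
  "u @ [i] \<in> fin_words I \<Longrightarrow> r (u @ [i]) \<le> \<delta> \<Longrightarrow> \<delta> < r u \<Longrightarrow> u @ [i] \<in> K \<delta>"
  by (simp add: cut_set_def)

text \<open>The lower bound in the definition of the cut concerns the word without its last letter,
  hence the exponent \<open>length u - 1\<close>.\<close>

lemma cut_set_less_power:
  assumes "u \<in> K \<delta>"
  shows "\<delta> < c ^ (length u - 1)"
  using cut_setD[OF assms] r_le_power[OF butlast_fin_words, of u] by simp

lemma words_subset_fin_words: "words I 1 k \<subseteq> fin_words I"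
  by (auto simp: words_1_iff[unfolded One_nat_def])

lemma finite_cut_set:
  assumes "0 < \<delta>"
  shows "finite (K \<delta>)"
proof -
  obtain n where n: "c ^ n < \<delta>" using real_arch_pow_inv[OF assms c_less] by blast
  have "K \<delta> \<subseteq> (\<Union>k\<in>{..n}. words I 1 k)"
  proof
    fix u assume u: "u \<in> K \<delta>"
    have "c ^ n < c ^ (length u - 1)" using n cut_set_less_power[OF u] by simp
    then have "length u - 1 < n"
      using c_pos c_less by (metis power_decreasing less_imp_le not_le)
    then show "u \<in> (\<Union>k\<in>{..n}. words I 1 k)"
      using cut_setD(1)[OF u] by (auto simp: words_1_iff[unfolded One_nat_def])
  qed
  then show ?thesis by (rule finite_subset) (use finite_words I_finite in auto)
qed

text \<open>The first prefix of norm at most \<open>\<delta>\<close> belongs to the cut. It is not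
  the empty prefix, whose norm 1 exceeds \<open>\<delta>\<close>.\<close>

lemma cut_set_prefix:
  assumes v: "v \<in> inf_words I" and \<delta>: "0 < \<delta>" "\<delta> < 1"
  shows "\<exists>n. word_prefix v n \<in> K \<delta>"
proof -
  have fw: "word_prefix v n \<in> fin_words I" for n by (rule word_prefix_fin_words[OF v])
  define P where "P n \<longleftrightarrow> r (word_prefix v n) \<le> \<delta>" for n
  obtain n where "c ^ n < \<delta>" using real_arch_pow_inv[OF \<delta>(1) c_less] by blast
  then have "P n" unfolding P_def using r_le_power[OF fw, of n] by simp
  then have L: "P (LEAST n. P n)" by (rule LeastI)
  have "\<not> P 0" unfolding P_def using \<delta>(2) by (simp add: r_Nil)
  then obtain m where m: "(LEAST n. P n) = Suc m" using L not0_implies_Suc by metis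
  have "\<not> P m" using not_less_Least[of m P] m by simp
  then have "word_prefix v (Suc m) \<in> K \<delta>"
    using L[unfolded m] \<open>\<not> P m\<close> fw[of "Suc m"]
    unfolding P_def word_prefix_Suc by (intro snoc_in_cut_set) auto
  then show ?thesis by blast
qed

lemma inf_words_nonempty: "inf_words I \<noteq> {}"
  unfolding inf_words_def using I_nonempty by (simp add: PiE_eq_empty_iff)

lemma cut_level_attained:
  assumes "0 < \<delta>" "\<delta> < 1"
  shows "\<exists>u\<in>K \<delta>. length u = cut_level I \<phi> J \<delta>"
proof -
  obtain u where "u \<in> K \<delta>" using inf_words_nonempty cut_set_prefix[OF _ assms] by blast
  then have "\<exists>k. \<exists>u\<in>K \<delta>. length u = k" by blast
  then show ?thesis unfolding cut_level_def by (rule LeastI_ex)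
qed

text \<open>There are finitely many words shorter than \<open>n\<close>, all of positive norm; once
  \<open>\<delta>\<close> is below all these norms, none of them is in the cut.\<close>

lemma cut_set_length_eventually:
  "\<forall>\<^sub>F \<delta> in at_right 0. \<forall>u\<in>K \<delta>. n \<le> length u"
proof -
  define W where "W = (\<Union>k\<in>{..<n}. words I 1 k)"
  have fin: "finite W" unfolding W_def using finite_words I_finite by auto
  have W: "W \<subseteq> fin_words I" unfolding W_def using words_subset_fin_words by blast
  \<comment> \<open>The inserted 1 keeps the minimum meaningful when \<open>W\<close> is
    empty.\<close>
  define d where "d = Min (insert 1 (r ` W))"
  have d: "0 < d" "\<And>u. u \<in> W \<Longrightarrow> d \<le> r u" unfolding d_def using fin W r_pos by auto
  have "\<forall>\<^sub>F \<delta> in at_right 0. \<delta> \<in> {0<..<d}" by (rule eventually_at_right_real[OF d(1)])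
  then show ?thesis
  proof eventually_elim
    case (elim \<delta>)
    show ?case
    proof
      fix u assume u: "u \<in> K \<delta>"
      have "u \<notin> W" using d(2)[of u] cut_setD(3)[OF u] elim by auto
      then show "n \<le> length u" unfolding W_def
        using cut_setD(1)[OF u] by (auto simp: words_1_iff[unfolded One_nat_def])
    qed
  qed
qed

text \<open>Norms do not increase along extensions, so no cut word is a proper prefix of another.
  Two cut words thus part at some letter, where the open set condition applies, and nesting carries
  disjointness down to them.\<close>

lemma cut_set_interior_disjoint:
  assumes osc: "open_set_condition I Jw" and u: "u \<in> K \<delta>" and v: "v \<in> K \<delta>" and ne: "u \<noteq> v"
  shows "interior (Jw u) \<inter> interior (Jw v) = {}"
proof -
  have np: "\<not> prefix x y" if x: "x \<in> K \<delta>" and y: "y \<in> K \<delta>" and "x \<noteq> y" for x y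
  proof
    assume "prefix x y"
    then obtain w where w: "y = x @ w" unfolding prefix_def by blast
    then have "w \<noteq> []" using \<open>x \<noteq> y\<close> by simp
    then have b: "butlast y = x @ butlast w" using w by (simp add: butlast_append)
    have "r (butlast y) \<le> c ^ length (butlast w) * r x"
      unfolding b by (rule r_antimono) (use butlast_fin_words[OF cut_setD(1)[OF y]] b in simp)
    also have "\<dots> \<le> 1 * r x"
      using c_pos c_less r_pos[OF cut_setD(1)[OF x]] by (intro mult_right_mono power_le_one) auto
    finally show False using cut_setD(3)[OF x] cut_setD(4)[OF y] by simp
  qed
  have "parallel u v" using np u v ne by (intro parallelI) metis+
  then obtain w i u' j v' where d: "i \<noteq> j" "u = w @ i # u'" "v = w @ j # v'"
    using parallel_decomp by blast
  have fu: "(w @ [i]) @ u' \<in> fin_words I" and fv: "(w @ [j]) @ v' \<in> fin_words I"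
    using cut_setD(1)[OF u] cut_setD(1)[OF v] d by auto
  have "w @ [i] \<in> fin_words I" "w @ [j] \<in> fin_words I"
    using take_fin_words[OF fu, of "length (w @ [i])"] take_fin_words[OF fv, of "length (w @ [j])"] by auto
  then have wij: "w \<in> words I 1 (length w)" "i \<in> I (Suc (length w))" "j \<in> I (Suc (length w))"
    unfolding snoc_fin_words words_1_iff by auto
  have "interior (Jw (w @ [i])) \<inter> interior (Jw (w @ [j])) = {}"
    using osc wij d(1) unfolding open_set_condition_def by blast
  moreover have "interior (Jw u) \<subseteq> interior (Jw (w @ [i]))" "interior (Jw v) \<subseteq> interior (Jw (w @ [j]))"
    using Jw_append[OF fu] Jw_append[OF fv] d by (auto intro!: interior_mono)
  ultimately show ?thesis by blast
qed

section \<open>Size of the norms in a cut, and counts of sets against cubes\<close>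

lemma sup_deriv_norm_generator_pos:
  assumes "1 \<le> k" "i \<in> I k"
  shows "0 < sup_deriv_norm J (\<phi> k i)"
proof -
  obtain x where x: "x \<in> J" using J_nonempty by blast
  have "0 < deriv_norm (\<phi> k i) x" using map_conformal[OF assms] x J_V conformal_atE by blast
  also have "\<dots> \<le> sup_deriv_norm J (\<phi> k i)" unfolding sup_deriv_norm_def
    by (rule cSUP_upper[OF x]) (use deriv_norm_generator_le[OF assms] in \<open>auto intro: bdd_aboveI2[of _ _ c]\<close>)
  finally show ?thesis .
qed

lemma r_le_max_deriv_norm:
  assumes "u \<in> fin_words I"
  shows "r u \<le> max_deriv_norm I \<phi> J (length u)"
  unfolding max_deriv_norm_def
  by (rule Max_ge) (use assms finite_words I_finite in \<open>auto simp: words_1_iff[unfolded One_nat_def]\<close>)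

text \<open>Makes the logarithm in the denominator of the limit hypothesis negative, so that the
  quotient can be cleared with a known sign.\<close>

lemma max_deriv_norm_less_1:
  assumes "u \<in> fin_words I" "u \<noteq> []"
  shows "max_deriv_norm I \<phi> J (length u) < 1"
proof -
  have "u \<in> words I 1 (length u)" using assms(1) by (simp add: words_1_iff[unfolded One_nat_def])
  moreover have "r w < 1" if "w \<in> words I 1 (length u)" for w
  proof -
    have w: "w \<in> fin_words I" "length w = length u" using that by (auto simp: words_1_iff[unfolded One_nat_def])
    have "r w \<le> c ^ length u" using r_le_power[OF w(1)] w(2) by simp
    also have "\<dots> < 1" using assms(2) c_pos c_less by (intro power_less_one_iff[THEN iffD2]) auto
    finally show ?thesis .
  qed
  ultimately show ?thesis unfolding max_deriv_norm_def
    using finite_words I_finite by (subst Max_less_iff) auto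
qed

lemma min_level_deriv_norm_bounds:
  assumes "1 \<le> k" "i \<in> I k"
  shows "0 < min_level_deriv_norm I \<phi> J k" "min_level_deriv_norm I \<phi> J k \<le> sup_deriv_norm J (\<phi> k i)"
proof -
  have ne: "(\<lambda>j. sup_deriv_norm J (\<phi> k j)) ` I k \<noteq> {}" using assms(2) by blast
  have fin: "finite ((\<lambda>j. sup_deriv_norm J (\<phi> k j)) ` I k)" using I_finite[OF assms(1)] by simp
  show "0 < min_level_deriv_norm I \<phi> J k"
    unfolding min_level_deriv_norm_def Min_gr_iff[OF fin ne]
    using sup_deriv_norm_generator_pos[OF assms(1)] by blast
  show "min_level_deriv_norm I \<phi> J k \<le> sup_deriv_norm J (\<phi> k i)"
    unfolding min_level_deriv_norm_def by (rule Min_le[OF fin]) (use assms(2) in blast)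
qed

text \<open>Before its last letter a cut word has norm above \<open>\<delta>\<close>, so it falls
  short of \<open>\<delta>\<close> by at most one generator norm, up to \<open>C\<close>. By the
  limit hypothesis that norm exceeds \<open>r u powr e\<close> for any small \<open>e\<close> once
  the words are long.\<close>

lemma cut_set_r_ge:
  assumes lim: "(\<lambda>k. ln (min_level_deriv_norm I \<phi> J k) / ln (max_deriv_norm I \<phi> J k)) \<longlonglongrightarrow> 0"
    and \<kappa>: "0 < \<kappa>"
  shows "\<forall>\<^sub>F \<delta> in at_right 0. \<forall>u\<in>K \<delta>. \<delta> powr (1 + \<kappa>) \<le> r u"
proof -
  \<comment> \<open>Chosen so that \<open>(1 - e) * (1 + \<kappa>) = 1 + \<kappa> / 2\<close>; the
    remaining \<open>\<kappa> / 2\<close> pays for the constant \<open>C\<close>.\<close>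
  define e where "e = \<kappa> / (2 * (1 + \<kappa>))"
  have e: "0 < e" "e < 1" "(1 - e) * (1 + \<kappa>) = 1 + \<kappa> / 2"
    unfolding e_def using \<kappa> by (auto simp: divide_simps) (simp add: algebra_simps)
  have "\<forall>\<^sub>F k in sequentially. ln (min_level_deriv_norm I \<phi> J k) / ln (max_deriv_norm I \<phi> J k) < e"
    using order_tendstoD(2)[OF lim e(1)] .
  then obtain n where n: "\<And>k. n \<le> k \<Longrightarrow> ln (min_level_deriv_norm I \<phi> J k) / ln (max_deriv_norm I \<phi> J k) < e"
    unfolding eventually_sequentially by blast
  have "\<forall>\<^sub>F \<delta> in at_right 0. C * \<delta> powr (\<kappa> / 2) \<le> 1"
    by (rule eventually_const_powr_le_1) (use \<kappa> in simp)
  then show ?thesis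
    using cut_set_length_eventually[of n] eventually_at_right_real[OF zero_less_one]
  proof eventually_elim
    case (elim \<delta>)
    have "ln (C * \<delta> powr (\<kappa> / 2)) \<le> 0" using elim C_ge by (intro ln_le_zero_iff[THEN iffD2]) auto
    then have lnC: "ln C + \<kappa> / 2 * ln \<delta> \<le> 0" using elim C_ge by (simp add: ln_mult ln_powr)
    show ?case
    proof
      fix u assume u: "u \<in> K \<delta>"
      note uD = cut_setD[OF u]
      define w i where "w = butlast u" and "i = last u"
      have uw: "u = w @ [i]" unfolding w_def i_def using uD(2) by simp
      have w: "w \<in> fin_words I" and i: "i \<in> I (Suc (length w))" using uD(1) unfolding uw snoc_fin_words by auto
      have len: "length u = Suc (length w)" unfolding uw by simp
      let ?M = "max_deriv_norm I \<phi> J (length u)" and ?m = "min_level_deriv_norm I \<phi> J (length u)"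
      have rM: "r u \<le> ?M" by (rule r_le_max_deriv_norm[OF uD(1)])
      have ru: "0 < r u" by (rule r_pos[OF uD(1)])
      have lnM: "ln ?M < 0" using max_deriv_norm_less_1[OF uD(1,2)] rM ru by simp
      have "ln ?m / ln ?M < e" using n elim(2) u by blast
      then have "e * ln ?M < ln ?m" using lnM by (simp add: neg_divide_less_eq)
      moreover have "ln (r u) \<le> ln ?M" using rM ru by (intro ln_mono) auto
      ultimately have 1: "e * ln (r u) < ln ?m" using e(1) by (smt (verit) mult_left_mono)
      have m: "0 < ?m" "?m \<le> sup_deriv_norm J (\<phi> (Suc (length w)) i)"
        unfolding len using min_level_deriv_norm_bounds[OF _ i] by auto
      have "\<delta> * ?m \<le> r w * sup_deriv_norm J (\<phi> (Suc (length w)) i)"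
        by (rule mult_mono) (use uD(4) m r_pos[OF w] in \<open>auto simp: w_def\<close>)
      also have "\<dots> \<le> C * r u" using r_snoc_ge[of w i] uD(1) unfolding uw by simp
      finally have "ln (\<delta> * ?m) \<le> ln (C * r u)" using elim(3) m by (intro ln_mono) auto
      then have "ln \<delta> + ln ?m \<le> ln C + ln (r u)"
        using elim(3) m(1) C_ge ru by (simp add: ln_mult)
      then have "ln \<delta> + \<kappa> / 2 * ln \<delta> \<le> (1 - e) * ln (r u)" using 1 lnC by (simp add: algebra_simps)
      then have "(1 - e) * ((1 + \<kappa>) * ln \<delta>) \<le> (1 - e) * ln (r u)"
        using e(3) by (metis distrib_right mult.assoc mult_1)
      then have "(1 + \<kappa>) * ln \<delta> \<le> ln (r u)" using e(2) by simp
      then have "exp ((1 + \<kappa>) * ln \<delta>) \<le> exp (ln (r u))" by simp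
      then show "\<delta> powr (1 + \<kappa>) \<le> r u" using ru elim(3) by (simp add: powr_def)
    qed
  qed
qed

text \<open>The sets meeting one cube contain disjoint balls of radius
  \<open>b * \<delta> powr (1 + \<kappa>')\<close>, all within a ball of radius
  \<open>R * \<delta>\<close>. Comparing volumes raises the ratio of the radii to the power of the
  dimension.\<close>

lemma cut_set_hit_count:
  assumes osc: "open_set_condition I Jw"
    and lim: "(\<lambda>k. ln (min_level_deriv_norm I \<phi> J k) / ln (max_deriv_norm I \<phi> J k)) \<longlonglongrightarrow> 0"
    and \<kappa>: "0 < \<kappa>"
  obtains A where "0 < A"
    "\<forall>\<^sub>F \<delta> in at_right 0. \<forall>Q\<in>mesh_cubes \<delta>. real (card {u \<in> K \<delta>. Jw u \<inter> Q \<noteq> {}}) \<le> A * \<delta> powr (- \<kappa>)"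
proof -
  let ?d = "CARD('n)"
  obtain L where L: "0 < L" "\<And>u x y. u \<in> fin_words I \<Longrightarrow> x \<in> Jw u \<Longrightarrow> y \<in> Jw u \<Longrightarrow> dist x y \<le> L * r u"
    using Jw_diameter by metis
  obtain b where b: "0 < b" "\<And>u. u \<in> fin_words I \<Longrightarrow> \<exists>z. ball z (b * r u) \<subseteq> interior (Jw u)"
    using Jw_inner_ball by metis
  \<comment> \<open>The cube contributes at most \<open>real ?d * \<delta>\<close> and the set
    \<open>Jw u\<close> at most \<open>L * \<delta>\<close>; the added 1 makes the inclusion in the
    open ball strict.\<close>
  define R where "R = real ?d + L + 1"
  have R: "0 < R" unfolding R_def using L(1) by simp
  \<comment> \<open>Divided by the dimension, since the ratio of radii is raised to that
    power.\<close>
  define \<kappa>' where "\<kappa>' = \<kappa> / real ?d"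
  have \<kappa>': "0 < \<kappa>'" "real ?d * \<kappa>' = \<kappa>" unfolding \<kappa>'_def using \<kappa> by auto
  obtain z where z: "\<And>u. u \<in> fin_words I \<Longrightarrow> ball (z u) (b * r u) \<subseteq> interior (Jw u)"
    using b(2) by metis
  show thesis
  proof (rule that[of "(R / b) ^ ?d"])
    show "0 < (R / b) ^ ?d" using R b(1) by simp
    show "\<forall>\<^sub>F \<delta> in at_right 0. \<forall>Q\<in>mesh_cubes \<delta>.
        real (card {u \<in> K \<delta>. Jw u \<inter> Q \<noteq> {}}) \<le> (R / b) ^ ?d * \<delta> powr (- \<kappa>)"
      using cut_set_r_ge[OF lim \<kappa>'(1)] eventually_at_right_real[OF zero_less_one]
    proof eventually_elim
      case (elim \<delta>)
      then have \<delta>: "0 < \<delta>" by simp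
      show ?case
      proof
        fix Q :: "(real^'n) set" assume Q: "Q \<in> mesh_cubes \<delta>"
        define \<rho> where "\<rho> = b * \<delta> powr (1 + \<kappa>')"
        have \<rho>: "0 < \<rho>" unfolding \<rho>_def using b(1) \<delta> by simp
        show "real (card {u \<in> K \<delta>. Jw u \<inter> Q \<noteq> {}}) \<le> (R / b) ^ ?d * \<delta> powr (- \<kappa>)"
        proof (cases "Q = {}")
          case False
          then obtain p where p: "p \<in> Q" by blast
          have diamQ: "dist p y \<le> real ?d * \<delta>" if "y \<in> Q" for y
          proof -
            obtain m :: "'n \<Rightarrow> int" where m: "Q = {x. \<forall>j. of_int (m j) * \<delta> \<le> x $ j \<and> x $ j < (of_int (m j) + 1) * \<delta>}"
              using Q unfolding mesh_cubes_def by (elim rangeE)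
            have "\<bar>(p - y) $ j\<bar> \<le> \<delta>" for j
            proof -
              have "of_int (m j) * \<delta> \<le> p $ j" "p $ j < (of_int (m j) + 1) * \<delta>"
                "of_int (m j) * \<delta> \<le> y $ j" "y $ j < (of_int (m j) + 1) * \<delta>"
                using p that unfolding m by auto
              then show ?thesis by (simp add: algebra_simps abs_le_iff)
            qed
            then have "(\<Sum>j\<in>UNIV. \<bar>(p - y) $ j\<bar>) \<le> real ?d * \<delta>" by (intro sum_bounded_above) simp
            then show ?thesis using norm_le_l1_cart[of "p - y"] by (simp add: dist_norm)
          qed
          \<comment> \<open>The inner balls are shrunk to one common radius, as the volume count
            requires.\<close>
          have small: "ball (z u) \<rho> \<subseteq> interior (Jw u)" if "u \<in> K \<delta>" for u
          proof -
            have "\<rho> \<le> b * r u" unfolding \<rho>_def using elim(1) that b(1) by (intro mult_left_mono) auto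
            then show ?thesis using z[OF cut_setD(1)[OF that]] subset_ball by blast
          qed
          have "real (card {u \<in> K \<delta>. Jw u \<inter> Q \<noteq> {}}) \<le> (R * \<delta> / \<rho>) ^ DIM(real^'n)"
          proof (rule card_disjoint_balls[of _ z \<rho> p])
            show "finite {u \<in> K \<delta>. Jw u \<inter> Q \<noteq> {}}" using finite_cut_set[OF \<delta>] by simp
            show "disjoint_family_on (\<lambda>u. ball (z u) \<rho>) {u \<in> K \<delta>. Jw u \<inter> Q \<noteq> {}}"
              unfolding disjoint_family_on_def
            proof (intro ballI impI)
              fix u v assume "u \<in> {u \<in> K \<delta>. Jw u \<inter> Q \<noteq> {}}" "v \<in> {u \<in> K \<delta>. Jw u \<inter> Q \<noteq> {}}" "u \<noteq> v"
              then have "u \<in> K \<delta>" "v \<in> K \<delta>" "interior (Jw u) \<inter> interior (Jw v) = {}"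
                using cut_set_interior_disjoint[OF osc] by auto
              then show "ball (z u) \<rho> \<inter> ball (z v) \<rho> = {}" using small by blast
            qed
            show "ball (z u) \<rho> \<subseteq> ball p (R * \<delta>)" if u: "u \<in> {u \<in> K \<delta>. Jw u \<inter> Q \<noteq> {}}" for u
            proof
              fix x assume x: "x \<in> ball (z u) \<rho>"
              have uK: "u \<in> K \<delta>" using u by simp
              obtain y where y: "y \<in> Jw u" "y \<in> Q" using u by blast
              have "x \<in> Jw u" using small[OF uK] x interior_subset by blast
              then have "dist y x \<le> L * r u" using L(2)[OF cut_setD(1)[OF uK]] y by blast
              also have "\<dots> \<le> L * \<delta>" using cut_setD(3)[OF uK] L(1) by (intro mult_left_mono) auto
              finally have "dist p x \<le> real ?d * \<delta> + L * \<delta>"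
                using diamQ[OF y(2)] dist_triangle[of p x y] by linarith
              also have "\<dots> < R * \<delta>" unfolding R_def using \<delta> by (simp add: algebra_simps)
              finally show "x \<in> ball p (R * \<delta>)" by simp
            qed
          qed (use \<rho> R \<delta> in auto)
          also have "R * \<delta> / \<rho> = R / b * \<delta> powr (- \<kappa>')"
            unfolding \<rho>_def using b(1) \<delta> by (simp add: powr_add powr_minus divide_simps)
          also have "\<dots> ^ DIM(real^'n) = (R / b) ^ ?d * \<delta> powr (- \<kappa>)"
            unfolding \<kappa>'(2)[symmetric] power_mult_distrib
            using \<delta> by (simp add: powr_realpow[symmetric] powr_powr mult.commute)
          finally show ?thesis .
        qed (use R b(1) in simp)
      qed
    qed
  qed
qed

text \<open>The diameter of \<open>Jw u\<close> is at most \<open>L * \<delta>\<close>, a fixed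
  multiple of the mesh size, so the count does not depend on the scale.\<close>

lemma Jw_mesh_count:
  obtains B where "0 < B"
    "\<And>\<delta> u. 0 < \<delta> \<Longrightarrow> u \<in> K \<delta> \<Longrightarrow> finite {Q \<in> mesh_cubes \<delta>. Jw u \<inter> Q \<noteq> {}} \<and>
       real (card {Q \<in> mesh_cubes \<delta>. Jw u \<inter> Q \<noteq> {}}) \<le> B"
proof -
  obtain L where L: "0 < L" "\<And>u x y. u \<in> fin_words I \<Longrightarrow> x \<in> Jw u \<Longrightarrow> y \<in> Jw u \<Longrightarrow> dist x y \<le> L * r u"
    using Jw_diameter by metis
  define N where "N = nat \<lceil>L\<rceil>"
  have N: "L \<le> real N" unfolding N_def by linarith
  show thesis
  proof (rule that[of "real ((2 * N + 3) ^ CARD('n))"])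
    show "0 < real ((2 * N + 3) ^ CARD('n))" by simp
    fix \<delta> :: real and u assume \<delta>: "0 < \<delta>" and u: "u \<in> K \<delta>"
    note uD = cut_setD[OF u]
    obtain x where x: "x \<in> Jw u" using Jw_image[OF uD(1)] J_nonempty by blast
    have "Jw u \<subseteq> cball x (real N * \<delta>)"
    proof
      fix y assume "y \<in> Jw u"
      then have "dist x y \<le> L * r u" using L(2)[OF uD(1) x] by blast
      also have "\<dots> \<le> real N * \<delta>" using N uD(3) L(1) r_pos[OF uD(1)] by (intro mult_mono) auto
      finally show "y \<in> cball x (real N * \<delta>)" by simp
    qed
    from mesh_cubes_hit[OF \<delta> this]
    show "finite {Q \<in> mesh_cubes \<delta>. Jw u \<inter> Q \<noteq> {}} \<and>
        real (card {Q \<in> mesh_cubes \<delta>. Jw u \<inter> Q \<noteq> {}}) \<le> real ((2 * N + 3) ^ CARD('n))"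
      unfolding Int_commute[of "Jw u"] of_nat_le_iff by blast
  qed
qed

end

section \<open>Level and cut pressures\<close>

locale measured_conformal_system = conformal_system I \<phi> J Jw V c C + finite_measure \<mu>
  for I :: "nat \<Rightarrow> 'i set" and \<phi> :: "nat \<Rightarrow> 'i \<Rightarrow> real^'n \<Rightarrow> real^'n" and J Jw V c C
    and \<mu> :: "(nat \<Rightarrow> 'i) measure" +
  assumes sets_\<mu>: "sets \<mu> = sets (word_borel I)" and \<mu>_pos: "0 < emeasure \<mu> (inf_words I)"
begin

abbreviation m :: "'i list \<Rightarrow> real" where "m u \<equiv> measure \<mu> (cylinder I u)"

abbreviation \<nu> :: "(real^'n) measure" where "\<nu> \<equiv> image_measure Jw \<mu>"

text \<open>Written in the exponent \<open>s\<close> instead of \<open>t\<close>, so that decay goes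
  in the same direction for \<open>q < 1\<close> and \<open>q > 1\<close>.\<close>

definition Z :: "real \<Rightarrow> real \<Rightarrow> 'i list set \<Rightarrow> real" where
  "Z q s W = (\<Sum>u\<in>W. r u powr s * m u powr q)"

lemma pressure_sum_eq_Z: "pressure_sum I \<phi> J \<mu> t q W = Z q (t * (1 - q)) W"
  by (simp add: pressure_sum_def Z_def)

lemma space_\<mu>: "space \<mu> = inf_words I"
  using sets_eq_imp_space_eq[OF sets_\<mu>] by (simp add: space_word_borel)

lemma cylinder_measurable [measurable]: "cylinder I u \<in> sets \<mu>"
  unfolding sets_\<mu> by (rule cylinder_sets)

lemma coding_map_borel: "coding_map Jw \<in> measurable \<mu> borel"
  using coding_map_measurable measurable_cong_sets[OF sets_\<mu> refl] by blast

lemma measure_\<nu>: "A \<in> sets borel \<Longrightarrow> measure \<nu> A = measure \<mu> (coding_map Jw -` A \<inter> inf_words I)"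
  unfolding image_measure_def using measure_distr[OF coding_map_borel] by (simp add: space_\<mu>)

lemma Z_nonneg: "0 \<le> Z q s W"
  unfolding Z_def by (intro sum_nonneg) simp

text \<open>The cylinders of \<open>W\<close> cover the space of infinite words, so positive total
  mass forces one of them to have positive mass.\<close>

lemma Z_pos:
  assumes fin: "finite W" and W: "W \<subseteq> fin_words I"
    and cover: "\<And>v. v \<in> inf_words I \<Longrightarrow> \<exists>n. word_prefix v n \<in> W"
  shows "0 < Z q s W"
proof -
  have "inf_words I \<subseteq> (\<Union>u\<in>W. cylinder I u)"
  proof
    fix v assume v: "v \<in> inf_words I"
    then obtain n where "word_prefix v n \<in> W" using cover by blast
    then show "v \<in> (\<Union>u\<in>W. cylinder I u)"
      using v by (auto simp: cylinder_def intro!: bexI[of _ "word_prefix v n"])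
  qed
  then have "measure \<mu> (inf_words I) \<le> measure \<mu> (\<Union>u\<in>W. cylinder I u)"
    using fin by (intro finite_measure_mono) auto
  also have "\<dots> \<le> (\<Sum>u\<in>W. m u)"
    using fin by (intro finite_measure_subadditive_finite) auto
  finally have "measure \<mu> (inf_words I) \<le> (\<Sum>u\<in>W. m u)" .
  moreover have "0 < measure \<mu> (inf_words I)"
    using \<mu>_pos by (simp add: emeasure_eq_measure)
  ultimately have "\<not> (\<Sum>u\<in>W. m u) \<le> 0" by linarith
  then obtain u where u: "u \<in> W" "0 < m u" using sum_nonpos[of W m] not_le by blast
  then have "0 < r u powr s * m u powr q" using r_pos[of u] W by auto
  also have "\<dots> \<le> Z q s W" unfolding Z_def
    by (rule member_le_sum[of u W "\<lambda>u. r u powr s * m u powr q"]) (use u fin in auto)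
  finally show ?thesis .
qed

lemma Z_words_pos: "0 < Z q s (words I 1 k)"
proof (rule Z_pos)
  show "finite (words I 1 k)" using finite_words I_finite by blast
  show "words I 1 k \<subseteq> fin_words I" by (rule words_subset_fin_words)
  show "\<exists>n. word_prefix v n \<in> words I 1 k" if "v \<in> inf_words I" for v
    unfolding words_1_iff using word_prefix_fin_words[OF that] by (intro exI[of _ k]) simp
qed

lemma Z_cut_set_pos: "0 < \<delta> \<Longrightarrow> \<delta> < 1 \<Longrightarrow> 0 < Z q s (K \<delta>)"
  by (rule Z_pos) (use finite_cut_set cut_setD(1) cut_set_prefix in auto)

text \<open>Each term gains the factor \<open>r u powr (s' - s)\<close>. This gain pays for the
  geometric series in the comparison of levels and cuts.\<close>

lemma Z_decay:
  assumes W: "W \<subseteq> fin_words I" and \<rho>: "\<And>u. u \<in> W \<Longrightarrow> r u \<le> \<rho>" and s: "s \<le> s'"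
  shows "Z q s' W \<le> \<rho> powr (s' - s) * Z q s W"
  unfolding Z_def sum_distrib_left
proof (rule sum_mono)
  fix u assume u: "u \<in> W"
  have "r u powr s' = r u powr (s' - s) * r u powr s" by (simp add: powr_add[symmetric])
  also have "\<dots> \<le> \<rho> powr (s' - s) * r u powr s"
    using \<rho>[OF u] r_pos[of u] u W s by (intro mult_right_mono powr_mono2) auto
  finally have "r u powr s' * m u powr q \<le> \<rho> powr (s' - s) * r u powr s * m u powr q"
    by (intro mult_right_mono) auto
  then show "r u powr s' * m u powr q \<le> \<rho> powr (s' - s) * (r u powr s * m u powr q)"
    by (simp add: mult.assoc)
qed

lemma Z_words_decay:
  assumes "s \<le> s'"
  shows "Z q s' (words I 1 k) \<le> (c powr (s' - s)) ^ k * Z q s (words I 1 k)"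
proof -
  have "Z q s' (words I 1 k) \<le> (c ^ k) powr (s' - s) * Z q s (words I 1 k)"
    by (rule Z_decay[OF words_subset_fin_words _ assms])
      (auto simp: words_1_iff[unfolded One_nat_def] intro: r_le_power)
  also have "(c ^ k) powr (s' - s) = (c powr (s' - s)) ^ k"
    using c_pos by (simp add: powr_realpow[symmetric] powr_powr mult.commute)
  finally show ?thesis .
qed

lemma Z_cut_set_decay: "s \<le> s' \<Longrightarrow> Z q s' (K \<delta>) \<le> \<delta> powr (s' - s) * Z q s (K \<delta>)"
  by (rule Z_decay) (auto dest: cut_setD)

section \<open>Comparison of levels and cuts\<close>

lemma Z_cover_le:
  assumes "finite A" "\<And>n. n \<in> A \<Longrightarrow> finite (B n)" "W \<subseteq> (\<Union>n\<in>A. B n)"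
  shows "Z q s W \<le> (\<Sum>n\<in>A. Z q s (B n))"
  unfolding Z_def by (rule sum_cover_le) (use assms in auto)

text \<open>Since \<open>r (u @ [i]) \<le> c * r u\<close>, the interval from \<open>r (u @ [i])\<close> to \<open>r u\<close> contains a power of \<open>c\<close>.\<close>

lemma word_in_cut_set_power:
  assumes u: "u \<in> words I 1 k" and k: "0 < k"
  shows "\<exists>n\<ge>k. u \<in> K (c ^ n)"
proof -
  have fu: "u \<in> fin_words I" "length u = k" using u unfolding words_1_iff by auto
  then have "u \<noteq> []" using k by auto
  then obtain w i where uw: "u = w @ [i]" using rev_exhaust by blast
  have rs: "r u \<le> c * r w" using r_snoc_le fu(1) unfolding uw by simp
  have w: "w \<in> fin_words I" using fu(1) unfolding uw snoc_fin_words by simp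
  define P where "P n \<longleftrightarrow> c ^ n < r w" for n
  obtain n0 where "c ^ n0 < r w" using real_arch_pow_inv[OF r_pos[OF w] c_less] by blast
  then have P: "P (LEAST n. P n)" unfolding P_def by (rule LeastI)
  define n where "n = (LEAST n. P n)"
  have n: "c ^ n < r w" using P unfolding n_def P_def .
  have "c ^ n < c ^ length w" using n r_le_power[OF w] by simp
  then have "length w < n" using c_pos c_less by (metis power_decreasing less_imp_le not_le)
  then have kn: "k \<le> n" using fu(2) unfolding uw by simp
  then obtain n' where n': "n = Suc n'" using k by (cases n) auto
  \<comment> \<open>By minimality the preceding power is at least \<open>r w\<close>, and the factor
    \<open>c\<close> gained by the last letter brings \<open>r u\<close> to at most
    \<open>c ^ n\<close>.\<close>
  have "\<not> P n'" using not_less_Least[of n' P] n' unfolding n_def by simp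
  then have "r w \<le> c ^ n'" unfolding P_def by simp
  then have "c * r w \<le> c ^ n" unfolding n' using c_pos by simp
  then have "u \<in> K (c ^ n)" using rs n fu(1) unfolding uw by (intro snoc_in_cut_set) auto
  then show ?thesis using kn by blast
qed

lemma power_tail_eventually_le_1:
  assumes "0 \<le> x" "x < 1"
  shows "\<forall>\<^sub>F k in sequentially. x ^ k / (1 - x) \<le> (1 :: real)"
proof -
  have "(\<lambda>k. x ^ k) \<longlonglongrightarrow> 0" using assms by (intro LIMSEQ_realpow_zero)
  then have "\<forall>\<^sub>F k in sequentially. x ^ k < 1 - x" using assms by (intro order_tendstoD) auto
  then show ?thesis by (rule eventually_mono) (use assms in \<open>simp add: pos_divide_le_eq\<close>)
qed

lemma cut_imp_level_threshold:
  assumes Z: "\<forall>\<^sub>F \<delta> in at_right 0. Z q s (K \<delta>) \<le> 1" and s: "s < s'"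
  shows "\<forall>\<^sub>F k in sequentially. Z q s' (words I 1 k) \<le> 1"
proof -
  obtain d where d: "0 < d" "\<And>\<delta>. 0 < \<delta> \<Longrightarrow> \<delta> < d \<Longrightarrow> Z q s (K \<delta>) \<le> 1"
    using Z unfolding eventually_at_right_field by auto
  define x where "x = c powr (s' - s)"
  have x: "0 \<le> x" "x < 1" unfolding x_def using powr01_less_one[OF c_pos c_less, of "s' - s"] s by auto
  have "(\<lambda>k. c ^ k) \<longlonglongrightarrow> 0" using c_pos c_less by (intro LIMSEQ_realpow_zero) auto
  then have "\<forall>\<^sub>F k in sequentially. c ^ k < d" using d(1) by (rule order_tendstoD)
  then show ?thesis
    using power_tail_eventually_le_1[OF x] eventually_gt_at_top[of 0]
  proof eventually_elim
    case (elim k)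
    let ?W = "words I 1 k"
    have fin: "finite ?W" using finite_words I_finite by blast
    have "\<forall>u\<in>?W. \<exists>n. k \<le> n \<and> u \<in> K (c ^ n)"
      using word_in_cut_set_power elim(3) by blast
    then obtain f where f: "\<And>u. u \<in> ?W \<Longrightarrow> k \<le> f u \<and> u \<in> K (c ^ f u)" by metis
    \<comment> \<open>Finitely many words use finitely many scales, so a finite stretch of the
      geometric series is enough.\<close>
    define M where "M = Max (f ` ?W)"
    have "?W \<subseteq> (\<Union>n\<in>{k..M}. K (c ^ n))"
    proof
      fix u assume u: "u \<in> ?W"
      then have "f u \<le> M" unfolding M_def using fin by simp
      then show "u \<in> (\<Union>n\<in>{k..M}. K (c ^ n))" using f[OF u] by auto
    qed
    then have "Z q s' ?W \<le> (\<Sum>n\<in>{k..M}. Z q s' (K (c ^ n)))"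
      by (rule Z_cover_le[rotated 2]) (use finite_cut_set c_pos in auto)
    also have "\<dots> \<le> (\<Sum>n\<in>{k..M}. x ^ n)"
    proof (rule sum_mono)
      fix n assume n: "n \<in> {k..M}"
      have "c ^ n \<le> c ^ k" using n c_pos c_less by (intro power_decreasing) auto
      then have "Z q s (K (c ^ n)) \<le> 1" using d(2) elim(1) c_pos by simp
      then have "(c ^ n) powr (s' - s) * Z q s (K (c ^ n)) \<le> (c ^ n) powr (s' - s) * 1"
        by (intro mult_left_mono) auto
      then have "Z q s' (K (c ^ n)) \<le> (c ^ n) powr (s' - s)"
        using Z_cut_set_decay[of s s' q "c ^ n"] s by simp
      also have "\<dots> = x ^ n" unfolding x_def
        using c_pos by (simp add: powr_realpow[symmetric] powr_powr mult.commute)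
      finally show "Z q s' (K (c ^ n)) \<le> x ^ n" .
    qed
    also have "\<dots> \<le> x ^ k / (1 - x)" by (rule sum_power_tail_le[OF x])
    also have "\<dots> \<le> 1" by (rule elim(2))
    finally show ?case .
  qed
qed

lemma level_imp_cut_threshold:
  assumes Z: "\<forall>\<^sub>F k in sequentially. Z q s (words I 1 k) \<le> 1" and s: "s < s'"
  shows "\<forall>\<^sub>F \<delta> in at_right 0. Z q s' (K \<delta>) \<le> 1"
proof -
  define x where "x = c powr (s' - s)"
  have x: "0 \<le> x" "x < 1" unfolding x_def using powr01_less_one[OF c_pos c_less, of "s' - s"] s by auto
  obtain N where N: "\<And>k. N \<le> k \<Longrightarrow> Z q s (words I 1 k) \<le> 1" "\<And>k. N \<le> k \<Longrightarrow> x ^ k / (1 - x) \<le> 1"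
    using eventually_conj[OF Z power_tail_eventually_le_1[OF x]] unfolding eventually_sequentially by blast
  show ?thesis
    using cut_set_length_eventually[of N] eventually_at_right_real[OF zero_less_one]
  proof eventually_elim
    case (elim \<delta>)
    have fin: "finite (K \<delta>)" using finite_cut_set elim(2) by simp
    define M where "M = Max (length ` K \<delta>)"
    have "K \<delta> \<subseteq> (\<Union>k\<in>{N..M}. words I 1 k)"
    proof
      fix u assume u: "u \<in> K \<delta>"
      then have "length u \<le> M" unfolding M_def using fin by simp
      moreover have "u \<in> words I 1 (length u)" using cut_setD(1)[OF u] unfolding words_1_iff by simp
      ultimately show "u \<in> (\<Union>k\<in>{N..M}. words I 1 k)" using elim(1) u by force
    qed
    then have "Z q s' (K \<delta>) \<le> (\<Sum>k\<in>{N..M}. Z q s' (words I 1 k))"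
      by (rule Z_cover_le[rotated 2]) (use finite_words I_finite in auto)
    also have "\<dots> \<le> (\<Sum>k\<in>{N..M}. x ^ k)"
    proof (rule sum_mono)
      fix k assume k: "k \<in> {N..M}"
      have "Z q s' (words I 1 k) \<le> x ^ k * Z q s (words I 1 k)"
        unfolding x_def by (rule Z_words_decay) (use s in simp)
      also have "\<dots> \<le> x ^ k * 1" using N(1)[of k] k x(1) by (intro mult_left_mono) auto
      finally show "Z q s' (words I 1 k) \<le> x ^ k" by simp
    qed
    also have "\<dots> \<le> x ^ N / (1 - x)" by (rule sum_power_tail_le[OF x])
    also have "\<dots> \<le> 1" by (rule N(2)) simp
    finally show ?case .
  qed
qed

lemma level_jump_eq:
  shows "q < 1 \<Longrightarrow> upper_level_jump I \<phi> J \<mu> q =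
      Inf (ereal ` {t. \<forall>\<^sub>F k in sequentially. Z q (t * (1 - q)) (words I 1 k) \<le> 1})"
    and "1 < q \<Longrightarrow> lower_level_jump I \<phi> J \<mu> q =
      Inf (ereal ` {t. \<not> (\<forall>\<^sub>F k in sequentially. Z q (t * (1 - q)) (words I 1 k) \<le> 1)})"
proof -
  \<comment> \<open>Each letter multiplies the norm by at most \<open>c\<close>, so the decay rate
    per level is \<open>- ln c\<close>.\<close>
  have l: "0 < - ln c" using c_pos c_less by simp
  have n: "\<forall>\<^sub>F k in sequentially. 0 < real k" using eventually_gt_at_top[of 0] by eventually_elim simp
  have pos: "\<forall>\<^sub>F k in sequentially. \<forall>s. 0 < Z q s (words I 1 k)"
    using Z_words_pos by (intro always_eventually) blast
  have decay: "\<forall>\<^sub>F k in sequentially. \<forall>s s'. s \<le> s' \<longrightarrow>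
      Z q s' (words I 1 k) \<le> exp (- ((s' - s) * (- ln c) * real k)) * Z q s (words I 1 k)"
  proof (intro always_eventually allI impI)
    fix k s s' assume "(s :: real) \<le> s'"
    have "exp (- ((s' - s) * (- ln c) * real k)) = exp (real k * ((s' - s) * ln c))"
      by (simp add: mult_ac)
    also have "\<dots> = (c powr (s' - s)) ^ k"
      unfolding exp_of_nat_mult using c_pos by (simp add: powr_def)
    finally have "exp (- ((s' - s) * (- ln c) * real k)) = (c powr (s' - s)) ^ k" .
    then show "Z q s' (words I 1 k) \<le> exp (- ((s' - s) * (- ln c) * real k)) * Z q s (words I 1 k)"
      using Z_words_decay[OF \<open>s \<le> s'\<close>, of q k] by simp
  qed
  show "upper_level_jump I \<phi> J \<mu> q =
      Inf (ereal ` {t. \<forall>\<^sub>F k in sequentially. Z q (t * (1 - q)) (words I 1 k) \<le> 1})" if "q < 1"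
    unfolding upper_level_jump_def upper_level_pressure_def level_pressure_term_def pressure_sum_eq_Z
    by (rule jump_point_Limsup[OF n pos l decay that])
  show "lower_level_jump I \<phi> J \<mu> q =
      Inf (ereal ` {t. \<not> (\<forall>\<^sub>F k in sequentially. Z q (t * (1 - q)) (words I 1 k) \<le> 1)})" if "1 < q"
    unfolding lower_level_jump_def lower_level_pressure_def level_pressure_term_def pressure_sum_eq_Z
    by (rule jump_point_Liminf[OF n pos l decay that])
qed

lemma cut_jump_eq:
  shows "q < 1 \<Longrightarrow> upper_cut_jump I \<phi> J \<mu> q =
      Inf (ereal ` {t. \<forall>\<^sub>F \<delta> in at_right 0. Z q (t * (1 - q)) (K \<delta>) \<le> 1})"
    and "1 < q \<Longrightarrow> lower_cut_jump I \<phi> J \<mu> q =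
      Inf (ereal ` {t. \<not> (\<forall>\<^sub>F \<delta> in at_right 0. Z q (t * (1 - q)) (K \<delta>) \<le> 1)})"
proof -
  let ?n = "\<lambda>\<delta>. real (cut_level I \<phi> J \<delta>)"
  \<comment> \<open>The shortest cut word, of length \<open>n\<close>, yields only
    \<open>\<delta> < c ^ (n - 1)\<close>. As \<open>n - 1 \<ge> n / 2\<close> for
    \<open>n \<ge> 2\<close>, half the rate remains.\<close>
  have l: "0 < - ln c / 2" using c_pos c_less by simp
  have level: "\<forall>\<^sub>F \<delta> in at_right 0. 2 \<le> cut_level I \<phi> J \<delta> \<and> \<delta> < c ^ (cut_level I \<phi> J \<delta> - 1) \<and> 0 < \<delta> \<and> \<delta> < 1"
    using cut_set_length_eventually[of 2] eventually_at_right_real[OF zero_less_one]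
  proof eventually_elim
    case (elim \<delta>)
    then obtain u where u: "u \<in> K \<delta>" "length u = cut_level I \<phi> J \<delta>" using cut_level_attained[of \<delta>] by auto
    then show ?case using cut_set_less_power[OF u(1)] elim by auto
  qed
  have n: "\<forall>\<^sub>F \<delta> in at_right 0. 0 < ?n \<delta>" using level by eventually_elim simp
  have pos: "\<forall>\<^sub>F \<delta> in at_right 0. \<forall>s. 0 < Z q s (K \<delta>)"
    using level by eventually_elim (use Z_cut_set_pos in blast)
  have decay: "\<forall>\<^sub>F \<delta> in at_right 0. \<forall>s s'. s \<le> s' \<longrightarrow>
      Z q s' (K \<delta>) \<le> exp (- ((s' - s) * (- ln c / 2) * ?n \<delta>)) * Z q s (K \<delta>)"
    using level
  proof eventually_elim
    case (elim \<delta>)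
    show ?case
    proof (intro allI impI)
      fix s s' :: real assume s: "s \<le> s'"
      have "ln \<delta> \<le> ln (c ^ (cut_level I \<phi> J \<delta> - 1))" using elim by (intro ln_mono) auto
      also have "\<dots> = (?n \<delta> - 1) * ln c" using elim c_pos by (simp add: ln_realpow of_nat_diff)
      also have "\<dots> \<le> ?n \<delta> / 2 * ln c" using elim c_pos c_less by (intro mult_right_mono_neg) auto
      finally have "(s' - s) * ln \<delta> \<le> (s' - s) * (?n \<delta> / 2 * ln c)" using s by (intro mult_left_mono) auto
      also have "\<dots> = - ((s' - s) * (- ln c / 2) * ?n \<delta>)" by simp
      finally have "\<delta> powr (s' - s) \<le> exp (- ((s' - s) * (- ln c / 2) * ?n \<delta>))"
        using elim by (simp add: powr_def)
      then have "\<delta> powr (s' - s) * Z q s (K \<delta>) \<le> exp (- ((s' - s) * (- ln c / 2) * ?n \<delta>)) * Z q s (K \<delta>)"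
        by (intro mult_right_mono Z_nonneg)
      then show "Z q s' (K \<delta>) \<le> exp (- ((s' - s) * (- ln c / 2) * ?n \<delta>)) * Z q s (K \<delta>)"
        using Z_cut_set_decay[OF s, of q \<delta>] by linarith
    qed
  qed
  show "upper_cut_jump I \<phi> J \<mu> q =
      Inf (ereal ` {t. \<forall>\<^sub>F \<delta> in at_right 0. Z q (t * (1 - q)) (K \<delta>) \<le> 1})" if "q < 1"
    unfolding upper_cut_jump_def upper_cut_pressure_def cut_pressure_term_def pressure_sum_eq_Z
    by (rule jump_point_Limsup[OF n pos l decay that])
  show "lower_cut_jump I \<phi> J \<mu> q =
      Inf (ereal ` {t. \<not> (\<forall>\<^sub>F \<delta> in at_right 0. Z q (t * (1 - q)) (K \<delta>) \<le> 1)})" if "1 < q"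
    unfolding lower_cut_jump_def lower_cut_pressure_def cut_pressure_term_def pressure_sum_eq_Z
    by (rule jump_point_Liminf[OF n pos l decay that])
qed

lemma level_jump_eq_cut_jump:
  shows "q < 1 \<Longrightarrow> upper_level_jump I \<phi> J \<mu> q = upper_cut_jump I \<phi> J \<mu> q"
    and "1 < q \<Longrightarrow> lower_level_jump I \<phi> J \<mu> q = lower_cut_jump I \<phi> J \<mu> q"
proof -
  let ?A = "\<lambda>s. \<forall>\<^sub>F k in sequentially. Z q s (words I 1 k) \<le> 1"
  let ?B = "\<lambda>s. \<forall>\<^sub>F \<delta> in at_right 0. Z q s (K \<delta>) \<le> 1"
  have AB: "\<And>s s'. s < s' \<Longrightarrow> ?A s \<Longrightarrow> ?B s'" and BA: "\<And>s s'. s < s' \<Longrightarrow> ?B s \<Longrightarrow> ?A s'"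
    using level_imp_cut_threshold cut_imp_level_threshold by blast+
  show "upper_level_jump I \<phi> J \<mu> q = upper_cut_jump I \<phi> J \<mu> q" if "q < 1"
    unfolding level_jump_eq(1)[OF that] cut_jump_eq(1)[OF that]
    by (rule antisym)
      (rule Inf_threshold_mono_pos[of ?B ?A, OF BA], assumption+, use that in simp,
       rule Inf_threshold_mono_pos[of ?A ?B, OF AB], assumption+, use that in simp)
  show "lower_level_jump I \<phi> J \<mu> q = lower_cut_jump I \<phi> J \<mu> q" if "1 < q"
    unfolding level_jump_eq(2)[OF that] cut_jump_eq(2)[OF that]
    by (rule antisym)
      (rule Inf_threshold_mono_neg[of ?A ?B, OF AB], assumption+, use that in simp,
       rule Inf_threshold_mono_neg[of ?B ?A, OF BA], assumption+, use that in simp)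
qed

section \<open>Mesh sums and dimensions\<close>

text \<open>A finite set of cubes that carries all the mass: a point coded by an infinite word lies
  in \<open>Jw u\<close> for some cut word \<open>u\<close>.\<close>

definition hit_cubes :: "real \<Rightarrow> (real^'n) set set" where
  "hit_cubes \<delta> = {Q \<in> mesh_cubes \<delta>. \<exists>u\<in>K \<delta>. Jw u \<inter> Q \<noteq> {}}"

definition mesh_sum :: "real \<Rightarrow> real \<Rightarrow> real" where
  "mesh_sum q \<delta> = (\<Sum>Q\<in>hit_cubes \<delta>. measure \<nu> Q powr q)"

lemma finite_hit_cubes:
  assumes "0 < \<delta>"
  shows "finite (hit_cubes \<delta>)"
proof -
  have "hit_cubes \<delta> = (\<Union>u\<in>K \<delta>. {Q \<in> mesh_cubes \<delta>. Jw u \<inter> Q \<noteq> {}})" unfolding hit_cubes_def by blast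
  moreover have "finite {Q \<in> mesh_cubes \<delta>. Jw u \<inter> Q \<noteq> {}}" if "u \<in> K \<delta>" for u
    by (rule Jw_mesh_count) (use assms that in blast)
  ultimately show ?thesis using finite_cut_set[OF assms] by simp
qed

text \<open>An infinite word coding a point of \<open>Q\<close> has a prefix in the cut, and the set
  of that prefix contains the point.\<close>

lemma measure_cube_le:
  assumes \<delta>: "0 < \<delta>" "\<delta> < 1" and Q: "Q \<in> mesh_cubes \<delta>"
  shows "measure \<nu> Q \<le> (\<Sum>u | u \<in> K \<delta> \<and> Jw u \<inter> Q \<noteq> {}. m u)"
proof -
  let ?U = "{u \<in> K \<delta>. Jw u \<inter> Q \<noteq> {}}"
  have fin: "finite ?U" using finite_cut_set[OF \<delta>(1)] by simp
  have "coding_map Jw -` Q \<inter> inf_words I \<subseteq> (\<Union>u\<in>?U. cylinder I u)"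
  proof
    fix v assume v: "v \<in> coding_map Jw -` Q \<inter> inf_words I"
    then obtain n where n: "word_prefix v n \<in> K \<delta>" using cut_set_prefix \<delta> by blast
    moreover have "coding_map Jw v \<in> Jw (word_prefix v n) \<inter> Q" using v coding_map_mem by blast
    ultimately have "word_prefix v n \<in> ?U" by blast
    then show "v \<in> (\<Union>u\<in>?U. cylinder I u)" using v by (auto simp: cylinder_def)
  qed
  then have "measure \<mu> (coding_map Jw -` Q \<inter> inf_words I) \<le> measure \<mu> (\<Union>u\<in>?U. cylinder I u)"
    using fin by (intro finite_measure_mono) auto
  also have "\<dots> \<le> (\<Sum>u\<in>?U. m u)" using fin by (intro finite_measure_subadditive_finite) auto
  finally show ?thesis by (simp add: measure_\<nu> mesh_cubes_borel[OF Q])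
qed

text \<open>The coded point of a word in the cylinder lies in \<open>Jw u\<close> and in some mesh
  cube, which therefore meets \<open>Jw u\<close>.\<close>

lemma measure_cylinder_le:
  assumes \<delta>: "0 < \<delta>" and u: "u \<in> K \<delta>"
  shows "m u \<le> (\<Sum>Q | Q \<in> hit_cubes \<delta> \<and> Jw u \<inter> Q \<noteq> {}. measure \<nu> Q)"
proof -
  let ?P = "{Q \<in> hit_cubes \<delta>. Jw u \<inter> Q \<noteq> {}}"
  have fin: "finite ?P" using finite_hit_cubes[OF \<delta>] by simp
  have meas: "coding_map Jw -` Q \<inter> inf_words I \<in> sets \<mu>" if "Q \<in> ?P" for Q
    using measurable_sets[OF coding_map_borel, of Q] that mesh_cubes_borel
    unfolding hit_cubes_def by (auto simp: space_\<mu>)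
  have "cylinder I u \<subseteq> (\<Union>Q\<in>?P. coding_map Jw -` Q \<inter> inf_words I)"
  proof
    fix v assume v: "v \<in> cylinder I u"
    obtain Q where Q: "Q \<in> mesh_cubes \<delta>" "coding_map Jw v \<in> Q" using mesh_cubes_cover[OF \<delta>] by metis
    have "coding_map Jw v \<in> Jw u" using coding_map_mem[of v "length u"] v by (auto simp: cylinder_def)
    then have "Q \<in> ?P" using Q u unfolding hit_cubes_def by blast
    then show "v \<in> (\<Union>Q\<in>?P. coding_map Jw -` Q \<inter> inf_words I)" using Q v by (auto simp: cylinder_def)
  qed
  then have "m u \<le> measure \<mu> (\<Union>Q\<in>?P. coding_map Jw -` Q \<inter> inf_words I)"
    by (rule finite_measure_mono) (rule sets.finite_UN[OF fin meas])
  also have "\<dots> \<le> (\<Sum>Q\<in>?P. measure \<mu> (coding_map Jw -` Q \<inter> inf_words I))"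
    by (rule finite_measure_subadditive_finite[OF fin]) (use meas in blast)
  also have "\<dots> = (\<Sum>Q\<in>?P. measure \<nu> Q)"
    by (intro sum.cong) (auto simp: measure_\<nu> mesh_cubes_borel hit_cubes_def)
  finally show ?thesis .
qed

lemma infsum_mesh_cubes:
  assumes \<delta>: "0 < \<delta>" "\<delta> < 1"
  shows "(\<Sum>\<^sub>\<infinity>Q\<in>mesh_cubes \<delta>. ennreal (measure \<nu> Q powr q)) = ennreal (mesh_sum q \<delta>)"
proof -
  have "(\<Sum>\<^sub>\<infinity>Q\<in>mesh_cubes \<delta>. ennreal (measure \<nu> Q powr q))
      = (\<Sum>\<^sub>\<infinity>Q\<in>hit_cubes \<delta>. ennreal (measure \<nu> Q powr q))"
  proof (rule infsum_cong_neutral)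
    fix Q assume "Q \<in> mesh_cubes \<delta> - hit_cubes \<delta>"
    then have Q: "Q \<in> mesh_cubes \<delta>" and E: "{u \<in> K \<delta>. Jw u \<inter> Q \<noteq> {}} = {}"
      unfolding hit_cubes_def by blast+
    have "measure \<nu> Q \<le> 0" using measure_cube_le[OF \<delta> Q] unfolding E by simp
    then show "ennreal (measure \<nu> Q powr q) = 0" by (simp add: measure_le_0_iff)
  qed (auto simp: hit_cubes_def)
  also have "\<dots> = ennreal (mesh_sum q \<delta>)"
    unfolding mesh_sum_def using finite_hit_cubes[OF \<delta>(1)] by (simp add: sum_ennreal)
  finally show ?thesis .
qed

section \<open>Comparison of mesh sums and cut sums\<close>

text \<open>Double counting in both directions. The number of sets per cube, of order
  \<open>\<delta> powr (- \<kappa>)\<close>, enters with power \<open>q\<close> when cubes are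
  estimated by words and with power 1 in the other direction.\<close>

lemma mesh_sum_bounds:
  assumes osc: "open_set_condition I Jw"
    and lim: "(\<lambda>k. ln (min_level_deriv_norm I \<phi> J k) / ln (max_deriv_norm I \<phi> J k)) \<longlonglongrightarrow> 0"
    and \<kappa>: "0 < \<kappa>" and q: "0 < q"
  obtains D where "0 < D"
    "\<forall>\<^sub>F \<delta> in at_right 0. mesh_sum q \<delta> \<le> D * \<delta> powr (- \<kappa> * q) * Z q 0 (K \<delta>) \<and>
       Z q 0 (K \<delta>) \<le> D * \<delta> powr (- \<kappa>) * mesh_sum q \<delta>"
proof -
  obtain A where A: "0 < A"
    "\<forall>\<^sub>F \<delta> in at_right 0. \<forall>Q\<in>mesh_cubes \<delta>. real (card {u \<in> K \<delta>. Jw u \<inter> Q \<noteq> {}}) \<le> A * \<delta> powr (- \<kappa>)"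
    using cut_set_hit_count[OF osc lim \<kappa>] .
  obtain B where B: "0 < B" "\<And>\<delta> u. 0 < \<delta> \<Longrightarrow> u \<in> K \<delta> \<Longrightarrow> finite {Q \<in> mesh_cubes \<delta>. Jw u \<inter> Q \<noteq> {}} \<and>
       real (card {Q \<in> mesh_cubes \<delta>. Jw u \<inter> Q \<noteq> {}}) \<le> B"
    by (rule Jw_mesh_count) (rule that, assumption, blast)
  define D where "D = max (A powr q * B) (B powr q * A)"
  show thesis
  proof (rule that[of D])
    show "0 < D" unfolding D_def using A(1) B(1) by (simp add: less_max_iff_disj)
    show "\<forall>\<^sub>F \<delta> in at_right 0. mesh_sum q \<delta> \<le> D * \<delta> powr (- \<kappa> * q) * Z q 0 (K \<delta>) \<and>
       Z q 0 (K \<delta>) \<le> D * \<delta> powr (- \<kappa>) * mesh_sum q \<delta>"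
      using A(2) eventually_at_right_real[OF zero_less_one]
    proof eventually_elim
      case (elim \<delta>)
      then have \<delta>: "0 < \<delta>" "\<delta> < 1" by auto
      \<comment> \<open>Positivity of \<open>r u\<close> matters here, because
        \<open>0 powr 0 = 0\<close>.\<close>
      have Z0: "Z q 0 (K \<delta>) = (\<Sum>u\<in>K \<delta>. m u powr q)"
        unfolding Z_def by (rule sum.cong) (use r_pos cut_setD(1) in \<open>force\<close>)+
      have hm: "hit_cubes \<delta> \<subseteq> mesh_cubes \<delta>" unfolding hit_cubes_def by blast
      have cU: "real (card {u \<in> K \<delta>. Jw u \<inter> Q \<noteq> {}}) \<le> A * \<delta> powr (- \<kappa>)" if "Q \<in> hit_cubes \<delta>" for Q
        using elim(1) that hm by blast
      have cP: "real (card {Q \<in> hit_cubes \<delta>. Jw u \<inter> Q \<noteq> {}}) \<le> B" if u: "u \<in> K \<delta>" for u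
      proof -
        have "card {Q \<in> hit_cubes \<delta>. Jw u \<inter> Q \<noteq> {}} \<le> card {Q \<in> mesh_cubes \<delta>. Jw u \<inter> Q \<noteq> {}}"
          by (rule card_mono) (use B(2)[OF \<delta>(1) u] hm in auto)
        then show ?thesis using B(2)[OF \<delta>(1) u] by linarith
      qed
      have "mesh_sum q \<delta> \<le> (A * \<delta> powr (- \<kappa>)) powr q * B * (\<Sum>u\<in>K \<delta>. m u powr q)"
        unfolding mesh_sum_def
        by (rule double_counting_powr[where R = "\<lambda>u Q. Jw u \<inter> Q \<noteq> {}"])
          (use finite_cut_set finite_hit_cubes \<delta> q cU cP measure_cube_le hm in auto)
      also have "\<dots> = A powr q * B * (\<delta> powr (- \<kappa> * q) * Z q 0 (K \<delta>))"
        using A(1) by (simp add: Z0 powr_mult powr_powr mult_ac)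
      also have "\<dots> \<le> D * (\<delta> powr (- \<kappa> * q) * Z q 0 (K \<delta>))"
        unfolding D_def by (intro mult_right_mono mult_nonneg_nonneg Z_nonneg) auto
      finally have 1: "mesh_sum q \<delta> \<le> D * \<delta> powr (- \<kappa> * q) * Z q 0 (K \<delta>)" by (simp add: mult.assoc)
      have "Z q 0 (K \<delta>) \<le> B powr q * (A * \<delta> powr (- \<kappa>)) * mesh_sum q \<delta>"
        unfolding mesh_sum_def Z0
        by (rule double_counting_powr[where R = "\<lambda>Q u. Jw u \<inter> Q \<noteq> {}"])
          (use finite_cut_set finite_hit_cubes \<delta> q cU cP measure_cylinder_le in auto)
      also have "\<dots> = B powr q * A * (\<delta> powr (- \<kappa>) * mesh_sum q \<delta>)" by (simp add: mult_ac)
      also have "\<dots> \<le> D * (\<delta> powr (- \<kappa>) * mesh_sum q \<delta>)"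
        unfolding D_def mesh_sum_def by (intro mult_right_mono mult_nonneg_nonneg sum_nonneg) auto
      finally have 2: "Z q 0 (K \<delta>) \<le> D * \<delta> powr (- \<kappa>) * mesh_sum q \<delta>" by (simp add: mult.assoc)
      show ?case using 1 2 by blast
    qed
  qed
qed

text \<open>On the cut, \<open>r u\<close> lies between \<open>\<delta> powr (1 + \<kappa>)\<close>
  and \<open>\<delta>\<close>. Replacing it by \<open>\<delta>\<close> changes the exponent by at
  most \<open>\<kappa> * \<bar>s\<bar>\<close>, whatever the sign of \<open>s\<close>.\<close>

lemma Z_cut_set_exponent_bounds:
  assumes lim: "(\<lambda>k. ln (min_level_deriv_norm I \<phi> J k) / ln (max_deriv_norm I \<phi> J k)) \<longlonglongrightarrow> 0"
    and \<kappa>: "0 < \<kappa>"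
  shows "\<forall>\<^sub>F \<delta> in at_right 0. \<forall>s. \<delta> powr (s + \<kappa> * \<bar>s\<bar>) * Z q 0 (K \<delta>) \<le> Z q s (K \<delta>) \<and>
    Z q s (K \<delta>) \<le> \<delta> powr (s - \<kappa> * \<bar>s\<bar>) * Z q 0 (K \<delta>)"
  using cut_set_r_ge[OF lim \<kappa>] eventually_at_right_real[OF zero_less_one]
proof eventually_elim
  case (elim \<delta>)
  then have \<delta>: "0 < \<delta>" "\<delta> < 1" by auto
  have *: "\<delta> powr (s + \<kappa> * \<bar>s\<bar>) \<le> r u powr s \<and> r u powr s \<le> \<delta> powr (s - \<kappa> * \<bar>s\<bar>)"
    if u: "u \<in> K \<delta>" for u s
  proof -
    have ru: "0 < r u" "r u \<le> \<delta>" "\<delta> powr (1 + \<kappa>) \<le> r u"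
      using r_pos[OF cut_setD(1)[OF u]] cut_setD(3)[OF u] elim(1) u by auto
    have le: "ln (r u) \<le> ln \<delta>" using ru by (intro ln_mono) auto
    have "ln (\<delta> powr (1 + \<kappa>)) \<le> ln (r u)" using ru \<delta> by (intro ln_mono) auto
    then have ge: "(1 + \<kappa>) * ln \<delta> \<le> ln (r u)" using \<delta> by (simp add: ln_powr)
    have "(s + \<kappa> * \<bar>s\<bar>) * ln \<delta> \<le> s * ln (r u) \<and> s * ln (r u) \<le> (s - \<kappa> * \<bar>s\<bar>) * ln \<delta>"
    proof -
      have l: "ln \<delta> < 0" using \<delta> by simp
      have k: "\<kappa> * \<bar>s\<bar> * ln \<delta> \<le> 0" using \<kappa> l by (intro mult_nonneg_nonpos) auto
      show ?thesis
      proof (cases "0 \<le> s")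
        case True
        have "s * ((1 + \<kappa>) * ln \<delta>) \<le> s * ln (r u)" "s * ln (r u) \<le> s * ln \<delta>"
          using True le ge by (auto intro: mult_left_mono)
        moreover have "s * ((1 + \<kappa>) * ln \<delta>) = (s + \<kappa> * \<bar>s\<bar>) * ln \<delta>"
          "(s - \<kappa> * \<bar>s\<bar>) * ln \<delta> = s * ln \<delta> - \<kappa> * \<bar>s\<bar> * ln \<delta>"
          using True by (simp_all add: algebra_simps)
        ultimately show ?thesis using k by linarith
      next
        case False
        have "s * ln (r u) \<le> s * ((1 + \<kappa>) * ln \<delta>)" "s * ln \<delta> \<le> s * ln (r u)"
          using False le ge by (auto intro: mult_left_mono_neg)
        moreover have "s * ((1 + \<kappa>) * ln \<delta>) = (s - \<kappa> * \<bar>s\<bar>) * ln \<delta>"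
          "(s + \<kappa> * \<bar>s\<bar>) * ln \<delta> = s * ln \<delta> + \<kappa> * \<bar>s\<bar> * ln \<delta>"
          using False by (simp_all add: algebra_simps)
        ultimately show ?thesis using k by linarith
      qed
    qed
    then show ?thesis using ru(1) \<delta> by (simp add: powr_def)
  qed
  have 0: "r u powr 0 = 1" if "u \<in> K \<delta>" for u using r_pos[OF cut_setD(1)[OF that]] by simp
  show ?case
    unfolding Z_def sum_distrib_left
    by (intro allI conjI sum_mono) (use * 0 in \<open>auto intro: mult_right_mono\<close>)
qed

lemma mesh_iff_cut_threshold:
  assumes osc: "open_set_condition I Jw"
    and lim: "(\<lambda>k. ln (min_level_deriv_norm I \<phi> J k) / ln (max_deriv_norm I \<phi> J k)) \<longlonglongrightarrow> 0"
    and q: "0 < q" and s: "s < s'"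
  shows "\<forall>\<^sub>F \<delta> in at_right 0. Z q s (K \<delta>) \<le> 1 \<Longrightarrow> \<forall>\<^sub>F \<delta> in at_right 0. mesh_sum q \<delta> * \<delta> powr s' \<le> 1"
    and "\<forall>\<^sub>F \<delta> in at_right 0. mesh_sum q \<delta> * \<delta> powr s \<le> 1 \<Longrightarrow> \<forall>\<^sub>F \<delta> in at_right 0. Z q s' (K \<delta>) \<le> 1"
proof -
  \<comment> \<open>Collects the coefficients of all losses, from the hit count and from replacing
    \<open>r u\<close> by \<open>\<delta>\<close>. With \<open>\<kappa>\<close> as below they use at
    most half of the gap \<open>s' - s\<close>; the other half, \<open>e\<close>, absorbs the
    constant \<open>D\<close>.\<close>
  define a where "a = q + \<bar>s\<bar> + \<bar>s'\<bar> + 1"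
  have a: "0 < a" unfolding a_def using q by simp
  define \<kappa> where "\<kappa> = (s' - s) / (2 * a)"
  have \<kappa>: "0 < \<kappa>" "\<kappa> * a = (s' - s) / 2" unfolding \<kappa>_def using s a by auto
  define e where "e = (s' - s) / 2"
  have e: "0 < e" unfolding e_def using s by simp
  have split: "\<kappa> * a = \<kappa> * q + \<kappa> * \<bar>s\<bar> + \<kappa> * \<bar>s'\<bar> + \<kappa>" unfolding a_def by (simp add: algebra_simps)
  have nn: "0 \<le> \<kappa> * q" "0 \<le> \<kappa> * \<bar>s\<bar>" "0 \<le> \<kappa> * \<bar>s'\<bar>" using \<kappa>(1) q by auto
  have ee: "e + e = s' - s" unfolding e_def by simp
  have "x + y \<le> e \<and> z + w \<le> e" if "e = x + y + z + w" "0 \<le> x" "0 \<le> y" "0 \<le> z" "0 \<le> w" for x y z w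
    using that by linarith
  from this[OF _ nn less_imp_le[OF \<kappa>(1)]]
  have loss: "\<kappa> * q + \<kappa> * \<bar>s\<bar> \<le> e" "\<kappa> * \<bar>s'\<bar> + \<kappa> \<le> e" using split \<kappa>(2) unfolding e_def by auto
  have exponent: "e \<le> y - x - (z + x')" if "x + x' \<le> e" "e + e = y - z" for x x' y z
    using that by linarith
  obtain D where D: "0 < D"
    "\<forall>\<^sub>F \<delta> in at_right 0. mesh_sum q \<delta> \<le> D * \<delta> powr (- \<kappa> * q) * Z q 0 (K \<delta>) \<and>
       Z q 0 (K \<delta>) \<le> D * \<delta> powr (- \<kappa>) * mesh_sum q \<delta>"
    using mesh_sum_bounds[OF osc lim \<kappa>(1) q] .
  have small: "\<forall>\<^sub>F \<delta> in at_right 0. D * \<delta> powr e \<le> 1" by (rule eventually_const_powr_le_1[OF e])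
  note ev = D(2) Z_cut_set_exponent_bounds[OF lim \<kappa>(1), of q] small eventually_at_right_real[OF zero_less_one]
  show "\<forall>\<^sub>F \<delta> in at_right 0. mesh_sum q \<delta> * \<delta> powr s' \<le> 1"
    if "\<forall>\<^sub>F \<delta> in at_right 0. Z q s (K \<delta>) \<le> 1"
    using that ev
  proof eventually_elim
    case (elim \<delta>)
    then have \<delta>: "0 < \<delta>" "\<delta> < 1" by auto
    let ?x = "s + \<kappa> * \<bar>s\<bar>"
    have "mesh_sum q \<delta> * \<delta> powr s' \<le> D * \<delta> powr (- \<kappa> * q) * Z q 0 (K \<delta>) * \<delta> powr s'"
      using elim by (intro mult_right_mono) auto
    also have "\<dots> = D * \<delta> powr (s' - \<kappa> * q - ?x) * (\<delta> powr ?x * Z q 0 (K \<delta>))"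
      by (simp add: powr_diff powr_add powr_minus field_simps)
    also have "\<dots> \<le> D * \<delta> powr (s' - \<kappa> * q - ?x) * 1"
      using elim D(1) by (intro mult_left_mono) (auto intro: order_trans)
    also have "\<dots> \<le> D * \<delta> powr e * 1"
    proof (intro mult_mono mult_left_mono powr_mono')
      show "e \<le> s' - \<kappa> * q - ?x" by (rule exponent[OF loss(1) ee])
    qed (use \<delta> D(1) in auto)
    also have "\<dots> \<le> 1" using elim by simp
    finally show ?case .
  qed
  show "\<forall>\<^sub>F \<delta> in at_right 0. Z q s' (K \<delta>) \<le> 1"
    if "\<forall>\<^sub>F \<delta> in at_right 0. mesh_sum q \<delta> * \<delta> powr s \<le> 1"
    using that ev
  proof eventually_elim
    case (elim \<delta>)
    then have \<delta>: "0 < \<delta>" "\<delta> < 1" by auto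
    let ?x = "s' - \<kappa> * \<bar>s'\<bar>"
    have "Z q s' (K \<delta>) \<le> \<delta> powr ?x * Z q 0 (K \<delta>)" using elim by blast
    also have "\<dots> \<le> \<delta> powr ?x * (D * \<delta> powr (- \<kappa>) * mesh_sum q \<delta>)"
      using elim by (intro mult_left_mono) auto
    also have "\<dots> = D * \<delta> powr (?x - \<kappa> - s) * (mesh_sum q \<delta> * \<delta> powr s)"
      using \<delta> by (simp add: powr_diff powr_add powr_minus field_simps)
    also have "\<dots> \<le> D * \<delta> powr (?x - \<kappa> - s) * 1"
      using elim D(1) by (intro mult_left_mono) auto
    also have "\<dots> \<le> D * \<delta> powr e * 1"
    proof (intro mult_mono mult_left_mono powr_mono')
      show "e \<le> ?x - \<kappa> - s" using exponent[OF loss(2) ee] by (simp only: algebra_simps)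
    qed (use \<delta> D(1) in auto)
    also have "\<dots> \<le> 1" using elim by simp
    finally show ?case .
  qed
qed

lemma gen_dim_eq_cut_jump:
  assumes osc: "open_set_condition I Jw"
    and lim: "(\<lambda>k. ln (min_level_deriv_norm I \<phi> J k) / ln (max_deriv_norm I \<phi> J k)) \<longlonglongrightarrow> 0"
    and q: "0 < q"
  shows "q < 1 \<Longrightarrow> upper_gen_dim q \<nu> = upper_cut_jump I \<phi> J \<mu> q"
    and "1 < q \<Longrightarrow> lower_gen_dim q \<nu> = lower_cut_jump I \<phi> J \<mu> q"
proof -
  let ?A = "\<lambda>s. \<forall>\<^sub>F \<delta> in at_right 0. mesh_sum q \<delta> * \<delta> powr s \<le> 1"
  let ?B = "\<lambda>s. \<forall>\<^sub>F \<delta> in at_right 0. Z q s (K \<delta>) \<le> 1"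
  have AB: "\<And>s s'. s < s' \<Longrightarrow> ?A s \<Longrightarrow> ?B s'" and BA: "\<And>s s'. s < s' \<Longrightarrow> ?B s \<Longrightarrow> ?A s'"
    using mesh_iff_cut_threshold[OF osc lim q] by blast+
  \<comment> \<open>Any loss is acceptable here, so \<open>\<kappa> = 1\<close> is taken: the bound
    serves only to carry positivity from the cut sum to the mesh sum.\<close>
  obtain D where D: "0 < D"
    "\<forall>\<^sub>F \<delta> in at_right 0. mesh_sum q \<delta> \<le> D * \<delta> powr (- 1 * q) * Z q 0 (K \<delta>) \<and>
       Z q 0 (K \<delta>) \<le> D * \<delta> powr (- 1) * mesh_sum q \<delta>"
    using mesh_sum_bounds[OF osc lim zero_less_one q] .
  have pos: "\<forall>\<^sub>F \<delta> in at_right 0. 0 < mesh_sum q \<delta>"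
    using D(2) eventually_at_right_real[OF zero_less_one]
  proof eventually_elim
    case (elim \<delta>)
    then have "0 < D * \<delta> powr (- 1) * mesh_sum q \<delta>" using Z_cut_set_pos[of \<delta> q 0] by simp
    moreover have "0 < D * \<delta> powr (- 1)" using D(1) elim(2) by simp
    ultimately show ?case by (rule zero_less_mult_pos)
  qed
  have quot: "\<forall>\<^sub>F \<delta> in at_right 0.
      dim_quotient q \<nu> \<delta> = extended_ln (ennreal (mesh_sum q \<delta>)) / ereal ((q - 1) * ln \<delta>)"
    using eventually_at_right_real[OF zero_less_one]
    by eventually_elim (simp add: dim_quotient_def infsum_mesh_cubes)
  show "upper_gen_dim q \<nu> = upper_cut_jump I \<phi> J \<mu> q" if "q < 1"
    unfolding upper_gen_dim_def Limsup_eq[OF quot] Limsup_extended_ln_quotient[OF pos that] cut_jump_eq(1)[OF that]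
    by (rule antisym)
      (rule Inf_threshold_mono_pos[of ?B ?A, OF BA], assumption+, use that in simp,
       rule Inf_threshold_mono_pos[of ?A ?B, OF AB], assumption+, use that in simp)
  show "lower_gen_dim q \<nu> = lower_cut_jump I \<phi> J \<mu> q" if "1 < q"
    unfolding lower_gen_dim_def Liminf_eq[OF quot] Liminf_extended_ln_quotient[OF pos that] cut_jump_eq(2)[OF that]
    by (rule antisym)
      (rule Inf_threshold_mono_neg[of ?A ?B, OF AB], assumption+, use that in simp,
       rule Inf_threshold_mono_neg[of ?B ?A, OF BA], assumption+, use that in simp)
qed

end

section \<open>From the system to the locale, and the theorem\<close>

lemma ncifs_conformal_system:
  assumes "ncifs I \<phi> J Jw"
  obtains V c C where "conformal_system I \<phi> J Jw V c C"
proof -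
  note n1 = assms[unfolded ncifs_def]
  note n2 = n1[THEN conjunct2]
  note n3 = n2[THEN conjunct2]
  note n4 = n3[THEN conjunct2]
  note n5 = n4[THEN conjunct2]
  note n6 = n5[THEN conjunct2]
  note n7 = n6[THEN conjunct2]
  note n8 = n7[THEN conjunct2]
  note n9 = n8[THEN conjunct2]
  note n10 = n9[THEN conjunct2]
  note I = n1[THEN conjunct1, rule_format]
  note J = n2[THEN conjunct1] n3[THEN conjunct1] n4[THEN conjunct1]
  note map_J = n5[THEN conjunct1, rule_format]
  note Nil = n7[THEN conjunct1]
  note nest = n9[THEN conjunct1, rule_format]
  note img = n10[THEN conjunct1, rule_format]
  obtain c where c: "0 < c" "c < 1" and
    contr: "\<forall>k\<ge>1. \<forall>i\<in>I k. \<forall>x\<in>J. \<forall>y\<in>J. dist (\<phi> k i x) (\<phi> k i y) \<le> c * dist x y"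
    using n8[THEN conjunct1] by (elim exE conjE)
  obtain V C where V: "open V" "connected V" "J \<subseteq> V"
    and ext: "\<forall>k\<ge>1. \<forall>i\<in>I k. C1_conformal_diffeo_into V (\<phi> k i)"
    and C: "1 \<le> C" and dist: "\<forall>l k. 1 \<le> l \<and> l \<le> k \<longrightarrow> (\<forall>u\<in>words I l k. \<forall>x\<in>V. \<forall>y\<in>V.
      deriv_norm (word_map \<phi> l u) x \<le> C * deriv_norm (word_map \<phi> l u) y)"
    using n10[THEN conjunct2] by (elim exE conjE)
  note diffeo = ext[rule_format]
  have "conformal_system I \<phi> J Jw V c C"
  proof
    fix k :: nat assume k: "1 \<le> k"
    show "finite (I k)" using I[OF k] by simp
    show "I k \<noteq> {}" using I[OF k] by auto
    fix i assume i: "i \<in> I k"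
    show "\<phi> k i ` J \<subseteq> J" by (rule map_J[OF k i])
    show "\<phi> k i ` V \<subseteq> V" using diffeo[OF k i] unfolding C1_conformal_diffeo_into_def by blast
    show "inj_on (\<phi> k i) V"
      using diffeo[OF k i] unfolding C1_conformal_diffeo_into_def by (metis inj_on_inverseI)
    show "conformal_at (\<phi> k i) x" if "x \<in> V" for x
      using diffeo[OF k i] that unfolding C1_conformal_diffeo_into_def by blast
    show "dist (\<phi> k i x) (\<phi> k i y) \<le> c * dist x y" if "x \<in> J" "y \<in> J" for x y
      by (rule contr[rule_format, OF k i that])
  next
    fix u i assume "u @ [i] \<in> fin_words I"
    then have "u \<in> words I 1 (Suc (length u) - 1)" "i \<in> I (Suc (length u))"
      unfolding snoc_fin_words words_1_iff by auto
    then show "Jw (u @ [i]) \<subseteq> Jw u" using nest[of "Suc (length u)"] by simp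
  next
    fix u x y assume "u \<in> fin_words I" "u \<noteq> []" "x \<in> V" "y \<in> V"
    \<comment> \<open>The distortion bound is stated for \<open>l \<le> k\<close>; with
      \<open>l = 1\<close> this concerns the nonempty words.\<close>
    moreover have "1 \<le> length u" using \<open>u \<noteq> []\<close> by (simp add: Suc_le_eq)
    ultimately show "deriv_norm (word_map \<phi> 1 u) x \<le> C * deriv_norm (word_map \<phi> 1 u) y"
      by (intro dist[rule_format, of 1 "length u"]) (auto simp: words_1_iff[unfolded One_nat_def])
  qed (use J Nil c V C img in auto)
  then show thesis by (rule that)
qed

theorem theorem1p3:
  fixes I :: "nat \<Rightarrow> 'i set"
    and \<phi> :: "nat \<Rightarrow> 'i \<Rightarrow> real^'n \<Rightarrow> real^'n"
    and J :: "(real^'n) set"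
    and Jw :: "'i list \<Rightarrow> (real^'n) set"
    and \<mu> :: "(nat \<Rightarrow> 'i) measure"
  assumes ncifs: "ncifs I \<phi> J Jw"
    and osc: "open_set_condition I Jw"
    and lim: "(\<lambda>k. ln (min_level_deriv_norm I \<phi> J k) / ln (max_deriv_norm I \<phi> J k)) \<longlonglongrightarrow> 0"
    and borel: "sets \<mu> = sets (word_borel I)"
    and finite: "finite_measure \<mu>"
    and positive: "emeasure \<mu> (inf_words I) > 0"
    and overlap: "bounded_overlap I Jw \<mu>"
  shows "(\<forall>q>1. lower_gen_dim q (image_measure Jw \<mu>) = lower_level_jump I \<phi> J \<mu> q \<and>
                lower_level_jump I \<phi> J \<mu> q = lower_cut_jump I \<phi> J \<mu> q) \<and>
         (\<forall>q. 0 < q \<and> q < 1 \<longrightarrow>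
                upper_gen_dim q (image_measure Jw \<mu>) = upper_level_jump I \<phi> J \<mu> q \<and>
                upper_level_jump I \<phi> J \<mu> q = upper_cut_jump I \<phi> J \<mu> q)"
proof -
  obtain V c C where "conformal_system I \<phi> J Jw V c C"
    using ncifs by (rule ncifs_conformal_system)
  then interpret conformal_system I \<phi> J Jw V c C .
  interpret finite_measure \<mu> by (rule finite)
  interpret measured_conformal_system I \<phi> J Jw V c C \<mu>
    by unfold_locales (use borel positive in auto)
  show ?thesis
    using gen_dim_eq_cut_jump[OF osc lim] level_jump_eq_cut_jump by simp
qed

end
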